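(* Let $d\ge1$ and let $\mu$ be the measure on $\mathbb N_0^d\times\mathbb R_-$ given by $d\mu(\alpha,\lambda)=\alpha!\,(2/|\lambda|)^{|\alpha|}|\lambda|^{2d}\,d\alpha\,d\lambda$, where $d\alpha$ is counting measure on $\mathbb N_0^d$ and $d\lambda$ is Lebesgue measure on $\mathbb R_-=(-\infty,0)$. Define, for $\varphi\in L^2(\mathbb N_0^d\times\mathbb R_-,d\mu)$ and $(\zeta,\zeta_{d+1})\in\mathcal U$, $$(\mathscr S\varphi)(\zeta,\zeta_{d+1})=\frac{1}{(2\pi)^{d+1}}\int_{\mathbb N_0^d\times\mathbb R_-}\zeta^\alpha e^{-i\lambda\zeta_{d+1}}\overline{\varphi(\alpha,\lambda)}\,|\lambda|^d\,d\alpha\,d\lambda .$$ Then $\mathscr S$ is a conjugate-linear bijection of $L^2(\mathbb N_0^d\times\mathbb R_-,d\mu)$ onto $DA$, and it is an isometry up to normalization of the norm: for each integer $n>d/2$ there is a constant $c>0$ depending only on $d,n$ such that $\|\mathscr S\varphi\|_{DA_{(n)}}=c\,\|\varphi\|_{L^2(d\mu)}$ for all $\varphi$.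
   Context: $\zeta^\alpha=\zeta_1^{\alpha_1}\cdots\zeta_d^{\alpha_d}$, $\alpha!=\alpha_1!\cdots\alpha_d!$, $|\alpha|=\alpha_1+\dots+\alpha_d$. $\mathcal U=\{(\zeta,\zeta_{d+1})\in\mathbb C^d\times\mathbb C:\operatorname{Im}\zeta_{d+1}>\frac14|\zeta|^2\}$, $\rho=\operatorname{Im}\zeta_{d+1}-\frac14|\zeta|^2$. For an integer $n>d/2$, $DA_{(n)}$ is the space of holomorphic $F$ on $\mathcal U$ with $F(\zeta,\zeta_{d+1})\to0$ as $\operatorname{Im}\zeta_{d+1}\to+\infty$ uniformly on $|\zeta|\le R$ for each $R$, and $\|F\|^2_{DA_{(n)}}=\int_{\mathcal U}|\rho^n\partial^n_{\zeta_{d+1}}F|^2\rho^{-d-1}dV<\infty$. As sets these spaces coincide for all such $n$ and are denoted $DA$ (Drury--Arveson space on $\mathcal U$). *)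

theory Defs
  imports "HOL-Analysis.Analysis"
begin

text \<open>Points of C^d x C are pairs (zeta, zeta_{d+1}) with zeta :: complex^'n, d = CARD('n).
  Multi-indices are functions 'n => nat.\<close>

definition mfact :: "('n::finite \<Rightarrow> nat) \<Rightarrow> real" where
  "mfact \<alpha> = (\<Prod>i\<in>UNIV. fact (\<alpha> i))"

definition msize :: "('n::finite \<Rightarrow> nat) \<Rightarrow> nat" where
  "msize \<alpha> = (\<Sum>i\<in>UNIV. \<alpha> i)"

definition mpow :: "complex ^ 'n::finite \<Rightarrow> ('n \<Rightarrow> nat) \<Rightarrow> complex" where
  "mpow z \<alpha> = (\<Prod>i\<in>UNIV. (z $ i) ^ (\<alpha> i))"

definition rho :: "(complex ^ 'n::finite) \<times> complex \<Rightarrow> real" where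
  "rho z = Im (snd z) - (norm (fst z))\<^sup>2 / 4"

definition siegelU :: "((complex ^ 'n::finite) \<times> complex) set" where
  "siegelU = {z. rho z > 0}"

definition cscale :: "complex \<Rightarrow> (complex ^ 'n::finite) \<times> complex \<Rightarrow> (complex ^ 'n) \<times> complex" where
  "cscale c z = ((\<chi> i. c * (fst z $ i)), c * snd z)"

definition holomorphic_several ::
  "((complex ^ 'n::finite) \<times> complex \<Rightarrow> complex) \<Rightarrow> ((complex ^ 'n) \<times> complex) set \<Rightarrow> bool" where
  "holomorphic_several F S \<longleftrightarrow>
     (\<forall>z\<in>S. \<exists>D. (F has_derivative D) (at z) \<and> (\<forall>c v. D (cscale c v) = c * D v))"

definition dlast :: "nat \<Rightarrow> ((complex ^ 'n::finite) \<times> complex \<Rightarrow> complex) \<Rightarrow> (complex ^ 'n) \<times> complex \<Rightarrow> complex" where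
  "dlast n F z = (deriv ^^ n) (\<lambda>w. F (fst z, w)) (snd z)"

definition DA_normsq :: "nat \<Rightarrow> ((complex ^ 'n::finite) \<times> complex \<Rightarrow> complex) \<Rightarrow> ennreal" where
  "DA_normsq n F = (\<integral>\<^sup>+ z. indicator siegelU z *
      ennreal ((cmod ((rho z) ^ n * dlast n F z))\<^sup>2 * (rho z) powr (- real CARD('n) - 1)) \<partial>lborel)"

definition DA_norm :: "nat \<Rightarrow> ((complex ^ 'n::finite) \<times> complex \<Rightarrow> complex) \<Rightarrow> real" where
  "DA_norm n F = sqrt (enn2real (DA_normsq n F))"

definition DA_n :: "nat \<Rightarrow> ((complex ^ 'n::finite) \<times> complex \<Rightarrow> complex) set" where
  "DA_n n = {F. holomorphic_several F siegelU \<and>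
      (\<forall>R \<epsilon>. R > 0 \<longrightarrow> \<epsilon> > 0 \<longrightarrow> (\<exists>T. \<forall>\<zeta> w. (\<zeta>, w) \<in> siegelU \<longrightarrow> norm \<zeta> \<le> R \<longrightarrow> Im w > T
            \<longrightarrow> cmod (F (\<zeta>, w)) < \<epsilon>)) \<and>
      DA_normsq n F < \<infinity>}"

text \<open>Drury--Arveson space: the common underlying set of DA_(n), n > d/2.\<close>
definition DA :: "((complex ^ 'n::finite) \<times> complex \<Rightarrow> complex) set" where
  "DA = (\<Union>n\<in>{n. 2 * n > CARD('n)}. DA_n n)"

definition base_meas :: "(('n::finite \<Rightarrow> nat) \<times> real) measure" where
  "base_meas = count_space UNIV \<Otimes>\<^sub>M lborel"

definition mu :: "(('n::finite \<Rightarrow> nat) \<times> real) measure" where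
  "mu = density base_meas (\<lambda>(\<alpha>, l). if l < 0 then
      ennreal (mfact \<alpha> * (2 / \<bar>l\<bar>) ^ msize \<alpha> * \<bar>l\<bar> ^ (2 * CARD('n))) else 0)"

definition L2mu :: "(('n::finite \<Rightarrow> nat) \<times> real \<Rightarrow> complex) set" where
  "L2mu = {\<phi>. \<phi> \<in> borel_measurable mu \<and> integrable mu (\<lambda>x. (cmod (\<phi> x))\<^sup>2)}"

definition L2norm :: "(('n::finite \<Rightarrow> nat) \<times> real \<Rightarrow> complex) \<Rightarrow> real" where
  "L2norm \<phi> = sqrt (\<integral>x. (cmod (\<phi> x))\<^sup>2 \<partial>(mu :: (('n \<Rightarrow> nat) \<times> real) measure))"

definition Strans :: "(('n::finite \<Rightarrow> nat) \<times> real \<Rightarrow> complex) \<Rightarrow> (complex ^ 'n) \<times> complex \<Rightarrow> complex" where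
  "Strans \<phi> z = (1 / (2 * complex_of_real pi) ^ (CARD('n) + 1)) *
     (\<integral>x. (if snd x < 0 then mpow (fst z) (fst x) * exp (- \<i> * complex_of_real (snd x) * snd z)
              * cnj (\<phi> x) * complex_of_real (\<bar>snd x\<bar> ^ CARD('n)) else 0) \<partial>base_meas)"

end

theory Submission
  imports Defs "HOL-Complex_Analysis.Complex_Analysis" "HOL-Probability.Probability" "HOL-Real_Asymp.Real_Asymp"
begin

text \<open>
  The n-th derivative in the last variable of the transform of phi is, up to a constant, the pairing
  of phi in L2(mu) with a coherent state at z. The Gram matrix of these coherent states is a negative
  power of i(cnj w' - w) - <zeta, zeta'>/2, that is, the reproducing kernel of the Bergman space with
  weight rho^(2n-d-1) on the Siegel domain. The reproducing property of this kernel comes from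
  averaging over rotations of the ball fibers over a fixed last coordinate, which leaves an integral
  over the half-plane; there the horizontal integrals are evaluated by residues and the vertical
  one by repeated integration by parts. Heisenberg translations move the formula to all points.

  Hence the derivative of the transform is isometric, up to a constant, on coherent states. These
  are total in L2(mu): integration over a torus isolates the component of each multi-index, whose
  Fourier transform then vanishes. Orthogonal projection extends the isometry to L2(mu), and it gives
  surjectivity because a Bergman function orthogonal to all kernels is zero. Finally a function in DA
  is recovered from its n-th derivative by its vanishing at infinity.
\<close>

section \<open>Holomorphic functions of several variables\<close>

text \<open>With d = \<open>CARD('n)\<close> the norm weight is
  \<open>rho^(2n) * rho^(-d-1) = rho^\<beta>\<close> with \<beta> = 2n - d - 1, and n > d/2 says
  exactly that \<beta> is a natural number. Two computations then meet in one exponent. The Gram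
  matrix is a Laplace integral of \<open>\<bar>l\<bar>^(2n)\<close>, hence a power -(2n + 1). The
  Bergman kernel of the half-plane for the weight \<open>Im w ^ (\<beta> + d)\<close>, whose extra d
  is the volume growth of the ball fibers, is a power -(\<beta> + d + 2), the same number. The
  measure \<open>mu\<close> is made so that, for fixed frequency, the sum over multi-indices in the
  Gram matrix is a product of exponential series. The obstacle is that the transform of a general
  element of L2(mu) is not known beforehand to be square integrable. The isometry identity is
  therefore first tested only between elements with square-integrable transforms, and Fatou's lemma
  supplies integrability in the limit. All of this is done for a linear transform; the conjugation
  enters only at the end, through the argument.\<close>

lemma cscale_0 [simp]: "cscale 0 v = 0"
  by (simp add: cscale_def vec_eq_iff prod_eq_iff zero_prod_def)

lemma norm_cscale: "norm (cscale c v) = cmod c * norm v"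
proof -
  have "norm (\<chi> i. c * (fst v $ i)) = cmod c * norm (fst v)"
    unfolding norm_vec_def by (simp add: norm_mult L2_set_left_distrib L2_set_right_distrib)
  thus ?thesis
    by (simp add: cscale_def norm_Pair norm_mult power_mult_distrib real_sqrt_mult norm_prod_def
        flip: distrib_left)
qed

lemma cscale_of_real: "cscale (of_real r) v = r *\<^sub>R v"
  by (auto simp: cscale_def vec_eq_iff prod_eq_iff scaleR_conv_of_real[where 'a=complex])

lemma cscale_add_left: "cscale (a + b) v = cscale a v + cscale b v"
  by (auto simp: cscale_def vec_eq_iff prod_eq_iff algebra_simps)

lemma cscale_scaleR: "cscale (r *\<^sub>R c) v = r *\<^sub>R cscale c v"
  by (auto simp: cscale_def vec_eq_iff prod_eq_iff scaleR_conv_of_real[where 'a=complex] mult.assoc)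

lemma bounded_linear_cscale_left: "bounded_linear (\<lambda>c. cscale c v)"
  by (rule bounded_linear_intro[where K="norm v"])
    (auto simp: cscale_add_left cscale_scaleR norm_cscale)

lemma holomorphic_severalD:
  assumes "holomorphic_several F S" "z \<in> S"
  obtains D where "(F has_derivative D) (at z)" "\<And>c v. D (cscale c v) = c * D v"
  using assms unfolding holomorphic_several_def by blast

lemma holomorphic_several_continuous_on:
  assumes "holomorphic_several F S" shows "continuous_on S F"
  by (meson assms continuous_at_imp_continuous_on has_derivative_continuous holomorphic_severalD)

lemma holomorphic_several_line_deriv:
  assumes "(F has_derivative D) (at (z + cscale s v))" "\<And>c v. D (cscale c v) = c * D v"
  shows "((\<lambda>s. F (z + cscale s v)) has_field_derivative D v) (at s)"
proof -
  have "((\<lambda>s. z + cscale s v) has_derivative (\<lambda>c. cscale c v)) (at s)"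
    by (auto intro!: derivative_eq_intros bounded_linear_imp_has_derivative bounded_linear_cscale_left)
  from has_derivative_compose[OF this assms(1)]
  show ?thesis by (simp add: has_field_derivative_def assms(2) mult.commute[of "D v"] mult_commute_abs)
qed

lemma holomorphic_several_line:
  assumes "holomorphic_several F S" "\<And>s. s \<in> A \<Longrightarrow> z + cscale s v \<in> S" "open A"
  shows "(\<lambda>s. F (z + cscale s v)) holomorphic_on A"
  unfolding holomorphic_on_open[OF assms(3)]
proof
  fix s assume "s \<in> A"
  from holomorphic_severalD[OF assms(1) assms(2)[OF this]] obtain D
    where "(F has_derivative D) (at (z + cscale s v))" "\<And>c v. D (cscale c v) = c * D v" by blast
  from holomorphic_several_line_deriv[OF this]
  show "\<exists>f'. ((\<lambda>s. F (z + cscale s v)) has_field_derivative f') (at s)" by blast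
qed

text \<open>Cauchy's estimate in one variable on the complex line through z in direction v. The
  parameter disc has radius \<open>r / (2 * norm v)\<close>, which keeps the closed disc inside the
  open ball and costs the factor 2.\<close>

lemma holomorphic_several_deriv_bound:
  assumes F: "holomorphic_several F S" and r: "0 < r" "ball z r \<subseteq> S"
    and M: "\<And>y. y \<in> ball z r \<Longrightarrow> cmod (F y) \<le> M"
    and D: "(F has_derivative D) (at z)" "\<And>c v. D (cscale c v) = c * D v"
  shows "cmod (D v) \<le> 2 * M / r * norm v"
proof (cases "v = 0")
  case True thus ?thesis using linear_0[OF has_derivative_linear[OF D(1)]] by simp
next
  case False
  define R where "R = r / 2 / norm v"
  have R: "R > 0" using False r by (simp add: R_def)
  have inb: "z + cscale s v \<in> ball z r" if "s \<in> cball 0 R" for s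
  proof -
    have "norm (cscale s v) \<le> r / 2"
      using that False by (simp add: norm_cscale R_def field_simps)
    thus ?thesis using r by (simp add: dist_norm)
  qed
  define A where "A = {s. z + cscale s v \<in> ball z r}"
  have opA: "open A" unfolding A_def
    by (intro open_Collect_less continuous_intros open_vimage[of "ball z r", unfolded vimage_def] open_ball
       linear_continuous_on[OF bounded_linear_cscale_left])
  have hol: "(\<lambda>s. F (z + cscale s v)) holomorphic_on A"
    using r opA by (intro holomorphic_several_line[OF F]) (auto simp: A_def)
  have sub: "cball 0 R \<subseteq> A" using inb by (auto simp: A_def)
  have dv: "deriv (\<lambda>s. F (z + cscale s v)) 0 = D v"
    by (rule DERIV_imp_deriv, rule holomorphic_several_line_deriv) (simp_all add: D)
  have "cmod ((deriv ^^ 1) (\<lambda>s. F (z + cscale s v)) 0) \<le> fact 1 * M / R ^ 1"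
    using sub R hol
    by (intro Cauchy_inequality)
       (auto intro!: holomorphic_on_subset[OF hol] M holomorphic_on_imp_continuous_on inb[unfolded mem_ball])
  thus ?thesis by (simp add: dv R_def field_simps)
qed

text \<open>Mean value inequality on \<open>ball z r\<close>: each of its points carries its own
  ball of radius r inside \<open>ball z (2 * r)\<close>, so the derivative bound holds there
  uniformly.\<close>

lemma holomorphic_several_diff_bound:
  assumes F: "holomorphic_several F S" and r: "0 < r" "ball z (2 * r) \<subseteq> S"
    and M: "\<And>y. y \<in> ball z (2 * r) \<Longrightarrow> cmod (F y) \<le> M"
    and v: "norm v < r"
  shows "cmod (F (z + v) - F z) \<le> 2 * M / r * norm v"
proof -
  have bd: "\<exists>D. (F has_derivative D) (at y) \<and> onorm D \<le> 2 * M / r" if "y \<in> ball z r" for y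
  proof -
    have sub: "ball y r \<subseteq> ball z (2 * r)"
    proof
      fix x assume "x \<in> ball y r"
      thus "x \<in> ball z (2 * r)" using that dist_triangle[of z x y] by auto
    qed
    obtain D where D: "(F has_derivative D) (at y)" "\<And>c v. D (cscale c v) = c * D v"
      using holomorphic_severalD[OF F] that r by (metis (no_types) ball_subset_ball_iff centre_in_ball sub subset_iff)
    have "onorm D \<le> 2 * M / r"
      using holomorphic_several_deriv_bound[OF F r(1) _ _ D] sub r M
      by (intro onorm_le) (auto simp: subset_iff)
    thus ?thesis using D by blast
  qed
  then obtain D where D: "\<And>y. y \<in> ball z r \<Longrightarrow> (F has_derivative D y) (at y) \<and> onorm (D y) \<le> 2 * M / r"
    by metis
  have "norm (F (z + v) - F z) \<le> 2 * M / r * norm (z + v - z)"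
    using v r D
    by (intro differentiable_bound[of "ball z r" F D]) (auto simp: dist_norm intro: has_derivative_at_withinI)
  thus ?thesis by simp
qed

text \<open>Only the functions are assumed dominated, not their derivatives: Cauchy's estimates turn
  the bound g on \<open>ball z (2 * r)\<close> into bounds for derivatives and difference quotients
  at z, and dominated convergence applies. It serves both Cauchy's integral over a circle and the
  transform over \<open>base_meas\<close>.\<close>

theorem has_derivative_integral_holomorphic:
  fixes f :: "'x \<Rightarrow> (complex ^ 'n::finite) \<times> complex \<Rightarrow> complex"
  assumes hol: "\<And>x. x \<in> space M \<Longrightarrow> holomorphic_several (f x) S"
    and meas: "\<And>z. z \<in> S \<Longrightarrow> (\<lambda>x. f x z) \<in> borel_measurable M"
    and r: "0 < r" "ball z (2 * r) \<subseteq> S"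
    and g: "integrable M g" "\<And>x y. x \<in> space M \<Longrightarrow> y \<in> ball z (2 * r) \<Longrightarrow> cmod (f x y) \<le> g x"
    and D: "\<And>x. x \<in> space M \<Longrightarrow> (f x has_derivative D x) (at z)"
           "\<And>x c v. x \<in> space M \<Longrightarrow> D x (cscale c v) = c * D x v"
  shows "((\<lambda>y. \<integral>x. f x y \<partial>M) has_derivative (\<lambda>v. \<integral>x. D x v \<partial>M)) (at z)"
proof -
  note [measurable] = borel_measurable_integrable[OF g(1)]
  have Dbd: "cmod (D x v) \<le> g x / r * norm v" if "x \<in> space M" for x v
    using holomorphic_several_deriv_bound[OF hol[OF that] _ r(2) g(2)[OF that] D[OF that]] r by simp
  have fbd: "cmod (f x (z + v) - f x z) \<le> 2 * g x / r * norm v" if "x \<in> space M" "norm v < r" for x v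
    using holomorphic_several_diff_bound[OF hol[OF that(1)] r g(2)[OF that(1)] that(2)] .
  have zS: "z + v \<in> S" if "norm v < 2 * r" for v using that by (intro subsetD[OF r(2)]) (simp add: dist_norm)
  have [measurable]: "(\<lambda>x. f x z) \<in> borel_measurable M" using meas[of z] zS[of 0] r by simp
  \<comment> \<open>Measurability of the derivative in x: it is the pointwise limit of difference
    quotients along the steps \<open>1 / (Suc i + k)\<close>. The offset k makes already the first
    step shorter than r, so that every quotient is evaluated inside S.\<close>
  have Dmeas [measurable]: "(\<lambda>x. D x v) \<in> borel_measurable M" for v
  proof (rule borel_measurable_LIMSEQ_metric)
    define k where "k = nat \<lceil>norm v / r\<rceil> + 1"
    have small: "norm (inverse (real (Suc i + k)) *\<^sub>R v) < r" for i
    proof -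
      have "norm v / r < real k" unfolding k_def by linarith
      hence "norm v < r * real k" using r by (simp add: field_simps)
      also have "\<dots> \<le> r * real (Suc i + k)" using r by (intro mult_left_mono) auto
      finally show ?thesis by (simp add: field_simps)
    qed
    show "(\<lambda>x. real (Suc i + k) *\<^sub>R (f x (z + inverse (real (Suc i + k)) *\<^sub>R v) - f x z)) \<in> borel_measurable M" for i
      using small[of i] r by (intro borel_measurable_scaleR borel_measurable_diff meas zS) auto
    fix x assume x: "x \<in> space M"
    have lim: "(\<lambda>i. inverse (real (Suc i + k))) \<longlonglongrightarrow> 0"
      using LIMSEQ_ignore_initial_segment[OF LIMSEQ_inverse_real_of_nat, of k] by (simp add: add_ac)
    have "((\<lambda>s. f x (z + cscale s v)) has_field_derivative D x v) (at 0)"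
      by (rule holomorphic_several_line_deriv) (simp_all add: D x)
    hence "((\<lambda>s. (f x (z + cscale s v) - f x z) / s) \<longlongrightarrow> D x v) (at 0)"
      by (simp add: has_field_derivative_iff)
    moreover have "filterlim (\<lambda>i. complex_of_real (inverse (real (Suc i + k)))) (at 0) sequentially"
      unfolding filterlim_at using tendsto_of_real[OF lim] by (auto simp del: of_real_inverse)
    ultimately have "(\<lambda>i. (f x (z + cscale (of_real (inverse (real (Suc i + k)))) v) - f x z)
         / of_real (inverse (real (Suc i + k)))) \<longlonglongrightarrow> D x v"
      by (rule filterlim_compose)
    thus "(\<lambda>i. real (Suc i + k) *\<^sub>R (f x (z + inverse (real (Suc i + k)) *\<^sub>R v) - f x z)) \<longlonglongrightarrow> D x v"
      by (simp only: cscale_of_real) (simp add: scaleR_conv_of_real field_simps)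
  qed
  have Dint: "integrable M (\<lambda>x. D x v)" for v
    by (rule Bochner_Integration.integrable_bound[of M "\<lambda>x. g x / r * norm v"])
       (use g Dbd in \<open>auto intro!: AE_I2 order_trans[OF Dbd] simp: divide_inverse mult_ac\<close>)
  have fint: "integrable M (\<lambda>x. f x (z + v))" if "norm v < 2 * r" for v
    by (rule Bochner_Integration.integrable_bound[OF g(1)])
       (use g zS[OF that] that in \<open>auto intro!: AE_I2 meas order_trans[OF g(2)] simp: dist_norm\<close>)
  show "((\<lambda>y. \<integral>x. f x y \<partial>M) has_derivative (\<lambda>v. \<integral>x. D x v \<partial>M)) (at z)"
    unfolding has_derivative_at
  proof (intro conjI)
    have lin: "linear (D x)" if "x \<in> space M" for x using D(1)[OF that] has_derivative_linear by blast
    show "bounded_linear (\<lambda>v. \<integral>x. D x v \<partial>M)"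
    proof (rule bounded_linear_intro[where K="(\<integral>x. g x \<partial>M) / r"])
      fix v w show "(\<integral>x. D x (v + w) \<partial>M) = (\<integral>x. D x v \<partial>M) + (\<integral>x. D x w \<partial>M)"
        by (subst Bochner_Integration.integral_add[symmetric, OF Dint Dint])
           (auto intro!: Bochner_Integration.integral_cong simp: linear_add[OF lin])
    next
      fix a v
      have "(\<integral>x. D x (a *\<^sub>R v) \<partial>M) = (\<integral>x. a *\<^sub>R D x v \<partial>M)"
        by (intro Bochner_Integration.integral_cong refl) (simp add: linear_scale[OF lin])
      thus "(\<integral>x. D x (a *\<^sub>R v) \<partial>M) = a *\<^sub>R (\<integral>x. D x v \<partial>M)" by simp
    next
      fix v
      have "cmod (\<integral>x. D x v \<partial>M) \<le> (\<integral>x. g x / r * norm v \<partial>M)"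
        by (rule order_trans[OF integral_norm_bound integral_mono]) (use g Dbd Dint in auto)
      thus "cmod (\<integral>x. D x v \<partial>M) \<le> norm v * ((\<integral>x. g x \<partial>M) / r)" by (simp add: mult_ac)
    qed
    show "(\<lambda>h. norm ((\<integral>x. f x (z + h) \<partial>M) - (\<integral>x. f x z \<partial>M) - (\<integral>x. D x h \<partial>M)) / norm h) \<midarrow>0\<rightarrow> 0"
      unfolding tendsto_at_iff_sequentially
    proof (intro allI impI)
      fix X :: "nat \<Rightarrow> (complex ^ 'n) \<times> complex" assume X0: "\<forall>i. X i \<in> UNIV - {0}" and X: "X \<longlonglongrightarrow> 0"
      from X r have "eventually (\<lambda>i. norm (X i) < r) sequentially"
        using tendsto_norm_zero order_tendstoD(2) by blast
      then obtain i0 where i0: "\<And>i. i \<ge> i0 \<Longrightarrow> norm (X i) < r" by (auto simp: eventually_sequentially)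
      define Y where "Y i = X (i + i0)" for i
      have Y0: "Y i \<noteq> 0" and Yr: "norm (Y i) < r" "norm (Y i) < 2 * r" for i
        using X0 i0[of "i + i0"] r by (auto simp: Y_def)
      have Y: "Y \<longlonglongrightarrow> 0" unfolding Y_def using X by (rule LIMSEQ_ignore_initial_segment)
      define q where "q i x = (f x (z + Y i) - f x z - D x (Y i)) /\<^sub>R norm (Y i)" for i x
      have "(\<lambda>i. \<integral>x. q i x \<partial>M) \<longlonglongrightarrow> (\<integral>x. 0 \<partial>M)"
      \<comment> \<open>The 3 is 2 from the increment of \<open>f x\<close> plus 1 from its linear
        part.\<close>
      proof (rule integral_dominated_convergence[where w="\<lambda>x. 3 * g x / r"])
        show "q i \<in> borel_measurable M" for i
          unfolding q_def using meas[OF zS[OF Yr(2)]] by measurable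
        show "integrable M (\<lambda>x. 3 * g x / r)" using g by auto
        show "AE x in M. (\<lambda>i. q i x) \<longlonglongrightarrow> 0"
        proof (rule AE_I2)
          fix x assume x: "x \<in> space M"
          have "(\<lambda>h. norm (f x (z + h) - f x z - D x h) / norm h) \<midarrow>0\<rightarrow> 0"
            using D(1)[OF x] by (simp add: has_derivative_at)
          moreover have "filterlim Y (at 0) sequentially"
            unfolding filterlim_at using Y Y0 by simp
          ultimately have "(\<lambda>i. norm (f x (z + Y i) - f x z - D x (Y i)) / norm (Y i)) \<longlonglongrightarrow> 0"
            by (rule filterlim_compose)
          thus "(\<lambda>i. q i x) \<longlonglongrightarrow> 0"
            unfolding q_def by (subst tendsto_norm_zero_iff[symmetric]) (simp add: divide_inverse mult.commute)
        qed
        show "AE x in M. norm (q i x) \<le> 3 * g x / r" for i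
        proof (rule AE_I2)
          fix x assume x: "x \<in> space M"
          have "norm (f x (z + Y i) - f x z - D x (Y i)) \<le> 2 * g x / r * norm (Y i) + g x / r * norm (Y i)"
            using fbd[OF x Yr(1)] Dbd[OF x] norm_triangle_ineq4 order_trans add_mono by metis
          hence "norm (f x (z + Y i) - f x z - D x (Y i)) / norm (Y i) \<le> 3 * g x / r"
            using Y0[of i] r by (simp add: field_simps)
          thus "norm (q i x) \<le> 3 * g x / r"
            by (simp only: q_def norm_scaleR) (simp add: divide_inverse mult.commute)
        qed
      qed auto
      moreover have "(\<integral>x. q i x \<partial>M) = ((\<integral>x. f x (z + Y i) \<partial>M) - (\<integral>x. f x z \<partial>M) - (\<integral>x. D x (Y i) \<partial>M)) /\<^sub>R norm (Y i)" for i
        unfolding q_def using fint[OF Yr(2)] fint[of 0] r Dint by simp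
      ultimately have "(\<lambda>i. norm (((\<integral>x. f x (z + Y i) \<partial>M) - (\<integral>x. f x z \<partial>M) - (\<integral>x. D x (Y i) \<partial>M)) /\<^sub>R norm (Y i))) \<longlonglongrightarrow> 0"
        using tendsto_norm_zero by force
      hence "(\<lambda>i. norm ((\<integral>x. f x (z + X (i + i0)) \<partial>M) - (\<integral>x. f x z \<partial>M) - (\<integral>x. D x (X (i + i0)) \<partial>M)) / norm (X (i + i0))) \<longlonglongrightarrow> 0"
        by (simp add: Y_def divide_inverse mult.commute)
      thus "((\<lambda>h. norm ((\<integral>x. f x (z + h) \<partial>M) - (\<integral>x. f x z \<partial>M) - (\<integral>x. D x h \<partial>M)) / norm h) \<circ> X) \<longlonglongrightarrow> 0"
        by (simp add: o_def LIMSEQ_offset[of _ i0])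
    qed
  qed
qed

section \<open>Cauchy's formula as an average over the unit interval\<close>

definition unit_circle :: "real \<Rightarrow> complex" where
  "unit_circle x = exp (2 * of_real pi * \<i> * of_real x)"

text \<open>A probability measure, so that circle averages carry no normalising factor; as a measure
  it can enter Fubini arguments and the finite product that represents a torus.\<close>

definition unit_interval :: "real measure" where
  "unit_interval = restrict_space lborel {0..1}"

lemma space_unit_interval [simp]: "space unit_interval = {0..1}"
  by (simp add: unit_interval_def space_restrict_space)

lemma sets_unit_interval [measurable_cong]: "sets unit_interval = sets (restrict_space borel {0..1})"
  by (auto simp: unit_interval_def sets_restrict_space)

lemma measurable_unit_interval [measurable (raw)]:
  "f \<in> borel_measurable borel \<Longrightarrow> f \<in> borel_measurable unit_interval"
  unfolding measurable_cong_sets[OF sets_unit_interval refl] by (rule measurable_restrict_space1)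

lemma emeasure_unit_interval: "emeasure unit_interval {0..1} = 1"
  by (simp add: unit_interval_def emeasure_restrict_space)

lemma finite_measure_unit_interval: "finite_measure unit_interval"
  by standard (simp add: emeasure_unit_interval)

lemma sigma_finite_unit_interval: "sigma_finite_measure unit_interval"
  using finite_measure_unit_interval by (simp add: finite_measure_def)

lemma integrable_unit_interval:
  fixes f :: "real \<Rightarrow> 'b::{banach, second_countable_topology}"
  assumes "continuous_on {0..1} f" shows "integrable unit_interval f"
  unfolding unit_interval_def
  by (subst integrable_restrict_space)
     (use borel_integrable_atLeastAtMost'[OF assms] in \<open>simp_all add: set_integrable_def\<close>)

lemma integral_unit_interval:
  fixes f :: "real \<Rightarrow> 'b::euclidean_space"
  assumes "continuous_on {0..1} f"
  shows "integral\<^sup>L unit_interval f = integral {0..1} f"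
  unfolding unit_interval_def
  by (subst integral_restrict_space)
     (use set_borel_integral_eq_integral(2)[OF borel_integrable_atLeastAtMost'[OF assms]]
       in \<open>simp_all add: set_lebesgue_integral_def\<close>)

lemma norm_unit_circle [simp]: "cmod (unit_circle x) = 1"
  by (simp add: unit_circle_def norm_exp_eq_Re)

lemma unit_circle_nonzero [simp]: "unit_circle x \<noteq> 0"
  by (simp add: unit_circle_def)

lemma continuous_on_unit_circle [continuous_intros]:
  "continuous_on A g \<Longrightarrow> continuous_on A (\<lambda>x. unit_circle (g x))"
  unfolding unit_circle_def by (intro continuous_intros)

lemma borel_measurable_unit_circle [measurable]: "unit_circle \<in> borel_measurable borel"
  by (intro borel_measurable_continuous_onI continuous_intros)

text \<open>Along the circle \<open>dz = 2 pi \<i> r u dx\<close> with u =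
  \<open>unit_circle x\<close>. The factor \<open>r u\<close> cancels one power of the denominator
  in Cauchy's formula, which leaves exponent k instead of \<open>Suc k\<close>.\<close>

lemma higher_deriv_eq_integral_unit_circle:
  assumes f: "continuous_on (cball w r) f" "f holomorphic_on ball w r" and r: "r > 0"
  shows "(deriv ^^ k) f w =
    fact k * (\<integral>x. f (w + r * unit_circle x) / (r * unit_circle x) ^ k \<partial>unit_interval)"
proof -
  have cont: "continuous_on {0..1} (\<lambda>x. f (w + r * unit_circle x) / (r * unit_circle x) ^ k)"
    by (intro continuous_intros continuous_on_compose2[OF f(1)])
       (use r in \<open>auto simp: dist_norm norm_mult\<close>)
  have vd: "vector_derivative (circlepath w r) (at x) = 2 * pi * \<i> * r * unit_circle x" for x
    unfolding unit_circle_def by (intro vector_derivative_at has_vector_derivative_circlepath)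
  have cp: "circlepath w r = (\<lambda>x. w + r * unit_circle x)"
    by (simp add: circlepath unit_circle_def)
  have e1: "(deriv ^^ k) f w = fact k / (2 * pi * \<i>) *
      integral {0..1} (\<lambda>x. (2 * pi * \<i>) * (f (w + r * unit_circle x) / (r * unit_circle x) ^ k))"
    using r
    by (subst Cauchy_higher_derivative_integral_circlepath(2)[OF f])
       (auto simp: contour_integral_integral cp vd[unfolded cp] intro!: integral_cong)
  have cancel: "fact k / c * (c * I) = fact k * I" if "c \<noteq> 0" for c I :: complex
    using that by simp
  have e2: "fact k / (2 * pi * \<i>) *
      integral {0..1} (\<lambda>x. (2 * pi * \<i>) * (f (w + r * unit_circle x) / (r * unit_circle x) ^ k))
    = fact k * (\<integral>x. f (w + r * unit_circle x) / (r * unit_circle x) ^ k \<partial>unit_interval)"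
    using cancel[of "2 * pi * \<i>"]
    by (simp only: Henstock_Kurzweil_Integration.integral_mult_right integral_unit_interval[OF cont]) simp
  show ?thesis by (rule trans[OF e1 e2])
qed

lemma circle_mean_value:
  assumes "f holomorphic_on A" "cball w r \<subseteq> A" "r > 0"
  shows "f w = (\<integral>x. f (w + r * unit_circle x) \<partial>unit_interval)"
  using higher_deriv_eq_integral_unit_circle[of w r f 0] assms
  by (simp add: holomorphic_on_imp_continuous_on holomorphic_on_subset ball_subset_cball
      order_trans[OF ball_subset_cball])

section \<open>Closure properties and derivatives in the last variable\<close>

lemma holomorphic_several_compose_affine:
  assumes F: "holomorphic_several F S" and L: "bounded_linear L" "\<And>c v. L (cscale c v) = cscale c (L v)"
    and S': "\<And>z. z \<in> S' \<Longrightarrow> a + L z \<in> S"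
  shows "holomorphic_several (\<lambda>z. F (a + L z)) S'"
  unfolding holomorphic_several_def
proof
  fix z assume "z \<in> S'"
  then obtain D where D: "(F has_derivative D) (at (a + L z))" "\<And>c v. D (cscale c v) = c * D v"
    using holomorphic_severalD[OF F S'] by blast
  have "((\<lambda>z. a + L z) has_derivative L) (at z)"
    by (auto intro!: derivative_eq_intros bounded_linear_imp_has_derivative L)
  from has_derivative_compose[OF this D(1)]
  show "\<exists>D. ((\<lambda>z. F (a + L z)) has_derivative D) (at z) \<and> (\<forall>c v. D (cscale c v) = c * D v)"
    using D(2) L(2) by (intro exI[of _ "\<lambda>v. D (L v)"]) simp
qed

lemma holomorphic_several_diff:
  assumes F: "holomorphic_several F S" "holomorphic_several G S"
  shows "holomorphic_several (\<lambda>z. F z - G z) S"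
  unfolding holomorphic_several_def
proof
  fix z assume z: "z \<in> S"
  obtain D where D: "(F has_derivative D) (at z)" "\<And>c v. D (cscale c v) = c * D v"
    using holomorphic_severalD[OF F(1) z] by blast
  obtain E where E: "(G has_derivative E) (at z)" "\<And>c v. E (cscale c v) = c * E v"
    using holomorphic_severalD[OF F(2) z] by blast
  show "\<exists>D. ((\<lambda>z. F z - G z) has_derivative D) (at z) \<and> (\<forall>c v. D (cscale c v) = c * D v)"
    using D E by (intro exI[of _ "\<lambda>v. D v - E v"]) (auto intro!: derivative_eq_intros simp: algebra_simps)
qed

lemma holomorphic_several_cmult:
  assumes F: "holomorphic_several F S"
  shows "holomorphic_several (\<lambda>z. a * F z) S"
  unfolding holomorphic_several_def
proof
  fix z assume z: "z \<in> S"
  obtain D where D: "(F has_derivative D) (at z)" "\<And>c v. D (cscale c v) = c * D v"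
    using holomorphic_severalD[OF F z] by blast
  show "\<exists>D. ((\<lambda>z. a * F z) has_derivative D) (at z) \<and> (\<forall>c v. D (cscale c v) = c * D v)"
    using D by (intro exI[of _ "\<lambda>v. a * D v"]) (auto intro!: derivative_eq_intros simp: algebra_simps)
qed

lemma holomorphic_several_transform:
  assumes "holomorphic_several F S" "open S" "\<And>z. z \<in> S \<Longrightarrow> F z = G z"
  shows "holomorphic_several G S"
  using assms unfolding holomorphic_several_def
  by (meson has_derivative_transform_within_open)

lemma holomorphic_several_openI:
  assumes "\<And>z. z \<in> S \<Longrightarrow> \<exists>T. z \<in> T \<and> holomorphic_several F T"
  shows "holomorphic_several F S"
  using assms unfolding holomorphic_several_def by blast

lemma Pair_eq_cscale: "(\<zeta>, w) = (\<zeta>, 0) + cscale w (0, 1)"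
  by (simp add: cscale_def vec_eq_iff)

lemma holomorphic_several_last:
  assumes "holomorphic_several F S" "\<And>w. w \<in> A \<Longrightarrow> (\<zeta>, w) \<in> S" "open A"
  shows "(\<lambda>w. F (\<zeta>, w)) holomorphic_on A"
  using holomorphic_several_line[OF assms(1), of A "(\<zeta>, 0)" "(0, 1)"] assms(2,3)
  by (simp add: Pair_eq_cscale[symmetric])

lemma dlast_0 [simp]: "dlast 0 F z = F z"
  by (simp add: dlast_def)

lemma dlast_Suc: "dlast (Suc n) F z = deriv (\<lambda>w. dlast n F (fst z, w)) (snd z)"
  by (simp add: dlast_def)

text \<open>Over a circle of fixed radius in the last variable, Cauchy's formula expresses the
  derivative as an average of translates of F. Each translate is holomorphic in all variables, and
  the average may be differentiated under the integral.\<close>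

lemma holomorphic_several_deriv_last:
  assumes F: "holomorphic_several F S" and S: "open S"
  shows "holomorphic_several (\<lambda>z. deriv (\<lambda>w. F (fst z, w)) (snd z)) S"
proof (rule holomorphic_several_openI)
  fix z0 assume "z0 \<in> S"
  then obtain r' where r': "r' > 0" "cball z0 r' \<subseteq> S" using S open_contains_cball by blast
  \<comment> \<open>The radii add up to 4r: z lies in \<open>ball z0 r\<close>, domination is needed
    on \<open>ball z (2 * r)\<close>, and the circle moves points by r.\<close>
  define r where "r = r' / 4"
  have r: "r > 0" "cball z0 (4 * r) \<subseteq> S" using r' by (auto simp: r_def)
  define p where "p x = (0 :: complex ^ 'a, r * unit_circle x)" for x
  have pn: "norm (p x) = r" for x using r by (simp add: p_def norm_Pair norm_mult)
  have inS: "z + p x \<in> cball z0 (4 * r)" if "z \<in> ball z0 (3 * r)" for z x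
    using that pn[of x] norm_triangle_ineq[of "z0 - z" "- p x"] by (simp add: dist_norm algebra_simps)
  have cF: "continuous_on S F" using F holomorphic_several_continuous_on by blast
  have "compact (F ` cball z0 (4 * r))"
    using r by (intro compact_continuous_image continuous_on_subset[OF cF]) auto
  then obtain B where B: "\<And>y. y \<in> cball z0 (4 * r) \<Longrightarrow> cmod (F y) \<le> B"
    by (meson bounded_iff compact_imp_bounded imageI)
  define f where "f x z = inverse (r * unit_circle x) * F (p x + z)" for x z
  have hf: "holomorphic_several (f x) (ball z0 (3 * r))" for x
    unfolding f_def using r inS
    by (intro holomorphic_several_cmult holomorphic_several_compose_affine[where L="\<lambda>x. x", OF F])
       (auto simp: add.commute[of "p x"] bounded_linear_ident)
  have "holomorphic_several (\<lambda>z. \<integral>x. f x z \<partial>unit_interval) (ball z0 r)"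
    unfolding holomorphic_several_def
  proof
    fix z assume z: "z \<in> ball z0 r"
    have sub: "ball z (2 * r) \<subseteq> ball z0 (3 * r)"
    proof
      fix y assume "y \<in> ball z (2 * r)"
      thus "y \<in> ball z0 (3 * r)" using z dist_triangle[of z0 y z] by auto
    qed
    have z3: "z \<in> ball z0 (3 * r)" using z r by auto
    have "\<exists>D. (f x has_derivative D) (at z) \<and> (\<forall>c v. D (cscale c v) = c * D v)" for x
      using holomorphic_severalD[OF hf z3] by metis
    then obtain D where D: "\<And>x. (f x has_derivative D x) (at z)" "\<And>x c v. D x (cscale c v) = c * D x v"
      by metis
    have "((\<lambda>y. \<integral>x. f x y \<partial>unit_interval) has_derivative (\<lambda>v. \<integral>x. D x v \<partial>unit_interval)) (at z)"
    proof (rule has_derivative_integral_holomorphic[OF hf _ r(1) sub _ _ D])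
      show "(\<lambda>x. f x y) \<in> borel_measurable unit_interval" if "y \<in> ball z0 (3 * r)" for y
        using inS[OF that] r unfolding f_def p_def
        by (intro borel_measurable_integrable integrable_unit_interval continuous_intros
             continuous_on_compose2[OF cF]) (auto simp: add.commute)
      show "integrable unit_interval (\<lambda>x. B / r)" by (intro integrable_unit_interval continuous_intros)
      show "cmod (f x y) \<le> B / r" if "y \<in> ball z (2 * r)" for x y
        using B[OF inS[of y x]] subsetD[OF sub that] r
        by (simp add: f_def norm_mult norm_inverse norm_divide divide_simps mult.commute add.commute)
    qed
    thus "\<exists>D. ((\<lambda>y. \<integral>x. f x y \<partial>unit_interval) has_derivative D) (at z) \<and> (\<forall>c v. D (cscale c v) = c * D v)"
      using D(2) by (intro exI conjI) auto
  qed
  moreover have "(\<integral>x. f x z \<partial>unit_interval) = deriv (\<lambda>w. F (fst z, w)) (snd z)" if z: "z \<in> ball z0 r" for z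
  proof -
    have cb: "(fst z, w) \<in> S" if "w \<in> ball (snd z) (2 * r)" for w
    proof -
      have "dist z (fst z, w) = dist (snd z) w" by (simp add: dist_prod_def)
      hence "dist z0 (fst z, w) \<le> 4 * r" using z that dist_triangle[of z0 "(fst z, w)" z] r by auto
      thus ?thesis using r by auto
    qed
    have h: "(\<lambda>w. F (fst z, w)) holomorphic_on ball (snd z) (2 * r)"
      by (rule holomorphic_several_last[OF F]) (auto intro!: cb)
    have "cball (snd z) r \<subseteq> ball (snd z) (2 * r)" using r by auto
    from holomorphic_on_subset[OF h this]
    show ?thesis using r
      using higher_deriv_eq_integral_unit_circle[of "snd z" r "\<lambda>w. F (fst z, w)" 1]
      by (simp add: f_def p_def holomorphic_on_imp_continuous_on holomorphic_on_subset[OF _ ball_subset_cball]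
         plus_prod_def add.commute field_simps)
  qed
  ultimately show "\<exists>T. z0 \<in> T \<and> holomorphic_several (\<lambda>z. deriv (\<lambda>w. F (fst z, w)) (snd z)) T"
    using r by (intro exI[of _ "ball z0 r"]) (auto intro: holomorphic_several_transform)
qed

lemma holomorphic_several_dlast:
  assumes F: "holomorphic_several F S" and S: "open S"
  shows "holomorphic_several (dlast n F) S"
proof (induction n)
  case 0 thus ?case using F by (simp add: dlast_def[abs_def])
next
  case (Suc n)
  show ?case using holomorphic_several_deriv_last[OF Suc S] by (simp add: dlast_Suc[abs_def])
qed

section \<open>Invariance of Lebesgue measure and circle averages\<close>

lemma nn_integral_lborel_translate:
  fixes f :: "'a::euclidean_space \<Rightarrow> ennreal"
  assumes [measurable]: "f \<in> borel_measurable borel"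
  shows "(\<integral>\<^sup>+x. f (c + x) \<partial>lborel) = (\<integral>\<^sup>+x. f x \<partial>lborel)"
  by (subst (2) lborel_distr_plus[of c, symmetric]) (simp add: nn_integral_distr)

text \<open>Uniqueness of translation-invariant measures, with the normalisation read off from the unit
  ball, which is symmetric and preserved by the isometry.\<close>

lemma lborel_distr_linear_isometry:
  fixes f f' :: "'a::euclidean_space \<Rightarrow> 'a"
  assumes f: "linear f" "\<And>x. norm (f x) = norm x" and inv: "\<And>x. f (f' x) = x"
  shows "distr lborel borel f = lborel"
proof (rule measure_eqI)
  have [measurable]: "f \<in> borel_measurable borel"
    by (intro borel_measurable_continuous_onI linear_continuous_on linear_conv_bounded_linear[THEN iffD1] f)
  define M where "M = distr lborel borel f"
  have sM [simp, measurable_cong]: "sets M = sets borel" and [simp]: "space M = UNIV" by (simp_all add: M_def)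
  interpret M: sigma_finite_measure M
  proof
    show "\<exists>A. countable A \<and> A \<subseteq> sets M \<and> \<Union> A = space M \<and> (\<forall>a\<in>A. emeasure M a \<noteq> \<infinity>)"
    proof (intro exI[of _ "range (\<lambda>n::nat. ball 0 (real n))"] conjI ballI)
      fix a assume "a \<in> range (\<lambda>n::nat. ball (0::'a) (real n))"
      then obtain n :: nat where n: "a = ball 0 (real n)" by auto
      have "f -` ball 0 (real n) = ball 0 (real n)" by (auto simp: f dist_norm)
      hence "emeasure M a = emeasure lborel (ball (0::'a) (real n))"
        by (simp add: n M_def emeasure_distr)
      thus "emeasure M a \<noteq> \<infinity>" using emeasure_bounded_finite[of "ball (0::'a) (real n)"] by auto
    next
      show "\<Union> (range (\<lambda>n::nat. ball 0 (real n))) = space M"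
        by (auto simp: reals_Archimedean2)
    qed auto
  qed
  interpret P: pair_sigma_finite M "lborel :: 'a measure" ..
  let ?B = "ball 0 1 :: 'a set"
  have [measurable]: "?B \<in> sets borel" by simp
  have [measurable]: "(\<lambda>x. indicator ?B (y - x) :: ennreal) \<in> borel_measurable borel" for y
    by measurable
  have L: "emeasure lborel ?B \<noteq> 0" "emeasure lborel ?B \<noteq> \<infinity>"
    using emeasure_bounded_finite[of ?B] open_not_negligible[of ?B] 
    by (auto simp: emeasure_lborel_ball_finite negligible_iff_null_sets null_sets_completion_iff)
  fix A assume "A \<in> sets (distr lborel borel f)"
  hence [measurable]: "A \<in> sets borel" by simp
  have tr: "(\<integral>\<^sup>+x. indicator A (x + y) \<partial>M) = emeasure M A" for y
  proof -
    have "(\<integral>\<^sup>+x. indicator A (x + y) \<partial>M) = (\<integral>\<^sup>+x. indicator A (f (f' y + x)) \<partial>lborel)"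
      unfolding M_def by (subst nn_integral_distr) (auto simp: linear_add[OF f(1)] inv add.commute)
    also have "\<dots> = (\<integral>\<^sup>+x. indicator A (f x) \<partial>lborel)"
      by (rule nn_integral_lborel_translate) measurable
    also have "\<dots> = (\<integral>\<^sup>+x. indicator A x \<partial>M)"
      unfolding M_def by (subst nn_integral_distr) auto
    finally show ?thesis by simp
  qed
  have bl: "(\<integral>\<^sup>+x. indicator ?B (y - x) \<partial>M) = emeasure lborel ?B" for y
  proof -
    have "(\<integral>\<^sup>+x. indicator ?B (y - x) \<partial>M) = (\<integral>\<^sup>+x. indicator ?B (y - f x) \<partial>lborel)"
      unfolding M_def by (subst nn_integral_distr) simp_all
    also have "\<dots> = (\<integral>\<^sup>+x. indicator ?B (- f' y + x) \<partial>lborel)"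
    proof (intro nn_integral_cong)
      fix x
      have "norm (y - f x) = norm (f (f' y - x))" by (simp add: linear_diff[OF f(1)] inv)
      hence "norm (y - f x) = norm (- f' y + x)" by (simp add: f norm_minus_commute)
      thus "indicator ?B (y - f x) = (indicator ?B (- f' y + x) :: ennreal)" by (auto split: split_indicator)
    qed
    also have "\<dots> = emeasure lborel ?B"
      by (subst nn_integral_lborel_translate) auto
    finally show ?thesis .
  qed
  \<comment> \<open>Double counting. Integrating x first, translation invariance of M gives M(A)
    times the volume of the ball. After replacing y by y - x, invariance of Lebesgue measure and
    \<open>bl\<close>, by which every unit ball has the same M-measure as Lebesgue measure, give the
    volume of A times that of the ball.\<close>
  have "emeasure M A * emeasure lborel ?B = (\<integral>\<^sup>+y. \<integral>\<^sup>+x. indicator A (x + y) * indicator ?B y \<partial>M \<partial>lborel)"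
    by (simp add: nn_integral_multc tr nn_integral_cmult)
  also have "\<dots> = (\<integral>\<^sup>+x. \<integral>\<^sup>+y. indicator A (x + y) * indicator ?B y \<partial>lborel \<partial>M)"
    by (rule P.Fubini') measurable
  also have "\<dots> = (\<integral>\<^sup>+x. \<integral>\<^sup>+y. indicator A y * indicator ?B (y - x) \<partial>lborel \<partial>M)"
  proof (rule nn_integral_cong)
    fix x
    show "(\<integral>\<^sup>+y. indicator A (x + y) * indicator ?B y \<partial>lborel) = (\<integral>\<^sup>+y. indicator A y * (indicator ?B (y - x) :: ennreal) \<partial>lborel)"
      by (subst (2) nn_integral_lborel_translate[of _ x, symmetric]) auto
  qed
  also have "\<dots> = (\<integral>\<^sup>+y. \<integral>\<^sup>+x. indicator A y * indicator ?B (y - x) \<partial>M \<partial>lborel)"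
    by (rule P.Fubini'[symmetric]) measurable
  also have "\<dots> = emeasure lborel A * emeasure lborel ?B"
    by (simp add: nn_integral_cmult bl nn_integral_multc)
  finally show "emeasure (distr lborel borel f) A = emeasure lborel A"
    using L by (auto simp: M_def mult.commute[of _ "emeasure lborel ?B"] ennreal_mult_cancel_left)
qed simp

section \<open>Rotations and averages over them\<close>

definition vscale :: "complex \<Rightarrow> complex ^ 'n::finite \<Rightarrow> complex ^ 'n" where
  "vscale c y = (\<chi> i. c * y $ i)"

lemma vscale_vscale: "vscale a (vscale b y) = vscale (a * b) y"
  by (simp add: vscale_def vec_eq_iff mult.assoc)

lemma vscale_1 [simp]: "vscale 1 y = y"
  by (simp add: vscale_def vec_eq_iff)

lemma norm_vscale: "norm (vscale c y) = cmod c * norm y"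
  unfolding vscale_def norm_vec_def by (simp add: norm_mult L2_set_right_distrib)

lemma continuous_on_vscale [continuous_intros]:
  "continuous_on A f \<Longrightarrow> continuous_on A g \<Longrightarrow> continuous_on A (\<lambda>x. vscale (f x) (g x))"
  unfolding vscale_def by (intro continuous_intros)

lemma linear_vscale: "linear (vscale c)"
  by (rule linearI) (simp_all add: vscale_def vec_eq_iff algebra_simps)

lemma lborel_distr_vscale:
  assumes "cmod c = 1" shows "distr lborel borel (vscale c) = lborel"
proof -
  have "c \<noteq> 0" using assms by auto
  thus ?thesis using assms
    by (intro lborel_distr_linear_isometry[where f'="vscale (inverse c)"])
       (auto simp: linear_vscale norm_vscale vscale_vscale)
qed

lemma lborel_distr_cmult:
  assumes "cmod c = 1" shows "distr lborel borel ((*) c) = (lborel :: complex measure)"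
proof -
  have "c \<noteq> 0" using assms by auto
  thus ?thesis using assms
    by (intro lborel_distr_linear_isometry[where f'="(*) (inverse c)"])
       (auto simp: norm_mult intro: linearI simp: algebra_simps)
qed

lemma measurable_Complex [measurable]: "(\<lambda>(u, v). Complex u v) \<in> borel_measurable (borel \<Otimes>\<^sub>M borel)"
  unfolding borel_prod case_prod_unfold Complex_eq
  by (intro borel_measurable_continuous_onI continuous_intros)

text \<open>Boxes in the plane are products of intervals, and Lebesgue measure is determined on
  boxes. This is what splits half-plane integrals into horizontal and vertical ones.\<close>

lemma lborel_complex: "(lborel :: complex measure) = distr (lborel \<Otimes>\<^sub>M lborel) borel (\<lambda>(u, v). Complex u v)"
proof (rule lborel_eqI)
  fix l u :: complex assume lu: "\<And>b. b \<in> Basis \<Longrightarrow> l \<bullet> b \<le> u \<bullet> b"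
  have le: "Re l \<le> Re u" "Im l \<le> Im u" using lu[of 1] lu[of \<i>] by (auto simp: Basis_complex_def)
  have eq: "(\<lambda>(u, v). Complex u v) -` box l u = box (Re l) (Re u) \<times> box (Im l) (Im u)"
    by (auto simp: box_def Basis_complex_def)
  show "emeasure (distr (lborel \<Otimes>\<^sub>M lborel) borel (\<lambda>(u, v). Complex u v)) (box l u) = (\<Prod>b\<in>Basis. (u - l) \<bullet> b)"
    using le by (simp add: emeasure_distr eq space_pair_measure lborel.emeasure_pair_measure_Times
       Basis_complex_def ennreal_mult[symmetric])
qed simp

lemma measurable_fst_unit_interval:
  "(\<lambda>p. (fst p, snd p)) \<in> measurable (unit_interval \<Otimes>\<^sub>M (lborel :: 'a::euclidean_space measure)) (borel \<Otimes>\<^sub>M borel)"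
proof (rule measurable_Pair)
  have "(\<lambda>x. x) \<in> borel_measurable unit_interval"
    by (rule measurable_unit_interval) simp
  from measurable_compose[OF measurable_fst[of unit_interval "lborel :: 'a measure"] this]
  show "fst \<in> borel_measurable (unit_interval \<Otimes>\<^sub>M (lborel :: 'a measure))" by simp
  show "snd \<in> borel_measurable (unit_interval \<Otimes>\<^sub>M (lborel :: 'a measure))"
    using measurable_snd[of unit_interval "lborel :: 'a measure"] by simp
qed

text \<open>Each \<open>R x\<close> preserves Lebesgue measure and the parameter interval has mass
  1, so Fubini allows replacing f by its average over x. For rotations, the average can then be
  evaluated by a mean value property.\<close>

lemma nn_integral_circle_average:
  fixes f :: "'a::euclidean_space \<Rightarrow> ennreal" and R :: "real \<Rightarrow> 'a \<Rightarrow> 'a"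
  assumes [measurable]: "f \<in> borel_measurable borel" "(\<lambda>(x, y). R x y) \<in> borel_measurable (borel \<Otimes>\<^sub>M borel)"
    and R: "\<And>x. distr lborel borel (R x) = (lborel :: 'a measure)"
  shows "(\<integral>\<^sup>+y. f y \<partial>lborel) = (\<integral>\<^sup>+y. \<integral>\<^sup>+x. f (R x y) \<partial>unit_interval \<partial>lborel)"
proof -
  interpret sigma_finite_measure unit_interval by (rule sigma_finite_unit_interval)
  interpret P: pair_sigma_finite unit_interval "lborel :: 'a measure" ..
  have [measurable]: "R x \<in> borel_measurable borel" for x
    using measurable_Pair2[OF assms(2), of x] by simp
  have sc: "sets (unit_interval \<Otimes>\<^sub>M (lborel :: 'a measure)) = sets (restrict_space borel {0..1} \<Otimes>\<^sub>M borel)"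
    by (intro sets_pair_measure_cong) (auto simp: sets_unit_interval)
  have Rm [measurable]: "(\<lambda>(x, y). R x y) \<in> borel_measurable (unit_interval \<Otimes>\<^sub>M (lborel :: 'a measure))"
    using measurable_compose[OF measurable_fst_unit_interval assms(2)] by (simp add: case_prod_unfold)
  have "(\<integral>\<^sup>+y. \<integral>\<^sup>+x. f (R x y) \<partial>unit_interval \<partial>lborel) = (\<integral>\<^sup>+x. \<integral>\<^sup>+y. f (R x y) \<partial>lborel \<partial>unit_interval)"
    by (rule P.Fubini') measurable
  also have "\<dots> = (\<integral>\<^sup>+x. \<integral>\<^sup>+y. f y \<partial>lborel \<partial>unit_interval)"
  proof (rule nn_integral_cong)
    fix x show "(\<integral>\<^sup>+y. f (R x y) \<partial>lborel) = (\<integral>\<^sup>+y. f y \<partial>lborel)"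
      by (subst (2) R[of x, symmetric]) (simp add: nn_integral_distr)
  qed
  also have "\<dots> = (\<integral>\<^sup>+y. f y \<partial>lborel)" by (simp add: emeasure_unit_interval)
  finally show ?thesis by simp
qed

lemma integral_circle_average:
  fixes f :: "'a::euclidean_space \<Rightarrow> 'b::{banach, second_countable_topology}"
    and R :: "real \<Rightarrow> 'a \<Rightarrow> 'a"
  assumes f: "integrable lborel f" and [measurable]: "(\<lambda>(x, y). R x y) \<in> borel_measurable (borel \<Otimes>\<^sub>M borel)"
    and R: "\<And>x. distr lborel borel (R x) = (lborel :: 'a measure)"
  shows "(\<integral>y. f y \<partial>lborel) = (\<integral>y. \<integral>x. f (R x y) \<partial>unit_interval \<partial>lborel)"
proof -
  interpret sigma_finite_measure unit_interval by (rule sigma_finite_unit_interval)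
  interpret P: pair_sigma_finite unit_interval "lborel :: 'a measure" ..
  have [measurable]: "f \<in> borel_measurable borel" using borel_measurable_integrable[OF f] by simp
  have [measurable]: "R x \<in> borel_measurable borel" for x
    using measurable_Pair2[OF assms(2), of x] by simp
  have Rm [measurable]: "(\<lambda>(x, y). R x y) \<in> borel_measurable (unit_interval \<Otimes>\<^sub>M (lborel :: 'a measure))"
    using measurable_compose[OF measurable_fst_unit_interval assms(2)] by (simp add: case_prod_unfold)
  have int: "integrable (unit_interval \<Otimes>\<^sub>M (lborel :: 'a measure)) (\<lambda>(x, y). f (R x y))"
  proof (rule integrableI_bounded)
    show "(\<lambda>(x, y). f (R x y)) \<in> borel_measurable (unit_interval \<Otimes>\<^sub>M (lborel :: 'a measure))" by measurable
    have "(\<integral>\<^sup>+p. ennreal (norm (case p of (x, y) \<Rightarrow> f (R x y))) \<partial>(unit_interval \<Otimes>\<^sub>M lborel))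
       = (\<integral>\<^sup>+y. \<integral>\<^sup>+x. ennreal (norm (f (R x y))) \<partial>unit_interval \<partial>lborel)"
      by (subst P.nn_integral_snd[symmetric]) (auto simp: case_prod_unfold)
    also have "\<dots> = (\<integral>\<^sup>+y. ennreal (norm (f y)) \<partial>lborel)"
      by (rule nn_integral_circle_average[symmetric, OF _ assms(2) R]) measurable
    also have "\<dots> < \<infinity>" using f by (simp add: integrable_iff_bounded)
    finally show "(\<integral>\<^sup>+p. ennreal (norm (case p of (x, y) \<Rightarrow> f (R x y))) \<partial>(unit_interval \<Otimes>\<^sub>M lborel)) < \<infinity>" .
  qed
  have "(\<integral>y. \<integral>x. f (R x y) \<partial>unit_interval \<partial>lborel) = (\<integral>x. \<integral>y. f (R x y) \<partial>lborel \<partial>unit_interval)"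
    by (rule P.Fubini_integral[OF int])
  also have "\<dots> = (\<integral>x. \<integral>y. f y \<partial>lborel \<partial>unit_interval)"
  proof (rule Bochner_Integration.integral_cong[OF refl])
    fix x show "(\<integral>y. f (R x y) \<partial>lborel) = (\<integral>y. f y \<partial>lborel)"
      by (subst (2) R[of x, symmetric]) (simp add: integral_distr)
  qed
  also have "\<dots> = (\<integral>y. f y \<partial>lborel)" by (simp add: measure_def emeasure_unit_interval)
  finally show ?thesis by simp
qed

text \<open>The mean value property of the holomorphic function \<open>h^2\<close>, followed by the
  triangle inequality for integrals.\<close>

lemma circle_sub_mean_value:
  assumes "h holomorphic_on A" "cball 0 1 \<subseteq> A"
  shows "ennreal ((cmod (h 0))\<^sup>2) \<le> (\<integral>\<^sup>+x. ennreal ((cmod (h (unit_circle x)))\<^sup>2) \<partial>unit_interval)"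
proof -
  have "continuous_on (cball 0 1) h"
    using assms holomorphic_on_imp_continuous_on continuous_on_subset by blast
  hence c: "continuous_on {0..1} (\<lambda>x. h (unit_circle x))"
    by (rule continuous_on_compose2) (auto intro!: continuous_intros)
  have "(h 0)^2 = (\<integral>x. (h (0 + of_real 1 * unit_circle x))^2 \<partial>unit_interval)"
    using assms by (intro circle_mean_value[where f="\<lambda>s. (h s)^2"] holomorphic_intros) auto
  hence "(cmod (h 0))\<^sup>2 = cmod (\<integral>x. (h (unit_circle x))^2 \<partial>unit_interval)"
    by (simp add: norm_power[symmetric])
  also have "\<dots> \<le> (\<integral>x. (cmod (h (unit_circle x)))^2 \<partial>unit_interval)"
    by (rule order_trans[OF integral_norm_bound]) (simp add: norm_power)
  finally show ?thesis
    by (subst nn_integral_eq_integral) (auto intro!: integrable_unit_interval continuous_intros c ennreal_leI)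
qed

section \<open>The reproducing formula on the half-plane\<close>

text \<open>The right factor is the squared distance of u to the point a + ib. Thus negative powers
  of this distance have the integrable majorant \<open>1 / (1 + u^2)\<close>. The core is
  \<open>(u - 2 * a)^2 \<ge> 0\<close>.\<close>

lemma one_plus_square_le:
  fixes a b u :: real
  assumes b: "b > 0"
  shows "1 + u\<^sup>2 \<le> (2 + (1 + 2 * a\<^sup>2) / b\<^sup>2) * ((u - a)\<^sup>2 + b\<^sup>2)"
proof -
  have e2: "(2 + (1 + 2 * a\<^sup>2) / b\<^sup>2) * ((u - a)^2 + b^2) = 2 * (u - a)^2 + 2 * b^2 + (1 + 2 * a^2) + (1 + 2 * a^2) / b^2 * (u - a)^2"
    using b by (simp add: field_simps)
  have "2 * (u - a)^2 + 2 * a^2 - u^2 = (u - 2 * a)^2" by (simp add: power2_eq_square algebra_simps)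
  hence e3: "u^2 \<le> 2 * (u - a)^2 + 2 * a^2" using zero_le_power2[of "u - 2 * a"] by linarith
  have e4: "0 \<le> (1 + 2 * a^2) / b^2 * (u - a)^2" by auto
  show ?thesis unfolding e2 using e3 e4 zero_le_power2[of b] by linarith
qed

text \<open>Residue theorem on the rectangle with corners -R and R + iR. As f is bounded and the
  denominator has degree at least 2, the three sides off the real line contribute O(1/R). The margin
  \<delta> makes f holomorphic across the real line, which is itself a side of the contour.\<close>

lemma line_integral_over_power:
  fixes f :: "complex \<Rightarrow> complex"
  assumes f: "f holomorphic_on {z. Im z > - \<delta>}" and d: "\<delta> > 0"
    and B: "\<And>z. Im z > - \<delta> \<Longrightarrow> cmod (f z) \<le> B" and p: "Im p > 0" and N: "N \<ge> 1"
  shows "(\<integral>u. f (of_real u) / (of_real u - p) ^ Suc N \<partial>lborel) = 2 * pi * \<i> * ((deriv ^^ N) f p / fact N)"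
proof -
  define q where "q z = f z / (z - p) ^ Suc N" for z
  define S where "S = {z. Im z > - \<delta>}"
  have S: "open S" "connected S"
    unfolding S_def by (simp_all add: open_halfspace_Im_gt convex_connected convex_halfspace_Im_gt)
  have pS: "p \<in> S" using p d by (simp add: S_def)
  have qh: "q holomorphic_on S - {p}"
    unfolding q_def using f by (auto intro!: holomorphic_intros simp: S_def holomorphic_on_subset)
  have B0: "B \<ge> 0" using B[of 0] d by (auto intro: order_trans[OF norm_ge_zero])
  have res: "residue q p = (deriv ^^ N) f p / fact N"
    unfolding q_def using f S(1) pS by (intro residue_holomorphic_over_power) (auto simp: S_def)
  have qc: "continuous_on UNIV (\<lambda>u. q (of_real u))"
  proof (rule continuous_on_compose2[of "S - {p}" q])
    show "continuous_on (S - {p}) q" using qh holomorphic_on_imp_continuous_on by blast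
  qed (use p d in \<open>auto intro!: continuous_intros simp: S_def\<close>)
  have qb: "cmod (q z) \<le> B / cmod (z - p) ^ Suc N" if "z \<in> S" for z
    unfolding q_def norm_divide norm_power using B[of z] that by (intro divide_right_mono) (auto simp: S_def)
  have int: "integrable lborel (\<lambda>u. q (of_real u))"
  proof -
    define a b where "a = Re p" and "b = Im p"
    define C where "C = 2 + (1 + 2 * a\<^sup>2) / b\<^sup>2"
    have b: "b > 0" using p by (simp add: b_def)
    have C: "C > 0" unfolding C_def using b by (intro add_pos_nonneg) auto
    have key: "1 + u\<^sup>2 \<le> C * cmod (of_real u - p)^2" for u
      using one_plus_square_le[OF b, of u a] by (simp add: cmod_power2 a_def b_def C_def)
    have h1: "cmod (q (of_real u)) \<le> (B / b ^ (N - 1) * C) * inverse (1 + u\<^sup>2)" for u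
    proof -
      have bu: "b \<le> cmod (of_real u - p)" using abs_Im_le_cmod[of "of_real u - p"] b by (simp add: b_def)
      have "cmod (q (of_real u)) \<le> B / cmod (of_real u - p) ^ Suc N"
        by (rule qb) (use d in \<open>auto simp: S_def\<close>)
      also have "\<dots> = B / (cmod (of_real u - p) ^ (N - 1) * cmod (of_real u - p)^2)"
        using N by (simp add: power_add[symmetric] del: power_Suc)
      also have "\<dots> \<le> B / (b ^ (N - 1) * ((1 + u\<^sup>2) / C))"
        using bu b C B0 key[of u] 
        by (intro divide_left_mono mult_mono power_mono mult_pos_pos zero_less_power divide_pos_pos)
           (auto simp: field_simps add_pos_nonneg)
      finally show ?thesis by (simp add: field_simps)
    qed
    have "integrable lborel (\<lambda>u::real. inverse (1 + u\<^sup>2))"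
      using integrable_inverse_1_plus_square by (simp add: set_integrable_def)
    hence "integrable lborel (\<lambda>u. (B / b ^ (N - 1) * C) * inverse (1 + u\<^sup>2))"
      by (rule integrable_mult_right)
    thus ?thesis
    proof (rule Bochner_Integration.integrable_bound)
      show "(\<lambda>u. q (of_real u)) \<in> borel_measurable lborel"
        by (simp add: borel_measurable_continuous_onI qc)
      show "AE u in lborel. norm (q (of_real u)) \<le> norm ((B / b ^ (N - 1) * C) * inverse (1 + u\<^sup>2))"
        using order_trans[OF h1 abs_ge_self] by (intro AE_I2) (simp only: real_norm_def)
    qed
  qed
  define I where "I R = (\<integral>u. indicator {-R..R} u *\<^sub>R q (of_real u) \<partial>lborel)" for R :: real
  have lim1: "(\<lambda>n. I (real n)) \<longlonglongrightarrow> (\<integral>u. q (of_real u) \<partial>lborel)"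
    unfolding I_def
  proof (rule integral_dominated_convergence[where w="\<lambda>u. cmod (q (of_real u))"])
    show "AE x in lborel. (\<lambda>i. indicator {- real i..real i} x *\<^sub>R q (of_real x)) \<longlonglongrightarrow> q (of_real x)"
    proof (rule AE_I2, rule tendsto_eventually)
      fix x
      show "\<forall>\<^sub>F i in sequentially. indicator {- real i..real i} x *\<^sub>R q (of_real x) = q (of_real x)"
        using eventually_ge_at_top[of "nat \<lceil>\<bar>x\<bar>\<rceil>"]
        by eventually_elim (auto simp: indicator_def nat_le_iff ceiling_le_iff)
    qed
  qed (use int in \<open>auto simp: indicator_def borel_measurable_integrable\<close>)
  define L where "L = 2 * pi * \<i> * residue q p"
  \<comment> \<open>\<open>R \<ge> cmod p + 1\<close> puts p inside the rectangle and at distance at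
    least 1 from the other three sides, so there the power \<open>Suc N\<close> of the distance
    dominates its square. Each of these sides has length at most 2R.\<close>
  have bound: "cmod (I R - L) \<le> 6 * B * R / (R - cmod p)\<^sup>2" if R: "R \<ge> cmod p + 1" for R
  proof -
    let ?a = "complex_of_real (-R)" and ?b = "complex_of_real R" and ?c = "Complex R R" and ?d = "Complex (-R) R"
    have R0: "R > 0" using R norm_ge_zero[of p] by linarith
    have reim: "\<bar>Re p\<bar> < R" "Im p < R" using abs_Re_le_cmod[of p] abs_Im_le_cmod[of p] R by linarith+
    have rp: "rectpath ?a ?c = linepath ?a ?b +++ linepath ?b ?c +++ linepath ?c ?d +++ linepath ?d ?a"
      by (simp add: rectpath_def Let_def complex_of_real_def)
    have box: "p \<in> box ?a ?c" using reim p by (auto simp: in_box_complex_iff)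
    have img: "path_image (rectpath ?a ?c) \<subseteq> S - {p}"
    proof -
      have "path_image (rectpath ?a ?c) = cbox ?a ?c - box ?a ?c"
        using R0 by (intro path_image_rectpath_cbox_minus_box) auto
      moreover have "cbox ?a ?c \<subseteq> S" using d by (auto simp: in_cbox_complex_iff S_def)
      ultimately show ?thesis using box by blast
    qed
    have sub: "closed_segment ?a ?b \<subseteq> S - {p}" "closed_segment ?b ?c \<subseteq> S - {p}"
        "closed_segment ?c ?d \<subseteq> S - {p}" "closed_segment ?d ?a \<subseteq> S - {p}"
    proof -
      have "path_image (rectpath ?a ?c) = closed_segment ?a ?b \<union> (closed_segment ?b ?c \<union> (closed_segment ?c ?d \<union> closed_segment ?d ?a))"
        unfolding rp by (simp only: path_image_join path_image_linepath pathstart_linepath pathfinish_linepath pathstart_join pathfinish_join)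
      thus "closed_segment ?a ?b \<subseteq> S - {p}" "closed_segment ?b ?c \<subseteq> S - {p}"
        "closed_segment ?c ?d \<subseteq> S - {p}" "closed_segment ?d ?a \<subseteq> S - {p}"
        using img by blast+
    qed
    have ci: "q contour_integrable_on linepath x y" if "closed_segment x y \<subseteq> S - {p}" for x y
      by (rule contour_integrable_continuous_linepath)
         (use qh that holomorphic_on_imp_continuous_on continuous_on_subset in blast)
    have "contour_integral (rectpath ?a ?c) q = 2 * pi * \<i> * (\<Sum>p\<in>{p}. winding_number (rectpath ?a ?c) p * residue q p)"
    proof (rule Residue_theorem[OF S])
      show "\<forall>z. z \<notin> S \<longrightarrow> winding_number (rectpath ?a ?c) z = 0"
        using R0 d by (auto intro!: winding_number_rectpath_outside simp: in_cbox_complex_iff S_def)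
    qed (use qh img in auto)
    hence "L = contour_integral (rectpath ?a ?c) q"
      unfolding L_def using winding_number_rectpath[OF box] by (simp del: of_real_minus)
    also have "\<dots> = contour_integral (linepath ?a ?b) q + (contour_integral (linepath ?b ?c) q +
        (contour_integral (linepath ?c ?d) q + contour_integral (linepath ?d ?a) q))"
      unfolding rp using sub ci by (simp del: of_real_minus)
    finally have Leq: "L = contour_integral (linepath ?a ?b) q + (contour_integral (linepath ?b ?c) q +
        (contour_integral (linepath ?c ?d) q + contour_integral (linepath ?d ?a) q))" .
    have IR: "contour_integral (linepath ?a ?b) q = I R"
    proof -
      have "((\<lambda>x. q (of_real x)) has_integral I R) {-R..R}"
      proof -
        have si: "set_integrable lborel {-R..R} (\<lambda>x. q (of_real x))"
          by (rule borel_integrable_atLeastAtMost') (use qc continuous_on_subset in blast)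
        thus ?thesis
          using has_integral_integral_lborel[OF si[unfolded set_integrable_def]]
            set_borel_integral_eq_integral[OF si]
          by (simp add: I_def set_lebesgue_integral_def has_integral_integral)
      qed
      hence "(q has_contour_integral I R) (linepath ?a ?b)"
        using R0 by (subst has_contour_integral_linepath_Reals_iff) auto
      thus ?thesis by (rule contour_integral_unique)
    qed
    have seg: "cmod (contour_integral (linepath x y) q) \<le> B / (R - cmod p)\<^sup>2 * (2 * R)"
      if s: "closed_segment x y \<subseteq> S - {p}" and far: "\<And>z. z \<in> closed_segment x y \<Longrightarrow> R \<le> cmod z"
        and len: "cmod (y - x) \<le> 2 * R" for x y
    proof -
      have "cmod (contour_integral (linepath x y) q) \<le> B / (R - cmod p)\<^sup>2 * cmod (y - x)"
      proof (rule has_contour_integral_bound_linepath[OF has_contour_integral_integral[OF ci[OF s]]])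
        fix z assume z: "z \<in> closed_segment x y"
        have "R - cmod p \<le> cmod (z - p)" using far[OF z] norm_triangle_ineq2[of z p] by linarith
        hence "(R - cmod p)\<^sup>2 \<le> cmod (z - p) ^ 2" using R by (intro power_mono) auto
        also have "\<dots> \<le> cmod (z - p) ^ Suc N"
          using N R \<open>R - cmod p \<le> cmod (z - p)\<close> by (intro power_increasing) auto
        finally have "B / cmod (z - p) ^ Suc N \<le> B / (R - cmod p)\<^sup>2"
          using B0 R \<open>R - cmod p \<le> cmod (z - p)\<close>
          by (intro divide_left_mono mult_pos_pos zero_less_power) auto
        moreover have "z \<in> S" using s z by blast
        ultimately show "cmod (q z) \<le> B / (R - cmod p)\<^sup>2" using qb[of z] by simp
      qed (use B0 in auto)
      also have "\<dots> \<le> B / (R - cmod p)\<^sup>2 * (2 * R)" using len B0 by (intro mult_left_mono) auto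
      finally show ?thesis .
    qed
    have far: "z \<in> closed_segment ?b ?c \<Longrightarrow> R \<le> cmod z" "z \<in> closed_segment ?c ?d \<Longrightarrow> R \<le> cmod z"
        "z \<in> closed_segment ?d ?a \<Longrightarrow> R \<le> cmod z" for z
      using R0 abs_Re_le_cmod[of z] abs_Im_le_cmod[of z]
      by (auto simp: closed_segment_same_Re closed_segment_same_Im)
    have len: "cmod (?c - ?b) \<le> 2 * R" "cmod (?d - ?c) \<le> 2 * R" "cmod (?a - ?d) \<le> 2 * R"
      using R0 by (auto intro!: order_trans[OF cmod_le])
    define J1 J2 J3 where J: "J1 = contour_integral (linepath ?b ?c) q"
      "J2 = contour_integral (linepath ?c ?d) q" "J3 = contour_integral (linepath ?d ?a) q"
    have "cmod J1 \<le> B / (R - cmod p)\<^sup>2 * (2 * R)" "cmod J2 \<le> B / (R - cmod p)\<^sup>2 * (2 * R)"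
       "cmod J3 \<le> B / (R - cmod p)\<^sup>2 * (2 * R)"
      unfolding J using seg[OF sub(2) far(1) len(1)] seg[OF sub(3) far(2) len(2)] seg[OF sub(4) far(3) len(3)]
      by simp_all
    moreover have "I R - L = - (J1 + (J2 + J3))" using Leq IR by (simp add: J)
    hence "cmod (I R - L) \<le> cmod J1 + (cmod J2 + cmod J3)"
      by (metis norm_minus_cancel norm_triangle_mono order_refl norm_triangle_ineq)
    ultimately have "cmod (I R - L) \<le> 3 * (B / (R - cmod p)\<^sup>2 * (2 * R))" by linarith
    thus ?thesis by simp
  qed
  have "(\<lambda>n. I (real n) - L) \<longlonglongrightarrow> 0"
  proof (rule Lim_null_comparison)
    show "\<forall>\<^sub>F n in sequentially. cmod (I (real n) - L) \<le> 6 * B * real n / (real n - cmod p)\<^sup>2"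
      using eventually_ge_at_top[of "nat \<lceil>cmod p + 1\<rceil>"]
      by eventually_elim (rule bound, simp only: nat_le_iff, linarith)
    show "(\<lambda>n. 6 * B * real n / (real n - cmod p)\<^sup>2) \<longlonglongrightarrow> 0" by real_asymp
  qed
  hence "(\<lambda>n. I (real n)) \<longlonglongrightarrow> L" by (simp add: LIM_zero_iff)
  with lim1 have "(\<integral>u. q (of_real u) \<partial>lborel) = L" by (rule LIMSEQ_unique)
  hence "(\<integral>u. q (of_real u) \<partial>lborel) = 2 * pi * \<i> * ((deriv ^^ N) f p / fact N)"
    unfolding L_def res .
  thus "(\<integral>u. f (of_real u) / (of_real u - p) ^ Suc N \<partial>lborel) = 2 * pi * \<i> * ((deriv ^^ N) f p / fact N)"
    by (simp only: q_def)
qed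

lemma higher_deriv_shift:
  assumes "f holomorphic_on S" "open S" "z + c \<in> S"
  shows "(deriv ^^ n) (\<lambda>s. f (s + c)) z = (deriv ^^ n) f (z + c)"
proof -
  have "open ((\<lambda>s. s + c) -` S)" using assms(2) by (intro open_vimage continuous_intros)
  thus ?thesis
    using higher_deriv_compose_linear'[where u=1 and c=c and f=f and S="(\<lambda>s. s + c) -` S" and T=S and z=z and n=n] assms
    by simp
qed

text \<open>Sub-mean value property of \<open>(cmod g)^2\<close> on the disc of radius r =
  \<open>Im w / 2\<close> about w, as an average over rotations of the disc. The disc stays above
  height r, so the weight is at least \<open>r ^ m\<close> there.\<close>

lemma bergman_pointwise_bound:
  fixes g :: "complex \<Rightarrow> complex"
  assumes g: "g holomorphic_on {w. Im w > 0}"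
    and A: "(\<integral>\<^sup>+w. indicator {w. Im w > 0} w * ennreal ((cmod (g w))\<^sup>2 * Im w ^ m) \<partial>lborel) \<le> ennreal A" and A0: "A \<ge> 0"
    and w: "Im w > 0"
  shows "(cmod (g w))\<^sup>2 * Im w ^ (m + 2) \<le> 2 ^ (m + 2) * A / pi"
proof -
  define r where "r = Im w / 2"
  have r: "r > 0" using w by (simp add: r_def)
  have inb: "Im (w + y) > r" if "norm y < r" for y
    using that abs_Im_le_cmod[of y] by (simp add: r_def)
  define F where "F y = indicator (ball 0 r) y * ennreal ((cmod (g (w + y)))\<^sup>2)" for y
  have cg: "continuous_on {w. Im w > 0} g" using g holomorphic_on_imp_continuous_on by blast
  have [measurable]: "F \<in> borel_measurable borel"
  proof -
    have "(\<lambda>y. indicator (ball 0 r) y *\<^sub>R ((cmod (g (w + y)))\<^sup>2)) \<in> borel_measurable borel"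
      by (rule borel_measurable_continuous_on_indicator)
         (use inb r in \<open>auto intro!: continuous_intros continuous_on_compose2[OF cg] order.strict_trans[OF r]\<close>)
    hence "(\<lambda>y. ennreal (indicator (ball 0 r) y *\<^sub>R ((cmod (g (w + y)))\<^sup>2))) \<in> borel_measurable borel"
      by measurable
    thus ?thesis by (rule measurable_cong[THEN iffD1, rotated]) (auto simp: F_def indicator_def)
  qed
  define Q where "Q y = indicator {w. Im w > 0} y * ennreal ((cmod (g y))\<^sup>2 * Im y ^ m)" for y
  have [measurable]: "Q \<in> borel_measurable borel"
  proof -
    have "(\<lambda>y. indicator {w. Im w > 0} y *\<^sub>R ((cmod (g y))\<^sup>2 * Im y ^ m)) \<in> borel_measurable borel"
      by (rule borel_measurable_continuous_on_indicator)
         (auto intro!: continuous_intros cg open_halfspace_Im_gt borel_open)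
    hence "(\<lambda>y. ennreal (indicator {w. Im w > 0} y *\<^sub>R ((cmod (g y))\<^sup>2 * Im y ^ m))) \<in> borel_measurable borel"
      by measurable
    thus ?thesis by (rule measurable_cong[THEN iffD1, rotated]) (auto simp: Q_def indicator_def)
  qed
  have Rm: "(\<lambda>(x, y). unit_circle x * y) \<in> borel_measurable (borel \<Otimes>\<^sub>M borel)"
    unfolding borel_prod case_prod_unfold by (intro borel_measurable_continuous_onI continuous_intros)
  have "ennreal ((cmod (g w))\<^sup>2) * emeasure lborel (ball (0::complex) r)
      = (\<integral>\<^sup>+y. ennreal ((cmod (g w))\<^sup>2) * indicator (ball (0::complex) r) y \<partial>lborel)"
    by (rule nn_integral_cmult_indicator[symmetric]) simp
  also have "\<dots> \<le> (\<integral>\<^sup>+y. \<integral>\<^sup>+x. F (unit_circle x * y) \<partial>unit_interval \<partial>lborel)"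
  proof (rule nn_integral_mono)
    fix y :: complex
    show "ennreal ((cmod (g w))\<^sup>2) * indicator (ball (0::complex) r) y \<le> (\<integral>\<^sup>+x. F (unit_circle x * y) \<partial>unit_interval)"
    proof (cases "norm y < r")
      case True
      define S where "S = {s. Im (w + s * y) > 0}"
      have S: "open S" unfolding S_def by (intro open_Collect_less continuous_intros)
      have "cball 0 1 \<subseteq> S"
      proof
        fix s :: complex assume "s \<in> cball 0 1"
        hence "norm (s * y) < r" using True mult_left_le_one_le[of "norm y" "norm s"] by (simp add: norm_mult)
        from inb[OF this] r show "s \<in> S" by (simp add: S_def)
      qed
      moreover have "(\<lambda>s. g (w + s * y)) holomorphic_on S"
        by (rule holomorphic_on_compose_gen[of "\<lambda>s. w + s * y" _ g, unfolded o_def, OF _ g])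
           (auto intro!: holomorphic_intros simp: S_def)
      ultimately have "ennreal ((cmod (g (w + 0 * y)))\<^sup>2) \<le> (\<integral>\<^sup>+x. ennreal ((cmod (g (w + unit_circle x * y)))\<^sup>2) \<partial>unit_interval)"
        by (intro circle_sub_mean_value[where h="\<lambda>s. g (w + s * y)"])
      thus ?thesis using True by (simp add: F_def norm_mult)
    qed simp
  qed
  also have "\<dots> = (\<integral>\<^sup>+y. F y \<partial>lborel)"
    by (rule nn_integral_circle_average[symmetric, OF _ Rm lborel_distr_cmult]) auto
  also have "\<dots> \<le> (\<integral>\<^sup>+y. ennreal ((1 / r) ^ m) * Q (w + y) \<partial>lborel)"
  proof (rule nn_integral_mono)
    fix y
    show "F y \<le> ennreal ((1 / r) ^ m) * Q (w + y)"
    proof (cases "norm y < r")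
      case True
      have "1 \<le> ((1 / r) * Im (w + y)) ^ m" using inb[OF True] r by (intro one_le_power) (simp add: field_simps)
      hence "(cmod (g (w + y)))\<^sup>2 \<le> (cmod (g (w + y)))\<^sup>2 * ((1 / r) ^ m * Im (w + y) ^ m)"
        by (simp only: power_mult_distrib mult_le_cancel_left1) simp
      moreover have "Im (w + y) > 0" using inb[OF True] r by simp
      ultimately show ?thesis using r True
        by (simp add: F_def Q_def ennreal_mult[symmetric] mult_ac ennreal_leI)
    qed (simp add: F_def)
  qed
  also have "\<dots> = ennreal ((1 / r) ^ m) * (\<integral>\<^sup>+y. Q (w + y) \<partial>lborel)"
    by (rule nn_integral_cmult) measurable
  also have "(\<integral>\<^sup>+y. Q (w + y) \<partial>lborel) = (\<integral>\<^sup>+y. Q y \<partial>lborel)"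
    by (rule nn_integral_lborel_translate) measurable
  also have "ennreal ((1 / r) ^ m) * \<dots> \<le> ennreal ((1 / r) ^ m) * ennreal A"
    using A by (intro mult_left_mono) (auto simp: Q_def)
  also have "\<dots> = ennreal ((1 / r) ^ m * A)" using r A0 by (simp add: ennreal_mult)
  also have "emeasure lborel (ball (0::complex) r) = ennreal (pi * r\<^sup>2)"
    using r by (subst emeasure_ball) (auto simp: unit_ball_vol_2)
  finally have "(cmod (g w))\<^sup>2 * (pi * r\<^sup>2) \<le> (1 / r) ^ m * A"
    using r A0 by (simp add: ennreal_mult[symmetric])
  thus ?thesis using r w by (simp add: r_def field_simps power_add power2_eq_square)
qed

text \<open>Repeated integration by parts, condensed into an explicit antiderivative. All boundary
  terms at infinity vanish, and at 0 only the term without a power of v survives. It is used for the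
  vertical half-plane integral and for the Gamma integral with complex parameter.\<close>

lemma integral_power_mult_iterated_deriv:
  fixes D :: "nat \<Rightarrow> real \<Rightarrow> complex"
  assumes D: "\<And>j v. v \<ge> 0 \<Longrightarrow> (D j has_vector_derivative D (Suc j) v) (at v)"
    and lim: "\<And>j. ((\<lambda>v. of_real (v ^ j) * D j v) \<longlongrightarrow> 0) at_top"
    and int: "integrable lborel (\<lambda>v. indicator {0<..} v *\<^sub>R (of_real (v ^ k) * D (Suc k) v))"
  shows "(\<integral>v. indicator {0<..} v *\<^sub>R (of_real (v ^ k) * D (Suc k) v) \<partial>lborel) = - ((-1) ^ k * fact k * D 0 0)"
proof -
  \<comment> \<open>\<open>P k\<close> is an antiderivative of \<open>v^k * D (Suc k) v\<close>: in
    the recursion, the derivative of \<open>v^(Suc k)\<close> produces the term that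
    \<open>Suc k * P k\<close> removes.\<close>
  define P where "P = rec_nat (D 0) (\<lambda>k Pk v. of_real (v ^ Suc k) * D (Suc k) v - of_nat (Suc k) * Pk v)"
  have P0: "P 0 = D 0" and PS: "P (Suc k) = (\<lambda>v. of_real (v ^ Suc k) * D (Suc k) v - of_nat (Suc k) * P k v)" for k
    by (simp_all add: P_def)
  have P_deriv: "(P k has_vector_derivative of_real (v ^ k) * D (Suc k) v) (at v)" if "v \<ge> 0" for k v
  proof (induction k)
    case 0 show ?case using D[OF that] by (simp add: P0)
  next
    case (Suc k)
    have "((\<lambda>v. of_real (v ^ Suc k) * D (Suc k) v - of_nat (Suc k) * P k v) has_vector_derivative
       (of_real (v ^ Suc k) * D (Suc (Suc k)) v + of_real (of_nat (Suc k) * v ^ k) * D (Suc k) v)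
         - of_nat (Suc k) * (of_real (v ^ k) * D (Suc k) v)) (at v)"
    proof (intro has_vector_derivative_diff has_vector_derivative_mult D that has_vector_derivative_mult_right Suc)
      have "((\<lambda>v::real. v ^ Suc k) has_real_derivative of_nat (Suc k) * v ^ k) (at v)"
        using DERIV_pow[of "Suc k" v] by simp
      from has_vector_derivative_of_real[OF this]
      show "((\<lambda>v. complex_of_real (v ^ Suc k)) has_vector_derivative complex_of_real (real (Suc k) * v ^ k)) (at v)"
        by simp
    qed
    thus ?case by (simp add: PS algebra_simps)
  qed
  have P_lim: "(P k \<longlongrightarrow> 0) at_top" for k
  proof (induction k)
    case 0 show ?case using lim[of 0] by (simp add: P0)
  next
    case (Suc k) show ?case using tendsto_diff[OF lim[of "Suc k"] tendsto_mult_right_zero[OF Suc, of "of_nat (Suc k)"]]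
      by (simp only: PS) simp
  qed
  have P_0: "P k 0 = (-1) ^ k * fact k * D 0 0" for k
    by (induction k) (simp_all add: P0 PS algebra_simps)
  have E: "einterval 0 \<infinity> = {0<..}" by (auto simp: einterval_def)
  have Dc: "isCont (D j) v" if "v \<ge> 0" for j v
    using has_vector_derivative_continuous[OF D[OF that]] by simp
  have "(LBINT x=0..\<infinity>. of_real (x ^ k) * D (Suc k) x) = 0 - P k 0"
  proof (rule interval_integral_FTC_integrable[where F = "P k"])
    show "set_integrable lborel (einterval 0 \<infinity>) (\<lambda>x. complex_of_real (x ^ k) * D (Suc k) x)"
      using int by (simp only: E set_integrable_def)
    have "isCont (P k) 0" using has_vector_derivative_continuous[OF P_deriv[of 0 k]] by simp
    hence "(P k \<longlongrightarrow> P k 0) (at_right 0)" by (simp add: continuous_at filterlim_at_split)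
    thus "((P k \<circ> real_of_ereal) \<longlongrightarrow> P k 0) (at_right 0)"
      using ereal_tendsto_simps1(2)[of "P k" "P k 0" 0] by (simp add: zero_ereal_def)
    show "((P k \<circ> real_of_ereal) \<longlongrightarrow> 0) (at_left \<infinity>)"
      using P_lim[of k] by (simp add: ereal_tendsto_simps1)
  qed (use P_deriv Dc in \<open>auto intro!: continuous_intros\<close>)
  thus ?thesis
    by (simp add: P_0 interval_lebesgue_integral_def E set_lebesgue_integral_def zero_ereal_def[symmetric])
qed

text \<open>On the line at height v one has \<open>cnj w - w0 = u - p\<close> with
  \<open>p = w0 + \<i> * v\<close>, so the conjugated variable disappears and the horizontal
  integral is a residue, the N-th derivative of g at \<open>w0 + 2 * \<i> * v\<close>. Integrating
  this against \<open>v^(N-1)\<close> brings back g at w0. The bound K is the one that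
  \<open>bergman_pointwise_bound\<close> provides for square-integrable g.\<close>

lemma halfplane_reproducing:
  fixes g :: "complex \<Rightarrow> complex"
  assumes g: "g holomorphic_on {w. Im w > 0}"
    and K: "\<And>w. Im w > 0 \<Longrightarrow> (cmod (g w))\<^sup>2 * Im w ^ (N + 1) \<le> K" and N: "N \<ge> 1" and w0: "Im w0 > 0"
    and int: "integrable lborel (\<lambda>w. indicator {w. Im w > 0} w *\<^sub>R (g w * of_real (Im w ^ (N - 1)) / (\<i> * (cnj w - w0)) ^ Suc N))"
  shows "(\<integral>w. indicator {w. Im w > 0} w *\<^sub>R (g w * of_real (Im w ^ (N - 1)) / (\<i> * (cnj w - w0)) ^ Suc N) \<partial>lborel)
     = of_real (2 * pi / (real N * 2 ^ N)) * g w0"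
proof -
  define \<Phi> where "\<Phi> w = indicator {w. Im w > 0} w *\<^sub>R (g w * of_real (Im w ^ (N - 1)) / (\<i> * (cnj w - w0)) ^ Suc N)" for w
  have opH: "open {w. Im w > 0}" by (simp add: open_halfspace_Im_gt)
  have K0: "K \<ge> 0" using K[of \<i>] by (auto intro: order_trans[rotated])
  have gb: "cmod (g w) \<le> sqrt (K / y ^ (N + 1))" if "Im w \<ge> y" "y > 0" for w y
  proof -
    have "(cmod (g w))\<^sup>2 * y ^ (N + 1) \<le> (cmod (g w))\<^sup>2 * Im w ^ (N + 1)"
      using that by (intro mult_left_mono power_mono) auto
    also have "\<dots> \<le> K" using that by (intro K) auto
    finally have "(cmod (g w))\<^sup>2 \<le> K / y ^ (N + 1)" using that by (simp add: field_simps)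
    thus ?thesis using real_le_rsqrt by blast
  qed
  have cm: "(\<lambda>(u, v). Complex u v) \<in> borel_measurable (lborel \<Otimes>\<^sub>M lborel)"
    using measurable_Complex by (simp add: borel_prod lborel_prod)
  have \<Phi>m: "\<Phi> \<in> borel_measurable borel" using borel_measurable_integrable[OF int] by (simp add: \<Phi>_def[abs_def])
  have int2: "integrable (lborel \<Otimes>\<^sub>M lborel) (\<lambda>(u, v). \<Phi> (Complex u v))"
    using int unfolding lborel_complex \<Phi>_def[symmetric]
    by (subst (asm) integrable_distr_eq[OF cm]) (use \<Phi>m in \<open>auto simp: case_prod_unfold\<close>)
  have "(\<integral>w. \<Phi> w \<partial>lborel) = (\<integral>p. (case p of (u, v) \<Rightarrow> \<Phi> (Complex u v)) \<partial>(lborel \<Otimes>\<^sub>M lborel))"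
    unfolding lborel_complex by (subst integral_distr[OF cm]) (use \<Phi>m in \<open>auto simp: case_prod_unfold\<close>)
  also have "\<dots> = (\<integral>v. \<integral>u. \<Phi> (Complex u v) \<partial>lborel \<partial>lborel)"
    by (rule lborel_pair.integral_snd[OF int2, symmetric])
  finally have I1: "(\<integral>w. \<Phi> w \<partial>lborel) = (\<integral>v. \<integral>u. \<Phi> (Complex u v) \<partial>lborel \<partial>lborel)" .
  have I2: "integrable lborel (\<lambda>v. \<integral>u. \<Phi> (Complex u v) \<partial>lborel)"
    by (rule lborel_pair.integrable_snd[OF int2])
  \<comment> \<open>The j-th derivative of g along the vertical ray
    \<open>w0 + 2 * \<i> * v\<close>, with the chain rule factor.\<close>
  define D where "D j v = (2 * \<i>) ^ j * (deriv ^^ j) g (w0 + 2 * \<i> * of_real v)" for j :: nat and v :: real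
  define c where "c = 2 * pi * \<i> / (\<i> ^ Suc N * fact N * (2 * \<i>) ^ N)"
  have inner: "(\<integral>u. \<Phi> (Complex u v) \<partial>lborel) = c * (indicator {0<..} v *\<^sub>R (of_real (v ^ (N - 1)) * D N v))" for v
  proof (cases "v > 0")
    case False
    thus ?thesis by (simp add: \<Phi>_def)
  next
    case True
    define p where "p = w0 + \<i> * of_real v"
    have "\<Phi> (Complex u v) = of_real (v ^ (N - 1)) / \<i> ^ Suc N * (g (of_real u + \<i> * of_real v) / (of_real u - p) ^ Suc N)" for u
    proof -
      have e: "cnj (Complex u v) - w0 = of_real u - p" by (simp add: p_def complex_eq_iff)
      show ?thesis unfolding \<Phi>_def e
        using True by (simp add: power_mult_distrib Complex_eq del: power_Suc)
    qed
    hence "(\<integral>u. \<Phi> (Complex u v) \<partial>lborel) = of_real (v ^ (N - 1)) / \<i> ^ Suc N *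
        (\<integral>u. g (of_real u + \<i> * of_real v) / (of_real u - p) ^ Suc N \<partial>lborel)" 
      by (simp only: integral_mult_right_zero)
    also have "(\<integral>u. g (of_real u + \<i> * of_real v) / (of_real u - p) ^ Suc N \<partial>lborel)
       = 2 * pi * \<i> * ((deriv ^^ N) (\<lambda>s. g (s + \<i> * of_real v)) p / fact N)"
    \<comment> \<open>Raising the argument by v makes g holomorphic and bounded above height -v/2,
      so the margin is \<delta> = v/2.\<close>
    proof (rule line_integral_over_power)
      show "(\<lambda>s. g (s + \<i> * of_real v)) holomorphic_on {z. Im z > - (v / 2)}"
        by (rule holomorphic_on_compose_gen[of "\<lambda>s. s + \<i> * of_real v" _ g, unfolded o_def, OF _ g])
           (use True in \<open>auto intro!: holomorphic_intros\<close>)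
      show "cmod (g (z + \<i> * of_real v)) \<le> sqrt (K / (v / 2) ^ (N + 1))" if "Im z > - (v / 2)" for z
        using that True by (intro gb) auto
    qed (use True N w0 in \<open>auto simp: p_def\<close>)
    also have "(deriv ^^ N) (\<lambda>s. g (s + \<i> * of_real v)) p = (deriv ^^ N) g (p + \<i> * of_real v)"
      by (rule higher_deriv_shift[OF g opH]) (use w0 True in \<open>simp add: p_def\<close>)
    also have "p + \<i> * of_real v = w0 + 2 * \<i> * of_real v" by (simp add: p_def)
    finally show ?thesis using True by (simp add: D_def c_def divide_simps mult_ac)
  qed
  have c0: "c \<noteq> 0" by (simp add: c_def)
  have "(\<integral>v. indicator {0<..} v *\<^sub>R (of_real (v ^ (N - 1)) * D (Suc (N - 1)) v) \<partial>lborel) = - ((-1) ^ (N - 1) * fact (N - 1) * D 0 0)"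
  proof (rule integral_power_mult_iterated_deriv)
    fix j :: nat and v :: real assume v: "v \<ge> 0"
    have "((deriv ^^ j) g has_field_derivative (deriv ^^ Suc j) g (w0 + 2 * \<i> * of_real v)) (at (w0 + 2 * \<i> * of_real v))"
      using holomorphic_derivI[OF holomorphic_higher_deriv[OF g opH] opH, of "w0 + 2 * \<i> * of_real v" j] w0 v by simp
    moreover have "((\<lambda>v. w0 + 2 * \<i> * of_real v) has_vector_derivative 2 * \<i>) (at v)"
      by (auto intro!: derivative_eq_intros)
    ultimately have "((\<lambda>v. (deriv ^^ j) g (w0 + 2 * \<i> * of_real v)) has_vector_derivative 2 * \<i> * (deriv ^^ Suc j) g (w0 + 2 * \<i> * of_real v)) (at v)"
      using field_vector_diff_chain_at[of "\<lambda>v. w0 + 2 * \<i> * of_real v" "2 * \<i>" v "(deriv ^^ j) g"] by (simp add: o_def)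
    from has_vector_derivative_mult_right[OF this, of "(2 * \<i>) ^ j"]
    show "(D j has_vector_derivative D (Suc j) v) (at v)"
      by (simp add: D_def[abs_def] mult_ac)
  next
    fix j :: nat
    \<comment> \<open>Cauchy's estimate on the disc of radius v about
      \<open>w0 + 2 * \<i> * v\<close>: it stays above height v, where g is at most
      \<open>sqrt (K / v^(N+1))\<close>, and its factor \<open>v^(-j)\<close> cancels the power in
      front.\<close>
    show "((\<lambda>v. of_real (v ^ j) * D j v) \<longlongrightarrow> 0) at_top"
    proof (rule Lim_null_comparison)
      show "\<forall>\<^sub>F v in at_top. norm (of_real (v ^ j) * D j v) \<le> 2 ^ j * fact j * sqrt (K / v ^ (N + 1))"
        using eventually_gt_at_top[of 0]
      proof eventually_elim
        case (elim v)
        have Imv: "Im z > v" if "z \<in> cball (w0 + 2 * \<i> * of_real v) v" for z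
          using that abs_Im_le_cmod[of "w0 + 2 * \<i> * of_real v - z"] w0 elim by (simp add: dist_norm)
        have sub: "cball (w0 + 2 * \<i> * of_real v) v \<subseteq> {w. Im w > 0}"
          using Imv elim by fastforce
        have "cmod ((deriv ^^ j) g (w0 + 2 * \<i> * of_real v)) \<le> fact j * sqrt (K / v ^ (N + 1)) / v ^ j"
        proof (rule Cauchy_inequality)
          show "g holomorphic_on ball (w0 + 2 * \<i> * of_real v) v"
            using holomorphic_on_subset[OF g] sub ball_subset_cball by blast
          show "continuous_on (cball (w0 + 2 * \<i> * of_real v) v) g"
            using holomorphic_on_imp_continuous_on[OF holomorphic_on_subset[OF g sub]] .
          show "cmod (g x) \<le> sqrt (K / v ^ (N + 1))" if "cmod (w0 + 2 * \<i> * of_real v - x) = v" for x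
            using Imv[of x] that elim by (intro gb) (auto simp: dist_norm)
        qed (use elim in auto)
        hence "v ^ j * (2 ^ j * cmod ((deriv ^^ j) g (w0 + 2 * \<i> * of_real v))) \<le> v ^ j * (2 ^ j * (fact j * sqrt (K / v ^ (N + 1)) / v ^ j))"
          using elim by (intro mult_left_mono) auto
        thus ?case using elim by (simp add: D_def norm_mult norm_power)
      qed
      have "((\<lambda>v. K / v ^ (N + 1)) \<longlongrightarrow> 0) at_top"
        by (intro tendsto_divide_0[OF tendsto_const] filterlim_at_top_imp_at_infinity filterlim_pow_at_top filterlim_ident) auto
      from tendsto_mult_right_zero[OF tendsto_real_sqrt[OF this, simplified], of "2 ^ j * fact j"]
      show "((\<lambda>v. 2 ^ j * fact j * sqrt (K / v ^ (N + 1))) \<longlongrightarrow> 0) at_top" by simp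
    qed
  next
    show "integrable lborel (\<lambda>v. indicator {0<..} v *\<^sub>R (of_real (v ^ (N - 1)) * D (Suc (N - 1)) v))"
      using integrable_mult_right[OF I2[unfolded inner], of "inverse c"] c0 N by (simp add: mult.assoc[symmetric])
  qed
  hence I3: "(\<integral>v. indicator {0<..} v *\<^sub>R (of_real (v ^ (N - 1)) * D N v) \<partial>lborel) = - ((-1) ^ (N - 1) * fact (N - 1) * g w0)"
    using N by (simp add: D_def)
  have "(\<integral>w. \<Phi> w \<partial>lborel) = c * - ((-1) ^ (N - 1) * fact (N - 1) * g w0)"
    unfolding I1 inner by (simp only: integral_mult_right_zero I3)
  \<comment> \<open>N is what remains of \<open>fact N / fact (N - 1)\<close> and
    \<open>2 ^ N\<close> comes from the chain rule; the powers of \<i> and of -1 cancel.\<close>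
  also have "c * - ((-1) ^ (N - 1) * fact (N - 1) * g w0) = of_real (2 * pi / (real N * 2 ^ N)) * g w0"
  proof -
    obtain M where M: "N = Suc M" using N by (cases N) auto
    have "(\<i> ^ M * \<i> ^ M) = (-1) ^ M" by (simp add: power_mult_distrib[symmetric])
    thus ?thesis by (simp add: c_def M power_mult_distrib divide_simps)
  qed
  finally show ?thesis by (simp add: \<Phi>_def)
qed

section \<open>The reproducing formula on the Siegel domain\<close>

text \<open>The fiber of the domain over a value of the last coordinate is a ball; scaling its radius
  shows that the integral of the weight over the fiber is a constant times a power of Im w.\<close>

definition fiber_weight :: "nat \<Rightarrow> real \<Rightarrow> complex ^ 'n::finite \<Rightarrow> real" where
  "fiber_weight \<beta> v \<eta> = (if (norm \<eta>)\<^sup>2 / 4 < v then (v - (norm \<eta>)\<^sup>2 / 4) ^ \<beta> else 0)"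

text \<open>A Beta-type integral over the ball of radius 2. Its value stays implicit; positivity and
  finiteness are what enters.\<close>

definition fiber_const :: "nat \<Rightarrow> 'n::finite itself \<Rightarrow> ennreal" where
  "fiber_const \<beta> _ = (\<integral>\<^sup>+\<eta>. ennreal (fiber_weight \<beta> 1 (\<eta> :: complex ^ 'n)) \<partial>lborel)"

lemma fiber_weight_nonneg [simp]: "fiber_weight \<beta> v \<eta> \<ge> 0"
  by (simp add: fiber_weight_def)

lemma measurable_fiber_weight [measurable]: "fiber_weight \<beta> v \<in> borel_measurable borel"
  unfolding fiber_weight_def[abs_def] by measurable

lemma fiber_weight_eq: "fiber_weight \<beta> (Im (snd z)) (fst z) = indicator siegelU z * rho z ^ \<beta>"
  by (auto simp: fiber_weight_def siegelU_def rho_def indicator_def)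

lemma fiber_weight_nonpos: "v \<le> 0 \<Longrightarrow> fiber_weight \<beta> v \<eta> = 0"
  using zero_le_power2[of "norm \<eta>"] unfolding fiber_weight_def by (subst if_not_P) linarith+

lemma fiber_const_finite: "fiber_const \<beta> TYPE('n::finite) < \<infinity>"
proof -
  have "fiber_const \<beta> TYPE('n) \<le> (\<integral>\<^sup>+\<eta>. indicator (ball (0 :: complex ^ 'n) 2) \<eta> \<partial>lborel)"
    unfolding fiber_const_def
  proof (rule nn_integral_mono)
    fix \<eta> :: "complex ^ 'n"
    show "ennreal (fiber_weight \<beta> 1 \<eta>) \<le> indicator (ball 0 2) \<eta>"
    proof (cases "(norm \<eta>)\<^sup>2 / 4 < 1")
      case True
      hence "(norm \<eta>)\<^sup>2 < 2\<^sup>2" by simp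
      hence "norm \<eta> < 2" by (rule power2_less_imp_less) simp
      moreover have "fiber_weight \<beta> 1 \<eta> \<le> 1" using True by (auto simp: fiber_weight_def intro!: power_le_one)
      ultimately show ?thesis by simp
    qed (simp add: fiber_weight_def)
  qed
  also have "\<dots> < \<infinity>" using emeasure_lborel_ball_finite[of "0 :: complex ^ 'n" 2] by simp
  finally show ?thesis .
qed

lemma fiber_const_pos: "fiber_const \<beta> TYPE('n::finite) > 0"
proof -
  have "0 < ennreal ((1/2) ^ \<beta>) * emeasure lborel (ball (0 :: complex ^ 'n) 1)"
  proof -
    have "emeasure lborel (ball (0 :: complex ^ 'n) 1) = ennreal (measure lborel (ball (0 :: complex ^ 'n) 1))"
      using emeasure_lborel_ball_finite[of "0 :: complex ^ 'n" 1] by (intro emeasure_eq_ennreal_measure) auto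
    thus ?thesis using content_ball_pos[of 1 "0 :: complex ^ 'n"] by (simp add: ennreal_zero_less_mult_iff)
  qed
  also have "\<dots> = (\<integral>\<^sup>+\<eta>. ennreal ((1/2) ^ \<beta>) * indicator (ball (0 :: complex ^ 'n) 1) \<eta> \<partial>lborel)"
    by (rule nn_integral_cmult_indicator[symmetric]) simp
  also have "\<dots> \<le> fiber_const \<beta> TYPE('n)"
    unfolding fiber_const_def
  proof (rule nn_integral_mono)
    fix \<eta> :: "complex ^ 'n"
    show "ennreal ((1/2) ^ \<beta>) * indicator (ball 0 1) \<eta> \<le> ennreal (fiber_weight \<beta> 1 \<eta>)"
    proof (cases "norm \<eta> < 1")
      case True
      hence "(norm \<eta>)\<^sup>2 < 1" by (simp add: power_less_one_iff)
      hence "(1/2) ^ \<beta> \<le> fiber_weight \<beta> 1 \<eta>" by (auto simp: fiber_weight_def intro!: power_mono)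
      thus ?thesis using True by (simp add: ennreal_leI)
    qed simp
  qed
  finally show ?thesis .
qed

lemma nn_integral_fiber_weight:
  assumes v: "v > 0"
  shows "(\<integral>\<^sup>+\<eta>. ennreal (fiber_weight \<beta> v (\<eta> :: complex ^ 'n::finite)) \<partial>lborel) = ennreal (v ^ (\<beta> + CARD('n))) * fiber_const \<beta> TYPE('n)"
proof -
  define s where "s = sqrt v"
  have s: "s > 0" "s\<^sup>2 = v" using v by (simp_all add: s_def)
  have w: "fiber_weight \<beta> v (s *\<^sub>R \<eta>) = v ^ \<beta> * fiber_weight \<beta> 1 \<eta>" for \<eta> :: "complex ^ 'n"
  proof -
    have n: "(norm (s *\<^sub>R \<eta>))\<^sup>2 = v * (norm \<eta>)\<^sup>2" using s by (simp add: power_mult_distrib)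
    have "v * (norm \<eta>)\<^sup>2 / 4 < v \<longleftrightarrow> (norm \<eta>)\<^sup>2 / 4 < 1" using v by (simp add: field_simps)
    moreover have "v - v * (norm \<eta>)\<^sup>2 / 4 = v * (1 - (norm \<eta>)\<^sup>2 / 4)" by (simp add: field_simps)
    ultimately show ?thesis by (simp add: fiber_weight_def n power_mult_distrib del: norm_scaleR)
  qed
  have "(\<integral>\<^sup>+\<eta>. ennreal (fiber_weight \<beta> v (\<eta> :: complex ^ 'n)) \<partial>lborel)
    = (\<integral>\<^sup>+\<eta>. ennreal (\<bar>s\<bar> ^ DIM(complex ^ 'n)) * ennreal (fiber_weight \<beta> v (s *\<^sub>R \<eta> :: complex ^ 'n)) \<partial>lborel)"
    using s by (subst lborel_affine[of s 0]) (simp_all add: nn_integral_density nn_integral_distr ennreal_power)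
  also have "\<dots> = (\<integral>\<^sup>+\<eta>. ennreal (v ^ (\<beta> + CARD('n))) * ennreal (fiber_weight \<beta> 1 (\<eta> :: complex ^ 'n)) \<partial>lborel)"
  proof (rule nn_integral_cong)
    fix \<eta> :: "complex ^ 'n"
    \<comment> \<open>The real dimension is 2d, so dilation by \<open>sqrt v\<close> has Jacobian
      \<open>v ^ d\<close>: this is the d in the exponent \<beta> + d.\<close>
    have "\<bar>s\<bar> ^ DIM(complex ^ 'n) = (s\<^sup>2) ^ CARD('n)" using s(1) by (simp add: mult.commute flip: power_mult)
    hence "\<bar>s\<bar> ^ DIM(complex ^ 'n) = v ^ CARD('n)" by (simp only: s(2))
    thus "ennreal (\<bar>s\<bar> ^ DIM(complex ^ 'n)) * ennreal (fiber_weight \<beta> v (s *\<^sub>R \<eta>)) =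
         ennreal (v ^ (\<beta> + CARD('n))) * ennreal (fiber_weight \<beta> 1 \<eta>)"
      using v by (simp only: w) (simp add: ennreal_mult[symmetric] power_add mult_ac)
  qed
  also have "\<dots> = ennreal (v ^ (\<beta> + CARD('n))) * fiber_const \<beta> TYPE('n)"
    unfolding fiber_const_def by (rule nn_integral_cmult) measurable
  finally show ?thesis .
qed

lemma measurable_vscale_circle: "(\<lambda>(x, y). vscale (unit_circle x) y) \<in> borel_measurable (borel \<Otimes>\<^sub>M borel)"
  unfolding borel_prod case_prod_unfold by (intro borel_measurable_continuous_onI continuous_intros)

lemma fiber_weight_vscale: "cmod c = 1 \<Longrightarrow> fiber_weight \<beta> v (vscale c y) = fiber_weight \<beta> v y"
  by (simp add: fiber_weight_def norm_vscale)

lemma vscale_in_fiber: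
  assumes "(norm y)\<^sup>2 / 4 < v" "s \<in> cball 0 1"
  shows "(norm (vscale s y))\<^sup>2 / 4 < v"
proof -
  have "norm (vscale s y) \<le> norm y" using assms(2) by (simp add: norm_vscale mult_left_le_one_le)
  hence "(norm (vscale s y))\<^sup>2 \<le> (norm y)\<^sup>2" by (intro power_mono) auto
  thus ?thesis using assms(1) by linarith
qed

text \<open>The weight is invariant under the rotations \<open>vscale (unit_circle x)\<close>.
  Averaging over them replaces h(y) by the mean of h over the circle through y, which is h(0).
  Holomorphy is used only on complex lines through 0.\<close>

lemma integral_fiber_holomorphic:
  fixes h :: "complex ^ 'n::finite \<Rightarrow> complex"
  assumes h: "\<And>y. (\<lambda>s. h (vscale s y)) holomorphic_on {s. (norm (vscale s y))\<^sup>2 / 4 < v}"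
    and int: "integrable lborel (\<lambda>\<eta>. fiber_weight \<beta> v \<eta> *\<^sub>R h \<eta>)" and v: "v > 0"
  shows "(\<integral>\<eta>. fiber_weight \<beta> v \<eta> *\<^sub>R h \<eta> \<partial>lborel) = of_real (v ^ (\<beta> + CARD('n)) * enn2real (fiber_const \<beta> TYPE('n))) * h 0"
proof -
  have "(\<integral>\<eta>. fiber_weight \<beta> v \<eta> *\<^sub>R h \<eta> \<partial>lborel)
     = (\<integral>y. \<integral>x. fiber_weight \<beta> v (vscale (unit_circle x) y) *\<^sub>R h (vscale (unit_circle x) y) \<partial>unit_interval \<partial>lborel)"
    by (rule integral_circle_average[OF int measurable_vscale_circle]) (simp add: lborel_distr_vscale)
  also have "\<dots> = (\<integral>y. fiber_weight \<beta> v (y :: complex ^ 'n) *\<^sub>R h 0 \<partial>lborel)"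
  proof (rule Bochner_Integration.integral_cong[OF refl])
    fix y :: "complex ^ 'n"
    have "(\<integral>x. h (vscale (unit_circle x) y) \<partial>unit_interval) = h 0" if y: "(norm y)\<^sup>2 / 4 < v"
      using circle_mean_value[OF h[of y], of 0 1] vscale_in_fiber[OF y]
      by (force simp: vscale_def zero_vec_def)
    thus "(\<integral>x. fiber_weight \<beta> v (vscale (unit_circle x) y) *\<^sub>R h (vscale (unit_circle x) y) \<partial>unit_interval) = fiber_weight \<beta> v y *\<^sub>R h 0"
      by (cases "(norm y)\<^sup>2 / 4 < v") (simp_all add: fiber_weight_vscale, simp add: fiber_weight_def)
  qed
  also have "\<dots> = (\<integral>y. fiber_weight \<beta> v (y :: complex ^ 'n) \<partial>lborel) *\<^sub>R h 0"
  proof (rule integral_scaleR_left)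
    show "integrable lborel (fiber_weight \<beta> v :: complex ^ 'n \<Rightarrow> real)"
      by (rule integrableI_nonneg)
         (use fiber_const_finite[of \<beta>, where 'n='n] v in \<open>auto simp: nn_integral_fiber_weight ennreal_mult_less_top\<close>)
  qed
  also have "(\<integral>y. fiber_weight \<beta> v (y :: complex ^ 'n) \<partial>lborel) = v ^ (\<beta> + CARD('n)) * enn2real (fiber_const \<beta> TYPE('n))"
    using v by (subst integral_eq_nn_integral) (auto simp: nn_integral_fiber_weight enn2real_mult)
  finally show ?thesis by (simp add: scaleR_conv_of_real)
qed

text \<open>The same averaging with the sub-mean value inequality in place of the mean value
  property. It bounds the Bergman norm of the restriction to first coordinate 0 by the norm on the
  whole domain.\<close>

lemma nn_integral_fiber_holomorphic:
  fixes h :: "complex ^ 'n::finite \<Rightarrow> complex"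
  assumes h: "\<And>y. (\<lambda>s. h (vscale s y)) holomorphic_on {s. (norm (vscale s y))\<^sup>2 / 4 < v}"
    and meas: "(\<lambda>\<eta>. ennreal (fiber_weight \<beta> v \<eta> * (cmod (h \<eta>))\<^sup>2)) \<in> borel_measurable borel" and v: "v > 0"
  shows "ennreal (v ^ (\<beta> + CARD('n)) * (cmod (h 0))\<^sup>2) * fiber_const \<beta> TYPE('n) \<le> (\<integral>\<^sup>+\<eta>. ennreal (fiber_weight \<beta> v \<eta> * (cmod (h \<eta>))\<^sup>2) \<partial>lborel)"
proof -
  have "ennreal (v ^ (\<beta> + CARD('n)) * (cmod (h 0))\<^sup>2) * fiber_const \<beta> TYPE('n)
     = (\<integral>\<^sup>+y. ennreal (fiber_weight \<beta> v (y :: complex ^ 'n)) * ennreal ((cmod (h 0))\<^sup>2) \<partial>lborel)"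
    using v by (subst nn_integral_multc) (auto simp: nn_integral_fiber_weight ennreal_mult mult_ac)
  also have "\<dots> \<le> (\<integral>\<^sup>+y. \<integral>\<^sup>+x. ennreal (fiber_weight \<beta> v (vscale (unit_circle x) y) * (cmod (h (vscale (unit_circle x) y)))\<^sup>2) \<partial>unit_interval \<partial>lborel)"
  proof (rule nn_integral_mono)
    fix y :: "complex ^ 'n"
    show "ennreal (fiber_weight \<beta> v y) * ennreal ((cmod (h 0))\<^sup>2)
      \<le> (\<integral>\<^sup>+x. ennreal (fiber_weight \<beta> v (vscale (unit_circle x) y) * (cmod (h (vscale (unit_circle x) y)))\<^sup>2) \<partial>unit_interval)"
    proof (cases "(norm y)\<^sup>2 / 4 < v")
      case True
      have sub: "cball 0 1 \<subseteq> {s. (norm (vscale s y))\<^sup>2 / 4 < v}" using vscale_in_fiber[OF True] by blast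
      have le: "ennreal ((cmod (h 0))\<^sup>2) \<le> (\<integral>\<^sup>+x. ennreal ((cmod (h (vscale (unit_circle x) y)))\<^sup>2) \<partial>unit_interval)"
        using circle_sub_mean_value[OF h[of y] sub] by (simp add: vscale_def zero_vec_def)
      have c: "continuous_on {0..1} (\<lambda>x. h (vscale (unit_circle x) y))"
        by (rule continuous_on_compose2[OF holomorphic_on_imp_continuous_on[OF h[of y]]])
           (intro continuous_intros, intro image_subsetI CollectI vscale_in_fiber[OF True], simp)
      have "(\<lambda>x. ennreal ((cmod (h (vscale (unit_circle x) y)))\<^sup>2)) \<in> borel_measurable unit_interval"
        using borel_measurable_integrable[OF integrable_unit_interval[OF c]] by measurable
      thus ?thesis using mult_left_mono[OF le, of "ennreal (fiber_weight \<beta> v y)"]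
        by (simp add: fiber_weight_vscale ennreal_mult nn_integral_cmult)
    qed (simp add: fiber_weight_def)
  qed
  also have "\<dots> = (\<integral>\<^sup>+\<eta>. ennreal (fiber_weight \<beta> v \<eta> * (cmod (h \<eta>))\<^sup>2) \<partial>lborel)"
    by (rule nn_integral_circle_average[symmetric, OF meas measurable_vscale_circle]) (simp add: lborel_distr_vscale)
  finally show ?thesis .
qed

text \<open>Write X for \<open>cmod (cnj w - w0)\<close>. Of the 2N + 2 powers of X, four pay for
  the factors \<open>1 + (Re w)^2\<close> and \<open>1 + (Im w)^2\<close>, and the other 2N - 2 pay
  for \<open>Im w ^ (N - 1)\<close> and \<open>Im w0 ^ (N - 1)\<close>, because X is at least
  \<open>Im w + Im w0\<close>. This leaves a product of two integrable functions.\<close>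

lemma kernel_integral_finite:
  assumes w0: "Im w0 > 0" and N: "N \<ge> 1"
  shows "(\<integral>\<^sup>+w. indicator {w. Im w > 0} w * ennreal (Im w ^ (N - 1) / cmod (cnj w - w0) ^ (2 * N + 2)) \<partial>lborel) < \<infinity>"
proof -
  define a b where "a = Re w0" and "b = Im w0"
  define C where "C = 2 + (1 + 2 * a\<^sup>2) / b\<^sup>2"
  define C' where "C' = 2 + 1 / b\<^sup>2"
  have b: "b > 0" using w0 by (simp add: b_def)
  have C: "C > 0" "C' > 0" unfolding C_def C'_def using b by (auto intro!: add_pos_nonneg)
  define k where "k = C * C' / b ^ (N - 1)"
  have k: "k \<ge> 0" using C b by (simp add: k_def)
  define q where "q u = ennreal (inverse (1 + u\<^sup>2))" for u :: real
  have q: "(\<integral>\<^sup>+u. q u \<partial>lborel) < \<infinity>"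
    using integrable_inverse_1_plus_square unfolding q_def integrable_iff_bounded set_integrable_def by simp
  have [measurable]: "q \<in> borel_measurable borel" unfolding q_def by measurable
  have cm: "(\<lambda>(u, v). Complex u v) \<in> borel_measurable (lborel \<Otimes>\<^sub>M lborel)"
    using measurable_Complex by (simp add: borel_prod lborel_prod)
  have "(\<integral>\<^sup>+w. indicator {w. Im w > 0} w * ennreal (Im w ^ (N - 1) / cmod (cnj w - w0) ^ (2 * N + 2)) \<partial>lborel)
     \<le> (\<integral>\<^sup>+w. ennreal k * (q (Re w) * q (Im w)) \<partial>lborel)"
  proof (rule nn_integral_mono)
    fix w :: complex
    show "indicator {w. Im w > 0} w * ennreal (Im w ^ (N - 1) / cmod (cnj w - w0) ^ (2 * N + 2)) \<le> ennreal k * (q (Re w) * q (Im w))"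
    proof (cases "Im w > 0")
      case True
      define X where "X = cmod (cnj w - w0)"
      have X2: "X\<^sup>2 = (Re w - a)\<^sup>2 + (Im w + b)\<^sup>2"
        unfolding X_def cmod_power2 by (simp add: a_def b_def power2_eq_square algebra_simps)
      have Xv: "Im w + b \<le> X" using abs_Im_le_cmod[of "cnj w - w0"] True b by (simp add: X_def b_def)
      have "b\<^sup>2 \<le> (Im w + b)\<^sup>2" using True b by (intro power_mono) auto
      hence "1 + (Re w)\<^sup>2 \<le> C * X\<^sup>2"
        using one_plus_square_le[OF b, of "Re w" a] C
        by (auto simp: C_def X2 intro: order_trans mult_left_mono)
      moreover have "1 + (Im w)\<^sup>2 \<le> C' * X\<^sup>2"
      proof -
        have "(Im w)\<^sup>2 + b\<^sup>2 \<le> (Im w + b)\<^sup>2" using True b by (simp add: power2_eq_square algebra_simps)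
        hence "C' * ((Im w - 0)\<^sup>2 + b\<^sup>2) \<le> C' * X\<^sup>2" using C by (intro mult_left_mono) (auto simp: X2 add_increasing)
        thus ?thesis using one_plus_square_le[OF b, of "Im w" 0] by (simp add: C'_def)
      qed
      ultimately have key: "(1 + (Re w)\<^sup>2) * (1 + (Im w)\<^sup>2) \<le> (C * X\<^sup>2) * (C' * X\<^sup>2)"
        using C by (intro mult_mono) auto
      have X0: "X > 0" using Xv True b by linarith
      have key1: "Im w ^ (N - 1) * b ^ (N - 1) \<le> X ^ (N - 1) * X ^ (N - 1)"
        using True b Xv by (intro mult_mono power_mono) auto
      hence "(Im w ^ (N - 1) * b ^ (N - 1)) * ((1 + (Re w)\<^sup>2) * (1 + (Im w)\<^sup>2)) \<le> (X ^ (N - 1) * X ^ (N - 1)) * ((C * X\<^sup>2) * (C' * X\<^sup>2))"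
        using X0 by (intro mult_mono[OF key1 key]) auto
      also have "\<dots> = C * C' * (X ^ (N - 1) * X ^ (N - 1) * X ^ 4)" by (simp add: power2_eq_square power4_eq_xxxx algebra_simps)
      also have "X ^ (N - 1) * X ^ (N - 1) * X ^ 4 = X ^ (2 * N + 2)"
      proof -
        have "(N - 1) + (N - 1) + 4 = 2 * N + 2" using N by simp
        from arg_cong[OF this, of "\<lambda>k. X ^ k"] show ?thesis by (simp only: power_add)
      qed
      finally have "Im w ^ (N - 1) / X ^ (2 * N + 2) \<le> k * (inverse (1 + (Re w)\<^sup>2) * inverse (1 + (Im w)\<^sup>2))"
        using X0 b by (simp add: k_def divide_simps add_pos_nonneg)
      thus ?thesis using True k unfolding X_def
        by (simp add: q_def ennreal_mult[symmetric] ennreal_leI)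
    qed simp
  qed
  also have "\<dots> = ennreal k * (\<integral>\<^sup>+w. (q (Re w) * q (Im w)) \<partial>lborel)"
    by (rule nn_integral_cmult) measurable
  also have "(\<integral>\<^sup>+w. (q (Re w) * q (Im w)) \<partial>lborel) = (\<integral>\<^sup>+p. (q (fst p) * q (snd p)) \<partial>(lborel \<Otimes>\<^sub>M lborel))"
    unfolding lborel_complex by (subst nn_integral_distr[OF cm]) (auto simp: case_prod_unfold)
  also have "\<dots> = (\<integral>\<^sup>+v. \<integral>\<^sup>+u. q u * q v \<partial>lborel \<partial>lborel)"
    by (subst lborel_pair.nn_integral_snd[symmetric]) auto
  also have "\<dots> = (\<integral>\<^sup>+u. q u \<partial>lborel) * (\<integral>\<^sup>+u. q u \<partial>lborel)"
    by (simp add: nn_integral_multc nn_integral_cmult)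
  also have "ennreal k * \<dots> < \<infinity>" using q by (simp add: ennreal_mult_less_top)
  finally show ?thesis .
qed

abbreviation siegel_weight :: "nat \<Rightarrow> (complex ^ 'n::finite) \<times> complex \<Rightarrow> real" where
  "siegel_weight \<beta> z \<equiv> fiber_weight \<beta> (Im (snd z)) (fst z)"

lemma continuous_on_rho [continuous_intros]: "continuous_on A rho"
  unfolding rho_def[abs_def] by (intro continuous_intros) auto

lemma open_siegelU: "open siegelU"
  unfolding siegelU_def by (intro open_Collect_less continuous_intros)

lemma siegelU_Im_pos:
  assumes "z \<in> siegelU" shows "Im (snd z) > 0"
proof -
  have "Im (snd z) - (norm (fst z))\<^sup>2 / 4 > 0" using assms by (simp only: siegelU_def rho_def mem_Collect_eq)
  thus ?thesis using zero_le_power2[of "norm (fst z)"] by linarith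
qed

text \<open>The weight vanishes off the domain, so continuity on \<open>siegelU\<close> alone makes
  the product Borel on the whole space.\<close>

lemma measurable_siegel_weight_scaleR:
  fixes H :: "(complex ^ 'n::finite) \<times> complex \<Rightarrow> 'b::{real_normed_vector, second_countable_topology}"
  assumes "continuous_on siegelU H"
  shows "(\<lambda>z. siegel_weight \<beta> z *\<^sub>R H z) \<in> borel_measurable borel"
proof -
  have "(\<lambda>z. indicator siegelU z *\<^sub>R (rho z ^ \<beta> *\<^sub>R H z)) \<in> borel_measurable borel"
    by (rule borel_measurable_continuous_on_indicator)
       (auto intro!: continuous_intros assms borel_open open_siegelU)
  thus ?thesis by (simp add: fiber_weight_eq)
qed

lemma fst_snd_in_siegelU: "(\<eta>, w) \<in> siegelU \<longleftrightarrow> (norm \<eta>)\<^sup>2 / 4 < Im w"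
  by (auto simp: siegelU_def rho_def)

lemma holomorphic_several_fiber:
  assumes G: "holomorphic_several G siegelU"
  shows "(\<lambda>s. G (vscale s y, w)) holomorphic_on {s. (norm (vscale s y))\<^sup>2 / 4 < Im w}"
proof -
  have e: "(0, w) + cscale s (y, 0) = (vscale s y, w)" for s by (simp add: cscale_def vscale_def)
  have "open {s. (norm (vscale s y))\<^sup>2 / 4 < Im w}"
    by (intro open_Collect_less continuous_intros) auto
  thus ?thesis
    using holomorphic_several_line[OF G, of "{s. (norm (vscale s y))\<^sup>2 / 4 < Im w}" "(0, w)" "(y, 0)"]
    by (simp add: e fst_snd_in_siegelU)
qed

text \<open>The half-plane constant \<open>2 pi / (N * 2^N)\<close> for N = \<beta> + d + 1, times
  the fiber constant.\<close>

definition siegel_const :: "nat \<Rightarrow> 'n::finite itself \<Rightarrow> real" where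
  "siegel_const \<beta> T = 2 * pi / (real (\<beta> + CARD('n) + 1) * 2 ^ (\<beta> + CARD('n) + 1)) * enn2real (fiber_const \<beta> T)"

lemma siegel_const_pos: "siegel_const \<beta> TYPE('n::finite) > 0"
  using fiber_const_pos[of \<beta>, where 'n='n] fiber_const_finite[of \<beta>, where 'n='n]
  unfolding siegel_const_def by (intro mult_pos_pos divide_pos_pos) (auto simp: enn2real_positive_iff)

text \<open>At a point with first coordinate 0 the kernel depends on the last coordinate only.
  Integrating over the fiber first turns G into \<open>G (0, w)\<close> times
  \<open>Im w ^ (\<beta> + d)\<close>, up to the fiber constant, and the half-plane formula with N -
  1 = \<beta> + d finishes.\<close>

lemma siegel_reproducing_0:
  fixes G :: "(complex ^ 'n::finite) \<times> complex \<Rightarrow> complex"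
  assumes G: "holomorphic_several G siegelU"
    and fin: "(\<integral>\<^sup>+z. ennreal (siegel_weight \<beta> z * (cmod (G z))\<^sup>2) \<partial>lborel) < \<infinity>"
    and w0: "Im w0 > 0" and N: "N = \<beta> + CARD('n) + 1"
  defines "k \<equiv> \<lambda>z. 1 / (\<i> * (cnj (snd z) - w0)) ^ Suc N"
  shows "(\<integral>\<^sup>+z. ennreal (siegel_weight \<beta> (z :: (complex ^ 'n) \<times> complex) * (cmod (k z))\<^sup>2) \<partial>lborel) < \<infinity>"
    and "(\<integral>z. siegel_weight \<beta> z *\<^sub>R (G z * k z) \<partial>lborel) = of_real (siegel_const \<beta> TYPE('n)) * G (0, w0)"
proof -
  let ?H = "{w::complex. Im w > 0}"
  let ?C = "fiber_const \<beta> TYPE('n)"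
  have N1: "N \<ge> 1" and N2: "N - 1 = \<beta> + CARD('n)" "N - Suc 0 = \<beta> + CARD('n)" using N by auto
  have nz: "cnj (snd z) - w0 \<noteq> 0" if "z \<in> siegelU" for z :: "(complex ^ 'n) \<times> complex"
    using siegelU_Im_pos[OF that] w0 by (auto simp: complex_eq_iff)
  have ck: "continuous_on siegelU k"
    unfolding k_def using nz by (intro continuous_intros) auto
  have cG: "continuous_on siegelU G" using G by (rule holomorphic_several_continuous_on)
  have kk: "k (\<eta>, w) = 1 / (\<i> * (cnj w - w0)) ^ Suc N" for \<eta> :: "complex ^ 'n" and w by (simp add: k_def)
  have mk: "(\<lambda>z. ennreal (siegel_weight \<beta> (z :: (complex ^ 'n) \<times> complex) * (cmod (k z))\<^sup>2)) \<in> borel_measurable borel"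
    using measurable_siegel_weight_scaleR[of "\<lambda>z. (cmod (k z))\<^sup>2" \<beta>] ck by (simp add: continuous_intros)
  have mG: "(\<lambda>z. ennreal (siegel_weight \<beta> z * (cmod (G z))\<^sup>2)) \<in> borel_measurable borel"
    using measurable_siegel_weight_scaleR[of "\<lambda>z. (cmod (G z))\<^sup>2" \<beta>] cG by (simp add: continuous_intros)
  have pairm: "f \<in> borel_measurable (borel :: ((complex ^ 'n) \<times> complex) measure) \<Longrightarrow> f \<in> borel_measurable (lborel \<Otimes>\<^sub>M lborel)"
    for f :: "_ \<Rightarrow> ennreal" by (simp add: lborel_prod)
  have nnfub: "(\<integral>\<^sup>+z. f z \<partial>lborel) = (\<integral>\<^sup>+w. \<integral>\<^sup>+\<eta>. f (\<eta>, w) \<partial>lborel \<partial>lborel)"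
    if "f \<in> borel_measurable borel" for f :: "(complex ^ 'n) \<times> complex \<Rightarrow> ennreal"
    using lborel_pair.nn_integral_snd[OF pairm[OF that]] by (simp add: lborel_prod)
  have slice: "(\<lambda>\<eta>. f (\<eta>, w)) \<in> borel_measurable borel" if "f \<in> borel_measurable borel"
    for f :: "(complex ^ 'n) \<times> complex \<Rightarrow> ennreal" and w
    using measurable_compose[OF _ that, of "\<lambda>\<eta>. (\<eta>, w)" borel] by (simp add: borel_measurable_continuous_onI continuous_intros)
  show finK: "(\<integral>\<^sup>+z. ennreal (siegel_weight \<beta> (z :: (complex ^ 'n) \<times> complex) * (cmod (k z))\<^sup>2) \<partial>lborel) < \<infinity>"
  proof -
    have "(\<integral>\<^sup>+z. ennreal (siegel_weight \<beta> (z :: (complex ^ 'n) \<times> complex) * (cmod (k z))\<^sup>2) \<partial>lborel)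
      = (\<integral>\<^sup>+w. (indicator ?H w * ennreal (Im w ^ (N - 1) / cmod (cnj w - w0) ^ (2 * N + 2))) * ?C \<partial>lborel)"
      unfolding nnfub[OF mk]
    proof (rule nn_integral_cong)
      fix w :: complex
      have e: "(cmod (1 / (\<i> * (cnj w - w0)) ^ Suc N))\<^sup>2 = 1 / cmod (cnj w - w0) ^ (2 * N + 2)"
      proof -
        have n: "2 * N + 2 = Suc N * 2" by simp
        show ?thesis unfolding n power_mult
          by (simp add: norm_divide norm_power norm_mult power_divide del: power_Suc)
      qed
      show "(\<integral>\<^sup>+\<eta>. ennreal (siegel_weight \<beta> (\<eta> :: complex ^ 'n, w) * (cmod (k (\<eta>, w)))\<^sup>2) \<partial>lborel) =
         indicator ?H w * ennreal (Im w ^ (N - 1) / cmod (cnj w - w0) ^ (2 * N + 2)) * ?C"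
      proof (cases "Im w > 0")
        case True
        show ?thesis unfolding kk e using True
          by (simp add: ennreal_mult nn_integral_multc nn_integral_fiber_weight N2 divide_inverse mult_ac)
      qed (simp add: fiber_weight_nonpos)
    qed
    also have "\<dots> = (\<integral>\<^sup>+w. (indicator ?H w * ennreal (Im w ^ (N - 1) / cmod (cnj w - w0) ^ (2 * N + 2))) \<partial>lborel) * ?C"
    proof (rule nn_integral_multc)
      have [measurable]: "(\<lambda>w. cmod (cnj w - w0)) \<in> borel_measurable borel"
        by (intro borel_measurable_continuous_onI continuous_intros)
      show "(\<lambda>w. indicator ?H w * ennreal (Im w ^ (N - 1) / cmod (cnj w - w0) ^ (2 * N + 2))) \<in> borel_measurable lborel"
        by measurable
    qed
    also have "\<dots> < \<infinity>"
      using kernel_integral_finite[OF w0 N1] fiber_const_finite[of \<beta>, where 'n='n] by (simp add: ennreal_mult_less_top)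
    finally show ?thesis .
  qed
  define \<Phi> where "\<Phi> z = siegel_weight \<beta> z *\<^sub>R (G z * k z)" for z
  have m\<Phi>: "\<Phi> \<in> borel_measurable borel" unfolding \<Phi>_def[abs_def]
    by (intro measurable_siegel_weight_scaleR continuous_intros cG ck)
  have int: "integrable lborel \<Phi>"
  proof (rule integrableI_bounded)
    have "(\<integral>\<^sup>+z. ennreal (norm (\<Phi> z)) \<partial>lborel) \<le> (\<integral>\<^sup>+z. ennreal (siegel_weight \<beta> z * (cmod (G z))\<^sup>2) + ennreal (siegel_weight \<beta> z * (cmod (k z))\<^sup>2) \<partial>lborel)"
    proof (rule nn_integral_mono)
      fix z :: "(complex ^ 'n) \<times> complex"
      have "0 \<le> (cmod (G z) - cmod (k z))\<^sup>2" by simp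
      hence "2 * (cmod (G z) * cmod (k z)) \<le> (cmod (G z))\<^sup>2 + (cmod (k z))\<^sup>2" by (simp add: power2_diff)
      moreover have "0 \<le> cmod (G z) * cmod (k z)" by simp
      ultimately have "cmod (G z) * cmod (k z) \<le> (cmod (G z))\<^sup>2 + (cmod (k z))\<^sup>2" by linarith
      hence "siegel_weight \<beta> z * (cmod (G z) * cmod (k z)) \<le> siegel_weight \<beta> z * ((cmod (G z))\<^sup>2 + (cmod (k z))\<^sup>2)"
        by (intro mult_left_mono) auto
      thus "ennreal (norm (\<Phi> z)) \<le> ennreal (siegel_weight \<beta> z * (cmod (G z))\<^sup>2) + ennreal (siegel_weight \<beta> z * (cmod (k z))\<^sup>2)"
        by (simp add: \<Phi>_def norm_mult ennreal_plus[symmetric] distrib_left ennreal_leI del: ennreal_plus)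
    qed
    also have "\<dots> < \<infinity>" using fin finK mk mG by (simp add: nn_integral_add)
    finally show "(\<integral>\<^sup>+z. ennreal (norm (\<Phi> z)) \<partial>lborel) < \<infinity>" .
  qed (use m\<Phi> in simp)
  define g where "g w = G (0, w)" for w
  have gh: "g holomorphic_on ?H"
    unfolding g_def by (rule holomorphic_several_last[OF G]) (auto simp: fst_snd_in_siegelU open_halfspace_Im_gt)
  have sl: "(\<lambda>\<eta>. ennreal (fiber_weight \<beta> (Im w) \<eta> * (cmod (G (\<eta>, w)))\<^sup>2)) \<in> borel_measurable borel" for w
    using slice[OF mG, of w] by simp
  define A where "A = enn2real ((\<integral>\<^sup>+z. ennreal (siegel_weight \<beta> z * (cmod (G z))\<^sup>2) \<partial>lborel) / ?C)"
  \<comment> \<open>The sub-mean value inequality on fibers, integrated over w, puts the restriction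
    g into a weighted Bergman space of the half-plane; this yields the bound K that
    \<open>halfplane_reproducing\<close> asks for.\<close>
  have bergman: "(\<integral>\<^sup>+w. indicator ?H w * ennreal ((cmod (g w))\<^sup>2 * Im w ^ (N - 1)) \<partial>lborel) \<le> ennreal A"
  proof -
    have meas: "(\<lambda>w. indicator ?H w * ennreal ((cmod (g w))\<^sup>2 * Im w ^ (N - 1))) \<in> borel_measurable borel"
    proof -
      have "(\<lambda>y. indicator ?H y *\<^sub>R ((cmod (g y))\<^sup>2 * Im y ^ (N - 1))) \<in> borel_measurable borel"
        by (rule borel_measurable_continuous_on_indicator)
           (auto intro!: continuous_intros holomorphic_on_imp_continuous_on[OF gh] open_halfspace_Im_gt borel_open)
      hence "(\<lambda>y. ennreal (indicator ?H y *\<^sub>R ((cmod (g y))\<^sup>2 * Im y ^ (N - 1)))) \<in> borel_measurable borel"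
        by measurable
      thus ?thesis by (rule measurable_cong[THEN iffD1, rotated]) (auto simp: indicator_def)
    qed
    have "(\<integral>\<^sup>+w. indicator ?H w * ennreal ((cmod (g w))\<^sup>2 * Im w ^ (N - 1)) \<partial>lborel) * ?C
      = (\<integral>\<^sup>+w. indicator ?H w * ennreal ((cmod (g w))\<^sup>2 * Im w ^ (N - 1)) * ?C \<partial>lborel)"
      using meas by (intro nn_integral_multc[symmetric]) simp
    also have "\<dots> \<le> (\<integral>\<^sup>+z. ennreal (siegel_weight \<beta> z * (cmod (G z))\<^sup>2) \<partial>lborel)"
      unfolding nnfub[OF mG]
    proof (rule nn_integral_mono)
      fix w :: complex
      show "indicator ?H w * ennreal ((cmod (g w))\<^sup>2 * Im w ^ (N - 1)) * ?C
         \<le> (\<integral>\<^sup>+\<eta>. ennreal (siegel_weight \<beta> (\<eta>, w) * (cmod (G (\<eta>, w)))\<^sup>2) \<partial>lborel)"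
      proof (cases "Im w > 0")
        case True
        show ?thesis
          using nn_integral_fiber_holomorphic[OF holomorphic_several_fiber[OF G] sl True] True
          by (simp add: g_def N2 mult_ac)
      qed simp
    qed
    finally have "(\<integral>\<^sup>+w. indicator ?H w * ennreal ((cmod (g w))\<^sup>2 * Im w ^ (N - 1)) \<partial>lborel) * ?C / ?C
        \<le> (\<integral>\<^sup>+z. ennreal (siegel_weight \<beta> z * (cmod (G z))\<^sup>2) \<partial>lborel) / ?C"
      by (rule divide_right_mono_ennreal)
    moreover have "x * ?C / ?C = x" for x
      using fiber_const_pos[of \<beta>, where 'n='n] fiber_const_finite[of \<beta>, where 'n='n]
      by (simp add: ennreal_mult_divide_eq)
    moreover have "(\<integral>\<^sup>+z. ennreal (siegel_weight \<beta> z * (cmod (G z))\<^sup>2) \<partial>lborel) / ?C < \<infinity>"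
      using fin fiber_const_pos[of \<beta>, where 'n='n] by (auto simp: ennreal_divide_eq_top_iff less_top[symmetric])
    ultimately show ?thesis by (simp add: A_def)
  qed
  have K: "(cmod (g w))\<^sup>2 * Im w ^ (N + 1) \<le> 2 ^ (N - 1 + 2) * A / pi" if "Im w > 0" for w
    using bergman_pointwise_bound[OF gh bergman _ that] N1 by (simp add: A_def)
  define \<Psi> where "\<Psi> w = indicator ?H w *\<^sub>R (g w * of_real (Im w ^ (N - 1)) / (\<i> * (cnj w - w0)) ^ Suc N)" for w
  have int2: "integrable (lborel \<Otimes>\<^sub>M lborel) (\<lambda>(\<eta>, w). \<Phi> (\<eta>, w))"
    using int by (simp add: lborel_prod case_prod_unfold)
  \<comment> \<open>Fubini gives integrability on almost every fiber only. On such a fiber the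
    kernel is a nonzero constant c, which is divided off to see that the weighted G is
    integrable.\<close>
  have inner: "AE w in lborel. (\<integral>\<eta>. \<Phi> (\<eta>, w) \<partial>lborel) = of_real (enn2real ?C) * \<Psi> w"
    using lborel_pair.AE_integrable_snd[OF int2]
  proof eventually_elim
    case (elim w)
    show ?case
    proof (cases "Im w > 0")
      case True
      define c where "c = 1 / (\<i> * (cnj w - w0)) ^ Suc N"
      have "cnj w - w0 \<noteq> 0" using True w0 by (auto simp: complex_eq_iff)
      hence c0: "c \<noteq> 0" by (simp add: c_def)
      have \<Phi>c: "\<Phi> (\<eta>, w) = (fiber_weight \<beta> (Im w) \<eta> *\<^sub>R G (\<eta>, w)) * c" for \<eta>
        by (simp add: \<Phi>_def k_def c_def scaleR_conv_of_real)
      have i: "integrable lborel (\<lambda>\<eta>. (fiber_weight \<beta> (Im w) \<eta> *\<^sub>R G (\<eta>, w)) * c)"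
        using elim by (simp only: \<Phi>c)
      hence i': "integrable lborel (\<lambda>\<eta>. fiber_weight \<beta> (Im w) \<eta> *\<^sub>R G (\<eta>, w))"
        using integrable_mult_left[OF i, of "inverse c"] c0 by (simp add: mult.assoc)
      have "(\<integral>\<eta>. \<Phi> (\<eta>, w) \<partial>lborel) = (\<integral>\<eta>. fiber_weight \<beta> (Im w) \<eta> *\<^sub>R G (\<eta>, w) \<partial>lborel) * c"
        by (simp only: \<Phi>c integral_mult_left_zero)
      also have "\<dots> = of_real (Im w ^ (\<beta> + CARD('n)) * enn2real ?C) * G (0, w) * c"
        by (subst integral_fiber_holomorphic[OF holomorphic_several_fiber[OF G] i' True]) simp
      finally show ?thesis using True by (simp add: \<Psi>_def g_def N2 c_def)
    qed (simp add: \<Phi>_def \<Psi>_def fiber_weight_nonpos)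
  qed
  have m\<Psi>: "\<Psi> \<in> borel_measurable borel" unfolding \<Psi>_def[abs_def]
  proof (rule borel_measurable_continuous_on_indicator)
    show "continuous_on ?H (\<lambda>w. g w * of_real (Im w ^ (N - 1)) / (\<i> * (cnj w - w0)) ^ Suc N)"
    proof (intro continuous_intros holomorphic_on_imp_continuous_on[OF gh] ballI)
      fix w assume "w \<in> ?H"
      hence "cnj w - w0 \<noteq> 0" using w0 by (auto simp: complex_eq_iff)
      thus "(\<i> * (cnj w - w0)) ^ Suc N \<noteq> 0" by simp
    qed
  qed (auto intro!: borel_open open_halfspace_Im_gt)
  have C0: "enn2real ?C > 0"
    using fiber_const_pos[of \<beta>, where 'n='n] fiber_const_finite[of \<beta>, where 'n='n] by (simp add: enn2real_positive_iff)
  have i3: "integrable lborel (\<lambda>w. of_real (enn2real ?C) * \<Psi> w)"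
    by (rule Bochner_Integration.integrable_cong_AE_imp[OF lborel_pair.integrable_snd[OF int2]]) (use inner m\<Psi> in auto)
  have i4: "integrable lborel \<Psi>"
    using integrable_mult_right[OF i3, of "inverse (of_real (enn2real ?C))"] C0 by (simp add: mult.assoc[symmetric])
  have "(\<integral>z. \<Phi> z \<partial>lborel) = (\<integral>w. \<integral>\<eta>. \<Phi> (\<eta>, w) \<partial>lborel \<partial>lborel)"
    using lborel_pair.integral_snd[OF int2] by (simp add: lborel_prod case_prod_unfold)
  also have "\<dots> = (\<integral>w. of_real (enn2real ?C) * \<Psi> w \<partial>lborel)"
    by (rule integral_cong_AE) (use inner m\<Psi> lborel_pair.integrable_snd[OF int2, THEN borel_measurable_integrable] in auto)
  also have "\<dots> = of_real (enn2real ?C) * (of_real (2 * pi / (real N * 2 ^ N)) * g w0)"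
    using halfplane_reproducing[OF gh K N1 w0 i4[unfolded \<Psi>_def]]
    unfolding \<Psi>_def by (simp only: integral_mult_right_zero)
  finally show "(\<integral>z. siegel_weight \<beta> z *\<^sub>R (G z * k z) \<partial>lborel) = of_real (siegel_const \<beta> TYPE('n)) * G (0, w0)"
    by (simp add: \<Phi>_def siegel_const_def N g_def mult_ac)
qed

section \<open>The Hermitian product and Heisenberg translations\<close>

definition hinner :: "complex ^ 'n::finite \<Rightarrow> complex ^ 'n \<Rightarrow> complex" where
  "hinner a b = (\<Sum>i\<in>UNIV. a $ i * cnj (b $ i))"

lemma hinner_add_left: "hinner (a + b) c = hinner a c + hinner b c"
  by (simp add: hinner_def algebra_simps sum.distrib)

lemma hinner_add_right: "hinner a (b + c) = hinner a b + hinner a c"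
  by (simp add: hinner_def algebra_simps sum.distrib)

lemma hinner_minus_left: "hinner (- a) b = - hinner a b"
  by (simp add: hinner_def sum_negf)

lemma hinner_minus_right: "hinner a (- b) = - hinner a b"
  by (simp add: hinner_def sum_negf)

lemma hinner_diff_left: "hinner (a - b) c = hinner a c - hinner b c"
  by (simp add: hinner_def algebra_simps sum_subtractf)

lemma hinner_scaleR_left: "hinner (r *\<^sub>R a) b = r *\<^sub>R hinner a b"
  by (simp add: hinner_def scaleR_conv_of_real[where 'a=complex] sum_distrib_left mult.assoc)

lemma hinner_vscale_left: "hinner (vscale c a) b = c * hinner a b"
  by (simp add: hinner_def vscale_def sum_distrib_left mult.assoc)

lemma cnj_hinner: "cnj (hinner a b) = hinner b a"
  by (simp add: hinner_def mult.commute)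

lemma hinner_self: "hinner a a = of_real ((norm a)\<^sup>2)"
  by (simp add: hinner_def norm_vec_def L2_set_def sum_nonneg complex_norm_square[symmetric] del: of_real_power)

lemma bounded_linear_hinner_left: "bounded_linear (\<lambda>a. hinner a b)"
  by (simp add: linear_conv_bounded_linear[symmetric])
     (rule linearI, simp_all add: hinner_add_left hinner_scaleR_left)

lemma norm_add_square: "(norm (a + b))\<^sup>2 = (norm a)\<^sup>2 + (norm b)\<^sup>2 + 2 * Re (hinner b a)"
proof -
  have "complex_of_real ((norm (a + b))\<^sup>2) = hinner a a + hinner b b + (hinner b a + cnj (hinner b a))"
    unfolding cnj_hinner hinner_self[symmetric] by (simp add: hinner_add_left hinner_add_right)
  also have "\<dots> = of_real ((norm a)\<^sup>2 + (norm b)\<^sup>2 + 2 * Re (hinner b a))"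
    by (simp add: hinner_self complex_add_cnj)
  finally show ?thesis by (simp only: of_real_eq_iff)
qed

text \<open>The Heisenberg translations preserve rho and Lebesgue measure and act transitively on first
  coordinates, which reduces the reproducing formula to points with first coordinate 0.\<close>

definition heis_linear :: "complex ^ 'n::finite \<Rightarrow> (complex ^ 'n) \<times> complex \<Rightarrow> (complex ^ 'n) \<times> complex" where
  "heis_linear \<xi> z = (fst z, snd z + \<i> / 2 * hinner (fst z) \<xi>)"

definition heis_shift :: "complex ^ 'n::finite \<Rightarrow> (complex ^ 'n) \<times> complex \<Rightarrow> (complex ^ 'n) \<times> complex" where
  "heis_shift \<xi> z = (\<xi>, \<i> / 4 * of_real ((norm \<xi>)\<^sup>2)) + heis_linear \<xi> z"

lemma bounded_linear_heis_linear: "bounded_linear (heis_linear \<xi>)"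
  unfolding heis_linear_def[abs_def]
  by (intro bounded_linear_Pair bounded_linear_add bounded_linear_fst bounded_linear_snd
      bounded_linear_const_mult bounded_linear_compose[OF bounded_linear_hinner_left])

lemma heis_linear_cscale: "heis_linear \<xi> (cscale c z) = cscale c (heis_linear \<xi> z)"
  using hinner_vscale_left[of c "fst z" \<xi>]
  by (simp add: heis_linear_def cscale_def vscale_def algebra_simps)

lemma rho_heis_shift: "rho (heis_shift \<xi> z) = rho z"
proof -
  have "Re (hinner (fst z) \<xi>) = Re (hinner \<xi> (fst z))" by (subst cnj_hinner[symmetric]) simp
  thus ?thesis by (simp add: rho_def heis_shift_def heis_linear_def norm_add_square field_simps)
qed

lemma heis_shift_in_siegelU: "heis_shift \<xi> z \<in> siegelU \<longleftrightarrow> z \<in> siegelU"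
  by (simp add: siegelU_def rho_heis_shift)

lemma siegel_weight_heis_shift: "siegel_weight \<beta> (heis_shift \<xi> z) = siegel_weight \<beta> z"
  by (simp add: fiber_weight_eq rho_heis_shift heis_shift_in_siegelU indicator_def)

lemma measurable_heis_shift [measurable]: "heis_shift \<xi> \<in> borel_measurable borel"
  unfolding heis_shift_def[abs_def]
  by (intro borel_measurable_continuous_onI continuous_intros linear_continuous_on bounded_linear_heis_linear)

text \<open>For fixed first coordinate \<eta> the map translates the last coordinate by an amount
  depending on \<eta> only, and then \<eta> itself is translated; so Fubini reduces the claim to two
  translations.\<close>

lemma lborel_distr_heis_shift: "distr lborel borel (heis_shift \<xi>) = lborel"
proof (rule measure_eqI)
  fix A assume "A \<in> sets (distr lborel borel (heis_shift \<xi>))"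
  hence A [measurable]: "A \<in> sets borel" by simp
  have fub: "(\<integral>\<^sup>+z. f z \<partial>lborel) = (\<integral>\<^sup>+\<eta>. \<integral>\<^sup>+w. f (\<eta>, w) \<partial>lborel \<partial>lborel)"
    if "f \<in> borel_measurable borel" for f :: "(complex ^ 'a) \<times> complex \<Rightarrow> ennreal"
    using lborel.nn_integral_fst[of f lborel] that by (simp add: lborel_prod)
  have sl: "(\<lambda>w. indicator A (\<eta>, w) :: ennreal) \<in> borel_measurable borel" for \<eta>
  proof -
    have "(\<lambda>w. (\<eta>, w)) \<in> borel_measurable borel" by (intro borel_measurable_continuous_onI continuous_intros)
    from measurable_compose[OF this borel_measurable_indicator[OF A]] show ?thesis .
  qed
  define I where "I \<eta> = (\<integral>\<^sup>+w. indicator A (\<eta>, w) \<partial>lborel :: ennreal)" for \<eta>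
  have "(\<lambda>z. indicator A z :: ennreal) \<in> borel_measurable (lborel \<Otimes>\<^sub>M lborel)" by (simp add: lborel_prod)
  from lborel.borel_measurable_nn_integral_fst[OF this]
  have I: "I \<in> borel_measurable borel" by (simp add: I_def[abs_def])
  have "emeasure (distr lborel borel (heis_shift \<xi>)) A = (\<integral>\<^sup>+z. indicator A (heis_shift \<xi> z) \<partial>lborel)"
  proof -
    have "emeasure (distr lborel borel (heis_shift \<xi>)) A = (\<integral>\<^sup>+z. indicator A z \<partial>distr lborel borel (heis_shift \<xi>))"
      by (rule nn_integral_indicator[symmetric]) simp
    also have "\<dots> = (\<integral>\<^sup>+z. indicator A (heis_shift \<xi> z) \<partial>lborel)"
      by (rule nn_integral_distr) measurable
    finally show ?thesis .
  qed
  also have "\<dots> = (\<integral>\<^sup>+\<eta>. \<integral>\<^sup>+w. indicator A (heis_shift \<xi> (\<eta>, w)) \<partial>lborel \<partial>lborel)"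
    by (rule fub) measurable
  also have "\<dots> = (\<integral>\<^sup>+\<eta>. I (\<xi> + \<eta>) \<partial>lborel)"
  proof (rule nn_integral_cong)
    fix \<eta>
    have "heis_shift \<xi> (\<eta>, w) = (\<xi> + \<eta>, (\<i> / 4 * of_real ((norm \<xi>)\<^sup>2) + \<i> / 2 * hinner \<eta> \<xi>) + w)" for w
      by (simp add: heis_shift_def heis_linear_def)
    thus "(\<integral>\<^sup>+w. indicator A (heis_shift \<xi> (\<eta>, w)) \<partial>lborel) = I (\<xi> + \<eta>)"
      unfolding I_def by (simp only: nn_integral_lborel_translate[OF sl])
  qed
  also have "\<dots> = (\<integral>\<^sup>+\<eta>. I \<eta> \<partial>lborel)" by (rule nn_integral_lborel_translate[OF I])
  also have "\<dots> = (\<integral>\<^sup>+z. indicator A z \<partial>lborel)"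
    unfolding I_def by (rule fub[symmetric]) measurable
  also have "\<dots> = emeasure lborel A" by simp
  finally show "emeasure (distr lborel borel (heis_shift \<xi>)) A = emeasure lborel A" .
qed simp

text \<open>The complex conjugate in z of the reproducing kernel at z0, up to a constant.\<close>

definition conj_kernel :: "nat \<Rightarrow> (complex ^ 'n::finite) \<times> complex \<Rightarrow> (complex ^ 'n) \<times> complex \<Rightarrow> complex" where
  "conj_kernel N z0 z = 1 / (\<i> * (cnj (snd z) - snd z0) - hinner (fst z0) (fst z) / 2) ^ Suc N"

text \<open>\<open>heis_shift (fst z0)\<close> carries \<open>(0, w0)\<close> to z0, where
  \<open>Im w0 = rho z0\<close>, and preserves weight and measure. Composition with it turns
  \<open>conj_kernel\<close> into the kernel of \<open>siegel_reproducing_0\<close>, which is the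
  identity \<open>phase\<close>.\<close>

theorem siegel_reproducing:
  fixes G :: "(complex ^ 'n::finite) \<times> complex \<Rightarrow> complex"
  assumes G: "holomorphic_several G siegelU"
    and fin: "(\<integral>\<^sup>+z. ennreal (siegel_weight \<beta> z * (cmod (G z))\<^sup>2) \<partial>lborel) < \<infinity>"
    and z0: "z0 \<in> siegelU" and N: "N = \<beta> + CARD('n) + 1"
  shows "(\<integral>\<^sup>+z. ennreal (siegel_weight \<beta> z * (cmod (conj_kernel N z0 z))\<^sup>2) \<partial>lborel) < \<infinity>" (is ?A)
    and "(\<integral>z. siegel_weight \<beta> z *\<^sub>R (G z * conj_kernel N z0 z) \<partial>lborel) = of_real (siegel_const \<beta> TYPE('n)) * G z0" (is ?B)
proof -
  define \<xi> where "\<xi> = fst z0"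
  define w0 where "w0 = snd z0 - \<i> / 4 * of_real ((norm \<xi>)\<^sup>2)"
  have w0: "Im w0 > 0" using z0 by (simp add: w0_def \<xi>_def siegelU_def rho_def)
  have hz0: "heis_shift \<xi> (0, w0) = z0"
    by (simp add: heis_shift_def heis_linear_def w0_def \<xi>_def hinner_def)
  have phase: "\<i> * (cnj (snd (heis_shift \<xi> z)) - snd z0) - hinner (fst z0) (fst (heis_shift \<xi> z)) / 2 = \<i> * (cnj (snd z) - w0)" for z
    by (simp add: heis_shift_def heis_linear_def w0_def \<xi>_def hinner_add_right cnj_hinner hinner_self algebra_simps)
  have kern: "conj_kernel N z0 (heis_shift \<xi> z) = 1 / (\<i> * (cnj (snd z) - w0)) ^ Suc N" for z
    by (simp only: conj_kernel_def phase)
  have G': "holomorphic_several (\<lambda>z. G (heis_shift \<xi> z)) siegelU"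
    unfolding heis_shift_def
    by (rule holomorphic_several_compose_affine[OF G bounded_linear_heis_linear])
       (simp_all only: heis_linear_cscale heis_shift_def[symmetric] heis_shift_in_siegelU)
  have contk: "continuous_on siegelU (conj_kernel N z0)"
  proof -
    have c: "continuous_on UNIV (\<lambda>z. hinner (fst z0) (fst (z :: (complex ^ 'n) \<times> complex)))"
      unfolding hinner_def by (intro continuous_intros)
    have "\<i> * (cnj (snd z) - snd z0) - hinner (fst z0) (fst z) / 2 \<noteq> 0" if "z \<in> siegelU" for z
    proof -
      \<comment> \<open>Translation by -\<xi> inverts translation by \<xi>, so \<open>phase\<close>
        at y shows that the denominator at z is nonzero.\<close>
      define y where "y = heis_shift (- \<xi>) z"
      have e: "heis_shift \<xi> y = z"
        by (simp add: y_def heis_shift_def heis_linear_def prod_eq_iff hinner_diff_left hinner_minus_left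
              hinner_minus_right hinner_self algebra_simps)
      have "y \<in> siegelU" using that e heis_shift_in_siegelU by metis
      hence "\<i> * (cnj (snd y) - w0) \<noteq> 0" using siegelU_Im_pos[of y] w0 by (auto simp: complex_eq_iff)
      thus ?thesis unfolding phase[of y, unfolded e] .
    qed
    thus ?thesis unfolding conj_kernel_def[abs_def]
      by (intro continuous_intros continuous_on_subset[OF c]) auto
  qed
  have cG: "continuous_on siegelU G" using G by (rule holomorphic_several_continuous_on)
  have tr: "(\<integral>\<^sup>+z. f (heis_shift \<xi> z) \<partial>lborel) = (\<integral>\<^sup>+z. f z \<partial>lborel)" if "f \<in> borel_measurable borel" for f :: "_ \<Rightarrow> ennreal"
    by (subst (2) lborel_distr_heis_shift[of \<xi>, symmetric]) (use that in \<open>simp add: nn_integral_distr\<close>)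
  have mnn: "(\<lambda>z. ennreal (siegel_weight \<beta> z * (cmod (H z))\<^sup>2)) \<in> borel_measurable borel" if "continuous_on siegelU H"
    for H :: "(complex ^ 'n) \<times> complex \<Rightarrow> complex"
    using measurable_siegel_weight_scaleR[of "\<lambda>z. (cmod (H z))\<^sup>2" \<beta>] that by (simp add: continuous_intros)
  have fin': "(\<integral>\<^sup>+z. ennreal (siegel_weight \<beta> z * (cmod (G (heis_shift \<xi> z)))\<^sup>2) \<partial>lborel) < \<infinity>"
    using tr[OF mnn[OF cG]] fin by (simp add: siegel_weight_heis_shift)
  note R = siegel_reproducing_0[OF G' fin' w0 N]
  show ?A using R(1) tr[OF mnn[OF contk]] by (simp only: siegel_weight_heis_shift kern)
  have "(\<integral>z. siegel_weight \<beta> z *\<^sub>R (G z * conj_kernel N z0 z) \<partial>lborel)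
    = (\<integral>z. siegel_weight \<beta> (heis_shift \<xi> z) *\<^sub>R (G (heis_shift \<xi> z) * conj_kernel N z0 (heis_shift \<xi> z)) \<partial>lborel)"
    by (subst (1) lborel_distr_heis_shift[of \<xi>, symmetric])
       (intro integral_distr, simp_all add: measurable_siegel_weight_scaleR continuous_intros cG contk)
  also have "\<dots> = of_real (siegel_const \<beta> TYPE('n)) * G z0"
    using R(2) by (simp only: siegel_weight_heis_shift kern hz0)
  finally show ?B .
qed

section \<open>Square-integrable functions\<close>

text \<open>Functions rather than classes modulo null sets: transforms are evaluated at points, and
  equality almost everywhere is tracked explicitly. Working with \<open>normsq\<close> keeps
  expansions free of roots.\<close>

definition L2 :: "'a measure \<Rightarrow> ('a \<Rightarrow> complex) set" where
  "L2 M = {f \<in> borel_measurable M. integrable M (\<lambda>x. (cmod (f x))\<^sup>2)}"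

definition normsq :: "'a measure \<Rightarrow> ('a \<Rightarrow> complex) \<Rightarrow> real" where
  "normsq M f = (\<integral>x. (cmod (f x))\<^sup>2 \<partial>M)"

definition ip :: "'a measure \<Rightarrow> ('a \<Rightarrow> complex) \<Rightarrow> ('a \<Rightarrow> complex) \<Rightarrow> complex" where
  "ip M f g = (\<integral>x. f x * cnj (g x) \<partial>M)"

lemma L2D: "f \<in> L2 M \<Longrightarrow> f \<in> borel_measurable M" "f \<in> L2 M \<Longrightarrow> integrable M (\<lambda>x. (cmod (f x))\<^sup>2)"
  by (auto simp: L2_def)

lemma normsq_nonneg [simp]: "normsq M f \<ge> 0"
  by (simp add: normsq_def)

lemma borel_measurable_cnj [measurable (raw)]:
  "f \<in> borel_measurable M \<Longrightarrow> (\<lambda>x. cnj (f x)) \<in> borel_measurable M"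
  using measurable_compose[of f M borel cnj borel]
  by (simp add: borel_measurable_continuous_onI continuous_intros)

lemma L2_integrable_mult:
  assumes "f \<in> L2 M" "g \<in> L2 M"
  shows "integrable M (\<lambda>x. f x * cnj (g x))"
proof (rule Bochner_Integration.integrable_bound)
  show "integrable M (\<lambda>x. (cmod (f x))\<^sup>2 + (cmod (g x))\<^sup>2)"
    by (intro Bochner_Integration.integrable_add L2D assms)
  show "(\<lambda>x. f x * cnj (g x)) \<in> borel_measurable M" using L2D(1)[OF assms(1)] L2D(1)[OF assms(2)] by measurable
  have "cmod a * cmod b \<le> (cmod a)\<^sup>2 + (cmod b)\<^sup>2" for a b
  proof -
    have "0 \<le> (cmod a - cmod b)\<^sup>2" by simp
    hence "2 * (cmod a * cmod b) \<le> (cmod a)\<^sup>2 + (cmod b)\<^sup>2" by (simp add: power2_diff)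
    moreover have "0 \<le> cmod a * cmod b" by simp
    ultimately show ?thesis by linarith
  qed
  thus "AE x in M. norm (f x * cnj (g x)) \<le> norm ((cmod (f x))\<^sup>2 + (cmod (g x))\<^sup>2)"
    by (simp add: norm_mult)
qed

lemma L2_cmult: "f \<in> L2 M \<Longrightarrow> (\<lambda>x. c * f x) \<in> L2 M"
  by (auto simp: L2_def norm_mult power_mult_distrib)

lemma L2_add:
  assumes "f \<in> L2 M" "g \<in> L2 M" shows "(\<lambda>x. f x + g x) \<in> L2 M"
proof -
  have "(cmod (f x + g x))\<^sup>2 = (cmod (f x))\<^sup>2 + (cmod (g x))\<^sup>2 + 2 * Re (f x * cnj (g x))" for x
    unfolding cmod_power2 by (simp add: algebra_simps power2_eq_square)
  moreover have "integrable M (\<lambda>x. 2 * Re (f x * cnj (g x)))"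
    by (intro integrable_mult_right integrable_Re L2_integrable_mult assms)
  ultimately show ?thesis unfolding L2_def mem_Collect_eq
    by (simp only:) (intro conjI borel_measurable_add Bochner_Integration.integrable_add L2D assms)
qed

lemma L2_diff: "f \<in> L2 M \<Longrightarrow> g \<in> L2 M \<Longrightarrow> (\<lambda>x. f x - g x) \<in> L2 M"
  using L2_add[of f M "\<lambda>x. (-1) * g x"] L2_cmult[of g M "-1"] by simp

lemma normsq_add_cmult:
  assumes "f \<in> L2 M" "g \<in> L2 M"
  shows "normsq M (\<lambda>x. f x + c * g x) = normsq M f + (cmod c)\<^sup>2 * normsq M g + 2 * Re (cnj c * ip M f g)"
proof -
  have e: "(cmod (f x + c * g x))\<^sup>2 = (cmod (f x))\<^sup>2 + (cmod c)\<^sup>2 * (cmod (g x))\<^sup>2 + 2 * Re (cnj c * (f x * cnj (g x)))" for x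
    unfolding cmod_power2 by (simp add: algebra_simps power2_eq_square)
  note i = L2D(2)[OF assms(1)] L2D(2)[OF assms(2)] L2_integrable_mult[OF assms]
  define h where "h x = cnj c * (f x * cnj (g x))" for x
  have h: "integrable M h" unfolding h_def[abs_def] by (intro integrable_mult_right i)
  have "normsq M (\<lambda>x. f x + c * g x) = normsq M f + (cmod c)\<^sup>2 * normsq M g + 2 * (\<integral>x. Re (h x) \<partial>M)"
    unfolding normsq_def e h_def[symmetric] using i(1,2) h by simp
  also have "(\<integral>x. Re (h x) \<partial>M) = Re (cnj c * ip M f g)"
  proof -
    have "integral\<^sup>L M h = cnj c * ip M f g" unfolding h_def[abs_def] ip_def by (rule integral_mult_right_zero)
    thus ?thesis using integral_Re[OF h] by simp
  qed
  finally show ?thesis .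
qed

lemma normsq_diff:
  assumes "f \<in> L2 M" "g \<in> L2 M"
  shows "normsq M (\<lambda>x. f x - g x) = normsq M f + normsq M g - 2 * Re (ip M f g)"
  using normsq_add_cmult[OF assms, of "-1"] by simp

lemma normsq_diff_commute: "normsq M (\<lambda>x. f x - g x) = normsq M (\<lambda>x. g x - f x)"
  by (simp add: normsq_def norm_minus_commute)

lemma normsq_cmult: "normsq M (\<lambda>x. c * f x) = (cmod c)\<^sup>2 * normsq M f"
  by (simp add: normsq_def norm_mult power_mult_distrib)

lemma normsq_parallelogram:
  assumes "f \<in> L2 M" "g \<in> L2 M"
  shows "normsq M (\<lambda>x. f x + g x) + normsq M (\<lambda>x. f x - g x) = 2 * normsq M f + 2 * normsq M g"
  using normsq_add_cmult[OF assms, of 1] normsq_add_cmult[OF assms, of "-1"] by simp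

lemma ip_Cauchy_Schwarz:
  assumes "f \<in> L2 M" "g \<in> L2 M"
  shows "(cmod (ip M f g))\<^sup>2 \<le> normsq M f * normsq M g"
proof -
  define a where "a = ip M f g"
  \<comment> \<open>Nonnegativity of the squared norm of f - t a g for real t. If g has norm 0, a
    large t forces a = 0; otherwise t is the inverse of the squared norm of g.\<close>
  have key: "0 \<le> normsq M f + t\<^sup>2 * (cmod a)\<^sup>2 * normsq M g - 2 * t * (cmod a)\<^sup>2" for t :: real
  proof -
    have "Re (cnj (- of_real t * a) * a) = - t * (cmod a)\<^sup>2"
      unfolding cmod_power2 by (simp add: power2_eq_square algebra_simps)
    thus ?thesis
      using normsq_add_cmult[OF assms, of "- of_real t * a"] normsq_nonneg[of M "\<lambda>x. f x + - of_real t * a * g x"]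
      by (simp add: a_def[symmetric] norm_mult power_mult_distrib)
  qed
  show ?thesis
  proof (cases "normsq M g = 0")
    case True
    have "(cmod a)\<^sup>2 = 0"
    proof (rule ccontr)
      assume "(cmod a)\<^sup>2 \<noteq> 0"
      hence p: "(cmod a)\<^sup>2 > 0" by simp
      have "2 * ((normsq M f + 1) / (cmod a)\<^sup>2) * (cmod a)\<^sup>2 = 2 * (normsq M f + 1)" using p by simp
      thus False using key[of "(normsq M f + 1) / (cmod a)\<^sup>2"] True normsq_nonneg[of M f] by simp
    qed
    thus ?thesis using True by (simp add: a_def)
  next
    case False
    hence p: "normsq M g > 0" using normsq_nonneg[of M g] by linarith
    have "(1 / normsq M g)\<^sup>2 * (cmod a)\<^sup>2 * normsq M g = (cmod a)\<^sup>2 / normsq M g"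
      using p by (simp add: power2_eq_square)
    hence "0 \<le> normsq M f + (cmod a)\<^sup>2 / normsq M g - 2 * ((cmod a)\<^sup>2 / normsq M g)"
      using key[of "1 / normsq M g"] by simp
    hence "(cmod a)\<^sup>2 / normsq M g \<le> normsq M f" by linarith
    thus ?thesis using p by (simp add: a_def field_simps)
  qed
qed

lemma nn_integral_L2: "f \<in> L2 M \<Longrightarrow> (\<integral>\<^sup>+x. ennreal ((cmod (f x))\<^sup>2) \<partial>M) = ennreal (normsq M f)"
  unfolding normsq_def by (rule nn_integral_eq_integral) (auto dest: L2D)

lemma L2I_nn:
  assumes "f \<in> borel_measurable M" "(\<integral>\<^sup>+x. ennreal ((cmod (f x))\<^sup>2) \<partial>M) < \<infinity>"
  shows "f \<in> L2 M"
  using assms by (auto simp: L2_def intro!: integrableI_nonneg)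

text \<open>Membership of the limit in L2 is a conclusion. This is what later shows that a transform
  is square integrable.\<close>

lemma L2_Fatou:
  assumes g: "\<And>k. g k \<in> L2 M" and f: "f \<in> borel_measurable M"
    and lim: "AE x in M. (\<lambda>k. g k x) \<longlonglongrightarrow> f x" and B: "\<forall>\<^sub>F k in sequentially. normsq M (g k) \<le> B"
  shows "f \<in> L2 M" "normsq M f \<le> B"
proof -
  have [measurable]: "g k \<in> borel_measurable M" for k using L2D(1)[OF g] .
  note [measurable] = f
  obtain k where "normsq M (g k) \<le> B" using eventually_happens[OF B] by auto
  hence B0: "B \<ge> 0" using normsq_nonneg[of M "g k"] by linarith
  have "(\<integral>\<^sup>+x. ennreal ((cmod (f x))\<^sup>2) \<partial>M) = (\<integral>\<^sup>+x. liminf (\<lambda>k. ennreal ((cmod (g k x))\<^sup>2)) \<partial>M)"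
  proof (rule nn_integral_cong_AE)
    show "AE x in M. ennreal ((cmod (f x))\<^sup>2) = liminf (\<lambda>k. ennreal ((cmod (g k x))\<^sup>2))"
      using lim
    proof eventually_elim
      case (elim x)
      have "(\<lambda>k. ennreal ((cmod (g k x))\<^sup>2)) \<longlonglongrightarrow> ennreal ((cmod (f x))\<^sup>2)"
        by (intro tendsto_ennrealI tendsto_power tendsto_norm elim)
      thus ?case by (intro lim_imp_Liminf[symmetric]) auto
    qed
  qed
  also have "\<dots> \<le> liminf (\<lambda>k. \<integral>\<^sup>+x. ennreal ((cmod (g k x))\<^sup>2) \<partial>M)"
    by (rule nn_integral_liminf) measurable
  also have "\<dots> = liminf (\<lambda>k. ennreal (normsq M (g k)))"
    by (simp add: nn_integral_L2[OF g])
  also have "\<dots> \<le> limsup (\<lambda>k. ennreal (normsq M (g k)))" by (simp add: Liminf_le_Limsup)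
  also have "\<dots> \<le> ennreal B"
    by (rule Limsup_bounded) (use B in \<open>auto elim!: eventually_mono simp: ennreal_leI\<close>)
  finally have le: "(\<integral>\<^sup>+x. ennreal ((cmod (f x))\<^sup>2) \<partial>M) \<le> ennreal B" .
  thus f2: "f \<in> L2 M" by (intro L2I_nn f) (auto simp: le_less_trans)
  show "normsq M f \<le> B" using le B0 by (simp add: nn_integral_L2[OF f2])
qed

text \<open>The Riesz-Fischer theorem: a rapidly convergent subsequence converges almost everywhere,
  and Fatou's lemma identifies its pointwise limit as the limit in norm of the whole
  sequence.\<close>

lemma L2_complete:
  assumes F: "\<And>n. F n \<in> L2 M"
    and Cauchy: "\<And>e. e > 0 \<Longrightarrow> \<exists>N. \<forall>m\<ge>N. \<forall>n\<ge>N. normsq M (\<lambda>x. F m x - F n x) < e"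
  obtains f where "f \<in> L2 M" "(\<lambda>n. normsq M (\<lambda>x. F n x - f x)) \<longlonglongrightarrow> 0"
proof -
  have "\<exists>N. \<forall>m\<ge>N. \<forall>n\<ge>N. normsq M (\<lambda>x. F m x - F n x) < (1/4) ^ k" for k by (rule Cauchy) simp
  then obtain N where N: "\<And>k m n. m \<ge> N k \<Longrightarrow> n \<ge> N k \<Longrightarrow> normsq M (\<lambda>x. F m x - F n x) < (1/4) ^ k" by metis
  \<comment> \<open>Summing the N j makes both \<open>r k\<close> and \<open>r (Suc k)\<close> at
    least \<open>N k\<close>; the summand k makes the indices tend to infinity.\<close>
  define r where "r k = k + (\<Sum>j\<le>k. N j)" for k
  have rN: "r k \<ge> N k" "r (Suc k) \<ge> N k" "r k \<ge> k" for k
  proof -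
    have "N k \<le> (\<Sum>j\<le>k. N j)" for k by (rule member_le_sum) auto
    from this[of k] show "r k \<ge> N k" "r (Suc k) \<ge> N k" "r k \<ge> k" by (auto simp: r_def)
  qed
  \<comment> \<open>The squared norms of the increments are at most \<open>4^(-k)\<close>. Weighted
    by \<open>2^k\<close> their sum still has finite integral, so almost everywhere the weighted
    terms are bounded and \<open>D k x\<close> decays like \<open>2^(-k/2)\<close>, which is
    summable.\<close>
  define D where "D k x = F (r (Suc k)) x - F (r k) x" for k x
  have D2: "D k \<in> L2 M" for k unfolding D_def by (intro L2_diff F)
  have [measurable]: "F n \<in> borel_measurable M" "D k \<in> borel_measurable M" for n k using L2D(1) F D2 by blast+
  have Dn: "normsq M (D k) \<le> (1/4) ^ k" for k
    using N[of k "r (Suc k)" "r k"] rN[of k] by (simp add: D_def[abs_def])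
  have "(\<integral>\<^sup>+x. (\<Sum>k. ennreal (2 ^ k * (cmod (D k x))\<^sup>2)) \<partial>M) = (\<Sum>k. \<integral>\<^sup>+x. ennreal (2 ^ k * (cmod (D k x))\<^sup>2) \<partial>M)"
    by (rule nn_integral_suminf) measurable
  also have "\<dots> \<le> (\<Sum>k. ennreal ((1/2) ^ k))"
  proof (intro suminf_le allI)
    fix k
    have "(\<integral>\<^sup>+x. ennreal (2 ^ k * (cmod (D k x))\<^sup>2) \<partial>M) = ennreal (2 ^ k * normsq M (D k))"
      by (simp add: ennreal_mult nn_integral_cmult nn_integral_L2[OF D2])
    also have "\<dots> \<le> ennreal (2 ^ k * (1/4) ^ k)" using Dn by (intro ennreal_leI mult_left_mono) auto
    also have "(2::real) ^ k * (1/4) ^ k = (1/2) ^ k" by (simp add: power_mult_distrib[symmetric])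
    finally show "(\<integral>\<^sup>+x. ennreal (2 ^ k * (cmod (D k x))\<^sup>2) \<partial>M) \<le> ennreal ((1/2) ^ k)" .
  qed auto
  also have "\<dots> < \<infinity>"
    by (subst suminf_ennreal2) (auto simp: summable_geometric)
  finally have fin: "(\<integral>\<^sup>+x. (\<Sum>k. ennreal (2 ^ k * (cmod (D k x))\<^sup>2)) \<partial>M) < \<infinity>" .
  have "AE x in M. (\<Sum>k. ennreal (2 ^ k * (cmod (D k x))\<^sup>2)) \<noteq> \<infinity>"
  proof (rule nn_integral_PInf_AE)
    show "(\<lambda>x. \<Sum>k. ennreal (2 ^ k * (cmod (D k x))\<^sup>2)) \<in> borel_measurable M" by measurable
  qed (use fin in auto)
  hence conv: "AE x in M. convergent (\<lambda>k. F (r k) x)"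
  proof eventually_elim
    case (elim x)
    hence s: "summable (\<lambda>k. 2 ^ k * (cmod (D k x))\<^sup>2)"
      by (intro summable_suminf_not_top) (auto simp: top_unique)
    hence "(\<lambda>k. 2 ^ k * (cmod (D k x))\<^sup>2) \<longlonglongrightarrow> 0" by (rule summable_LIMSEQ_zero)
    hence "Bseq (\<lambda>k. 2 ^ k * (cmod (D k x))\<^sup>2)" by (intro convergent_imp_Bseq convergentI)
    then obtain C where C: "C > 0" "\<And>k. norm (2 ^ k * (cmod (D k x))\<^sup>2) \<le> C" by (auto simp: Bseq_def)
    have "cmod (D k x) \<le> sqrt C * (1 / sqrt 2) ^ k" for k
    proof -
      have "(cmod (D k x))\<^sup>2 \<le> C * (1/2) ^ k" using C(2)[of k] by (simp add: field_simps power_divide)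
      hence "cmod (D k x) \<le> sqrt (C * (1/2) ^ k)" by (rule real_le_rsqrt)
      thus ?thesis by (simp add: real_sqrt_mult real_sqrt_power real_sqrt_divide power_divide)
    qed
    moreover have "summable (\<lambda>k. sqrt C * (1 / sqrt 2) ^ k)"
      by (intro summable_mult summable_geometric) auto
    ultimately have "summable (\<lambda>k. D k x)"
      by (intro summable_comparison_test[of "\<lambda>k. D k x" "\<lambda>k. sqrt C * (1 / sqrt 2) ^ k"] exI allI impI)
    hence "convergent (\<lambda>n. F (r 0) x + (\<Sum>k<n. D k x))"
      by (intro convergent_add convergent_const) (simp add: summable_iff_convergent)
    moreover have "F (r 0) x + (\<Sum>k<n. D k x) = F (r n) x" for n
      using sum_lessThan_telescope[of "\<lambda>k. F (r k) x" n] by (simp add: D_def)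
    ultimately show ?case by simp
  qed
  define f where "f x = lim (\<lambda>k. F (r k) x)" for x
  have [measurable]: "f \<in> borel_measurable M" unfolding f_def by (rule borel_measurable_lim_metric) measurable
  have lim: "AE x in M. (\<lambda>k. F (r k) x) \<longlonglongrightarrow> f x"
    using conv by eventually_elim (simp add: f_def convergent_LIMSEQ_iff)
  have small: "(\<lambda>x. F n x - f x) \<in> L2 M" "normsq M (\<lambda>x. F n x - f x) \<le> e"
    if "e > 0" "\<And>m k. m \<ge> K \<Longrightarrow> k \<ge> K \<Longrightarrow> normsq M (\<lambda>x. F m x - F k x) < e" "n \<ge> K" for e K n
  proof -
    have 1: "\<And>k. (\<lambda>x. F n x - F (r k) x) \<in> L2 M" by (intro L2_diff F)
    have 2: "AE x in M. (\<lambda>k. F n x - F (r k) x) \<longlonglongrightarrow> F n x - f x"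
      using lim by eventually_elim (intro tendsto_intros)
    have 3: "\<forall>\<^sub>F k in sequentially. normsq M (\<lambda>x. F n x - F (r k) x) \<le> e"
      using eventually_ge_at_top[of K]
    proof eventually_elim
      case (elim k)
      thus ?case using that(2)[OF that(3), of "r k"] rN(3)[of k] by simp
    qed
    show "(\<lambda>x. F n x - f x) \<in> L2 M" "normsq M (\<lambda>x. F n x - f x) \<le> e"
      using L2_Fatou[OF 1 _ 2 3] by simp_all
  qed
  obtain K where K: "\<forall>m\<ge>K. \<forall>n\<ge>K. normsq M (\<lambda>x. F m x - F n x) < 1" using Cauchy[of 1] by auto
  have "(\<lambda>x. F K x - (F K x - f x)) \<in> L2 M"
    by (rule L2_diff[OF F small(1)[of 1 K K]]) (use K in auto)
  hence "f \<in> L2 M" by simp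
  moreover have "(\<lambda>n. normsq M (\<lambda>x. F n x - f x)) \<longlonglongrightarrow> 0"
  proof (rule LIMSEQ_I)
    fix e :: real assume e: "e > 0"
    then obtain K where K: "\<forall>m\<ge>K. \<forall>n\<ge>K. normsq M (\<lambda>x. F m x - F n x) < e / 2" using Cauchy[of "e/2"] by auto
    have "norm (normsq M (\<lambda>x. F n x - f x) - 0) < e" if "n \<ge> K" for n
    proof -
      have "normsq M (\<lambda>x. F n x - f x) \<le> e / 2"
        by (rule small(2)[of "e/2" K]) (use K e that in auto)
      thus ?thesis using e by simp
    qed
    thus "\<exists>no. \<forall>n\<ge>no. norm (normsq M (\<lambda>x. F n x - f x) - 0) < e" by blast
  qed
  ultimately show ?thesis by (rule that)
qed

lemma normsq_tendsto:
  assumes F: "\<And>n. F n \<in> L2 M" and f: "f \<in> L2 M" and h: "h \<in> L2 M"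
    and lim: "(\<lambda>n. normsq M (\<lambda>x. F n x - f x)) \<longlonglongrightarrow> 0"
  shows "(\<lambda>n. normsq M (\<lambda>x. h x - F n x)) \<longlonglongrightarrow> normsq M (\<lambda>x. h x - f x)"
proof -
  let ?d = "\<lambda>n. normsq M (\<lambda>x. F n x - f x)" and ?s = "normsq M (\<lambda>x. h x - f x)"
  have hf: "(\<lambda>x. h x - f x) \<in> L2 M" and Ff: "\<And>n. (\<lambda>x. F n x - f x) \<in> L2 M" by (auto intro!: L2_diff f h F)
  define I where "I n = Re (ip M (\<lambda>x. h x - f x) (\<lambda>x. F n x - f x))" for n
  have e: "normsq M (\<lambda>x. h x - F n x) = ?s + ?d n - 2 * I n" for n
    using normsq_diff[OF hf Ff[of n]] by (simp add: I_def)
  have "\<bar>I n\<bar> \<le> sqrt (?s * ?d n)" for n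
  proof -
    have "\<bar>I n\<bar> \<le> cmod (ip M (\<lambda>x. h x - f x) (\<lambda>x. F n x - f x))" unfolding I_def by (rule abs_Re_le_cmod)
    also have "\<dots> \<le> sqrt (?s * ?d n)" by (rule real_le_rsqrt[OF ip_Cauchy_Schwarz[OF hf Ff]])
    finally show ?thesis .
  qed
  moreover have "(\<lambda>n. sqrt (?s * ?d n)) \<longlonglongrightarrow> sqrt (?s * 0)"
    by (intro tendsto_real_sqrt tendsto_mult tendsto_const lim)
  ultimately have I0: "I \<longlonglongrightarrow> 0"
    by (intro Lim_null_comparison[of I "\<lambda>n. sqrt (?s * ?d n)"]) simp_all
  have "(\<lambda>n. ?s + ?d n - 2 * I n) \<longlonglongrightarrow> ?s + 0 - 2 * 0"
    by (intro tendsto_add tendsto_diff tendsto_mult tendsto_const lim I0)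
  thus ?thesis by (simp only: e) simp
qed

text \<open>V is not assumed closed, so the projection P lies in its closure and comes with a
  sequence from V approximating it. By the parallelogram law applied to midpoints, a minimising
  sequence is Cauchy; minimality along G - P + c v gives orthogonality.\<close>

theorem L2_projection:
  assumes V: "V \<subseteq> L2 M" "V \<noteq> {}" "\<And>f g. f \<in> V \<Longrightarrow> g \<in> V \<Longrightarrow> (\<lambda>x. f x + g x) \<in> V"
    "\<And>c f. f \<in> V \<Longrightarrow> (\<lambda>x. c * f x) \<in> V" and G: "G \<in> L2 M"
  obtains P F where "P \<in> L2 M" "\<And>n::nat. F n \<in> V" "(\<lambda>n. normsq M (\<lambda>x. F n x - P x)) \<longlonglongrightarrow> 0"
    "\<And>v. v \<in> V \<Longrightarrow> ip M (\<lambda>x. G x - P x) v = 0"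
proof -
  define S where "S = (\<lambda>v. normsq M (\<lambda>x. G x - v x)) ` V"
  define \<delta> where "\<delta> = Inf S"
  have bdd: "bdd_below S" unfolding S_def by (rule bdd_belowI2[of _ 0]) simp
  have \<delta>: "\<delta> \<le> normsq M (\<lambda>x. G x - v x)" if "v \<in> V" for v
    unfolding \<delta>_def by (rule cInf_lower[OF _ bdd]) (use that S_def in auto)
  have "\<exists>v\<in>V. normsq M (\<lambda>x. G x - v x) < \<delta> + inverse (real (Suc n))" for n
  proof -
    have "\<exists>s\<in>S. s < \<delta> + inverse (real (Suc n))"
      unfolding \<delta>_def using V(2) by (intro cInf_lessD) (auto simp: S_def)
    thus ?thesis by (auto simp: S_def)
  qed
  then obtain F where FV: "\<And>n. F n \<in> V" and Fd: "\<And>n. normsq M (\<lambda>x. G x - F n x) < \<delta> + inverse (real (Suc n))" by metis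
  have FL: "F n \<in> L2 M" for n using FV V(1) by auto
  have Cauchy: "\<exists>N. \<forall>m\<ge>N. \<forall>n\<ge>N. normsq M (\<lambda>x. F m x - F n x) < e" if e: "e > 0" for e
  proof -
    obtain N where N: "inverse (real (Suc N)) < e / 4" using reals_Archimedean[of "e/4"] e by auto
    have "normsq M (\<lambda>x. F m x - F n x) < e" if mn: "m \<ge> N" "n \<ge> N" for m n
    proof -
      have GF: "(\<lambda>x. G x - F k x) \<in> L2 M" for k by (intro L2_diff G FL)
      have "normsq M (\<lambda>x. (G x - F m x) + (G x - F n x)) + normsq M (\<lambda>x. (G x - F m x) - (G x - F n x))
        = 2 * normsq M (\<lambda>x. G x - F m x) + 2 * normsq M (\<lambda>x. G x - F n x)"
        by (rule normsq_parallelogram[OF GF GF])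
      moreover have "normsq M (\<lambda>x. (G x - F m x) - (G x - F n x)) = normsq M (\<lambda>x. F m x - F n x)"
        by (simp add: normsq_def norm_minus_commute)
      moreover have "normsq M (\<lambda>x. (G x - F m x) + (G x - F n x)) \<ge> 4 * \<delta>"
      proof -
        have "(\<lambda>x. (1/2) * (F m x + F n x)) \<in> V" by (intro V FV)
        from \<delta>[OF this] have "4 * \<delta> \<le> (cmod 2)\<^sup>2 * normsq M (\<lambda>x. G x - (1/2) * (F m x + F n x))" by simp
        also have "\<dots> = normsq M (\<lambda>x. 2 * (G x - (1/2) * (F m x + F n x)))" by (simp only: normsq_cmult)
        also have "\<dots> = normsq M (\<lambda>x. (G x - F m x) + (G x - F n x))" by (simp add: algebra_simps)
        finally show ?thesis .
      qed
      moreover have inv: "inverse (real (Suc k)) < e / 4" if "k \<ge> N" for k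
        by (rule le_less_trans[OF le_imp_inverse_le N]) (use that in simp_all)
      note inv[OF mn(1)] inv[OF mn(2)]
      ultimately show ?thesis using Fd[of m] Fd[of n] by linarith
    qed
    thus ?thesis by blast
  qed
  obtain P where P: "P \<in> L2 M" "(\<lambda>n. normsq M (\<lambda>x. F n x - P x)) \<longlonglongrightarrow> 0"
    using L2_complete[OF FL Cauchy] by blast
  have ge: "\<delta> \<le> normsq M (\<lambda>x. (G x - P x) + c * v x)" if v: "v \<in> V" for v c
  proof -
    have h: "(\<lambda>x. G x + c * v x) \<in> L2 M" using v V(1) by (intro L2_add L2_cmult G) auto
    have "(\<lambda>n. normsq M (\<lambda>x. (G x + c * v x) - F n x)) \<longlonglongrightarrow> normsq M (\<lambda>x. (G x + c * v x) - P x)"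
      by (rule normsq_tendsto[OF FL P(1) h P(2)])
    moreover have "\<delta> \<le> normsq M (\<lambda>x. (G x + c * v x) - F n x)" for n
    proof -
      have "(\<lambda>x. F n x + (-c) * v x) \<in> V" by (intro V FV v)
      from \<delta>[OF this] show ?thesis by (simp add: algebra_simps)
    qed
    ultimately have "\<delta> \<le> normsq M (\<lambda>x. (G x + c * v x) - P x)"
      by (intro LIMSEQ_le_const) auto
    thus ?thesis by (simp add: algebra_simps)
  qed
  have eq: "normsq M (\<lambda>x. G x - P x) \<le> \<delta>"
  proof (rule LIMSEQ_le[OF normsq_tendsto[OF FL P(1) G P(2)]])
    show "(\<lambda>n. \<delta> + inverse (real (Suc n))) \<longlonglongrightarrow> \<delta>"
      using LIMSEQ_inverse_real_of_nat_add[of \<delta>] .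
    show "\<exists>N. \<forall>n\<ge>N. normsq M (\<lambda>x. G x - F n x) \<le> \<delta> + inverse (real (Suc n))"
      using Fd less_imp_le by blast
  qed
  have "ip M (\<lambda>x. G x - P x) v = 0" if v: "v \<in> V" for v
  proof -
    define a where "a = ip M (\<lambda>x. G x - P x) v"
    \<comment> \<open>The + 1 covers the case that v has norm 0 and ensures
      \<open>t * normsq M v < 1\<close>, so the factor \<open>t * normsq M v - 2\<close> below is
      negative.\<close>
    define t where "t = 1 / (normsq M v + 1)"
    have n: "normsq M v + 1 > 0" using normsq_nonneg[of M v] by linarith
    have t: "t > 0" "t * normsq M v < 1" using n by (auto simp: t_def field_simps)
    have GP: "(\<lambda>x. G x - P x) \<in> L2 M" and vL: "v \<in> L2 M" using v V(1) by (auto intro: L2_diff G P)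
    have "Re (cnj (- of_real t * a) * a) = - t * (cmod a)\<^sup>2"
      unfolding cmod_power2 by (simp add: power2_eq_square algebra_simps)
    hence "0 \<le> t\<^sup>2 * (cmod a)\<^sup>2 * normsq M v - 2 * t * (cmod a)\<^sup>2"
      using normsq_add_cmult[OF GP vL, of "- of_real t * a"] ge[OF v, of "- of_real t * a"] eq t
      by (simp add: a_def[symmetric] norm_mult power_mult_distrib)
    hence "0 \<le> t * (cmod a)\<^sup>2 * (t * normsq M v - 2)" by (simp add: power2_eq_square algebra_simps)
    hence "t * (cmod a)\<^sup>2 \<le> 0" using t(2) by (simp add: zero_le_mult_iff) 
    thus ?thesis using t(1) by (simp add: a_def mult_le_0_iff)
  qed
  from that[OF P(1) FV P(2) this] show ?thesis .
qed

section \<open>The transform and its coherent states\<close>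

lemma nn_integral_power_exp:
  assumes s: "s > (0::real)"
  shows "(\<integral>\<^sup>+l. indicator {..<0} l * ennreal ((-l) ^ k * exp (s * l)) \<partial>lborel) = ennreal (fact k / s ^ Suc k)"
proof -
  have "(\<integral>\<^sup>+l. indicator {..<0} l * ennreal ((-l) ^ k * exp (s * l)) \<partial>lborel)
     = ennreal (1 / s) * (\<integral>\<^sup>+x. indicator {..<0} (0 + (- 1 / s) * x) * ennreal ((- (0 + (- 1 / s) * x)) ^ k * exp (s * (0 + (- 1 / s) * x))) \<partial>lborel)"
    using s by (subst nn_integral_real_affine[where t=0 and c="- 1 / s"]) auto
  also have "(\<integral>\<^sup>+x. indicator {..<0} (0 + (- 1 / s) * x) * ennreal ((- (0 + (- 1 / s) * x)) ^ k * exp (s * (0 + (- 1 / s) * x))) \<partial>lborel)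
     = (\<integral>\<^sup>+x. ennreal ((1 / s) ^ k) * (ennreal (x ^ k * exp (- x)) * indicator {0..} x) \<partial>lborel)"
  proof (rule nn_integral_cong_AE)
    have "AE x in lborel. x \<noteq> (0::real)" by (rule AE_lborel_singleton)
    thus "AE x in lborel. indicator {..<0} (0 + (- 1 / s) * x) * ennreal ((- (0 + (- 1 / s) * x)) ^ k * exp (s * (0 + (- 1 / s) * x)))
        = ennreal ((1 / s) ^ k) * (ennreal (x ^ k * exp (- x)) * indicator {0..} x)"
    proof eventually_elim
      case (elim x)
      show ?case
      proof (cases "x > 0")
        case True
        thus ?thesis using s by (simp add: ennreal_mult[symmetric] power_divide field_simps)
      next
        case False
        hence "x < 0" using elim by simp
        hence "\<not> (- 1 / s) * x < 0" using s by (simp add: field_simps)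
        thus ?thesis using \<open>x < 0\<close> by simp
      qed
    qed
  qed
  also have "\<dots> = ennreal ((1 / s) ^ k) * ennreal (fact k)"
    by (subst nn_integral_cmult) (auto simp: nn_intergal_power_times_exp_Ici)
  finally show ?thesis using s by (simp add: ennreal_mult[symmetric] power_divide field_simps)
qed

text \<open>The Gamma integral with complex parameter: after the reflection l = -v it is
  \<open>integral_power_mult_iterated_deriv\<close> for the successive derivatives of
  \<open>exp (- p * v)\<close>. Integrability comes from the real case with Re p.\<close>

lemma integral_power_exp:
  fixes p :: complex
  assumes p: "Re p > 0"
  shows "(\<integral>l. indicator {..<0} l *\<^sub>R (of_real ((-l) ^ k) * exp (p * of_real l)) \<partial>lborel) = fact k / p ^ Suc k"
proof -
  have p0: "p \<noteq> 0" using p by auto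
  have int: "integrable lborel (\<lambda>l. indicator {..<0} l *\<^sub>R (of_real ((-l) ^ k) * exp (p * of_real l)))"
  proof (rule integrableI_bounded)
    have "(\<integral>\<^sup>+l. ennreal (norm (indicator {..<0} l *\<^sub>R (of_real ((-l) ^ k) * exp (p * of_real l)))) \<partial>lborel)
      = (\<integral>\<^sup>+l. indicator {..<0} l * ennreal ((-l) ^ k * exp (Re p * l)) \<partial>lborel)"
      by (intro nn_integral_cong) (auto simp: indicator_def norm_mult norm_power)
    thus "(\<integral>\<^sup>+l. ennreal (norm (indicator {..<0} l *\<^sub>R (of_real ((-l) ^ k) * exp (p * of_real l)))) \<partial>lborel) < \<infinity>"
      using p by (simp add: nn_integral_power_exp)
  qed measurable
  have refl: "(\<lambda>v. indicator {0<..} v *\<^sub>R (of_real (v ^ k) * exp (- p * of_real v))) =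
      (\<lambda>v. indicator {..<0} (0 + (-1) * v) *\<^sub>R (of_real ((- (0 + (-1) * v)) ^ k) * exp (p * of_real (0 + (-1) * v))))"
    by (auto simp: indicator_def)
  have int': "integrable lborel (\<lambda>v. indicator {0<..} v *\<^sub>R (of_real (v ^ k) * exp (- p * of_real v)))"
    unfolding refl by (rule lborel_integrable_real_affine[OF int]) simp
  define D where "D j v = (- p) ^ j * exp (- p * of_real v)" for j and v :: real
  have D: "indicator {0<..} v *\<^sub>R (of_real (v ^ k) * D (Suc k) v) = (- p) ^ Suc k * (indicator {0<..} v *\<^sub>R (of_real (v ^ k) * exp (- p * of_real v)))" for v
    by (simp add: D_def)
  have "(\<integral>v. indicator {0<..} v *\<^sub>R (of_real (v ^ k) * D (Suc k) v) \<partial>lborel) = - ((-1) ^ k * fact k * D 0 0)"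
  proof (rule integral_power_mult_iterated_deriv)
    fix j v
    show "(D j has_vector_derivative D (Suc j) v) (at v)"
    proof -
      have "((\<lambda>w. exp (- p * w)) has_field_derivative exp (- p * of_real v) * - p) (at (of_real v))"
        by (auto intro!: derivative_eq_intros)
      from has_vector_derivative_mult_right[OF has_vector_derivative_real_field[OF this], of "(- p) ^ j"]
      show ?thesis by (simp add: D_def[abs_def] mult_ac)
    qed
  next
    fix j
    show "((\<lambda>v. of_real (v ^ j) * D j v) \<longlongrightarrow> 0) at_top"
    proof (rule Lim_null_comparison)
      show "\<forall>\<^sub>F v in at_top. norm (of_real (v ^ j) * D j v) \<le> cmod p ^ j * (v ^ j * exp (- Re p * v))"
        using eventually_ge_at_top[of 0]
        by eventually_elim (simp add: D_def norm_mult norm_power)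
      show "((\<lambda>v. cmod p ^ j * (v ^ j * exp (- Re p * v))) \<longlongrightarrow> 0) at_top"
        using p by real_asymp
    qed
  next
    show "integrable lborel (\<lambda>v. indicator {0<..} v *\<^sub>R (of_real (v ^ k) * D (Suc k) v))"
      unfolding D by (intro integrable_mult_right int')
  qed
  hence "(- p) ^ Suc k * (\<integral>v. indicator {0<..} v *\<^sub>R (of_real (v ^ k) * exp (- p * of_real v)) \<partial>lborel) = - ((-1) ^ k * fact k)"
    unfolding D by (simp only: integral_mult_right_zero) (simp add: D_def)
  hence "p ^ Suc k * (\<integral>v. indicator {0<..} v *\<^sub>R (of_real (v ^ k) * exp (- p * of_real v)) \<partial>lborel) = fact k"
    by (simp add: power_minus[of p] mult.assoc)
  hence "(\<integral>v. indicator {0<..} v *\<^sub>R (of_real (v ^ k) * exp (- p * of_real v)) \<partial>lborel) = fact k / p ^ Suc k"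
    using p0 by (simp add: field_simps)
  moreover have "(\<integral>v. indicator {0<..} v *\<^sub>R (of_real (v ^ k) * exp (- p * of_real v)) \<partial>lborel)
     = (\<integral>l. indicator {..<0} l *\<^sub>R (of_real ((-l) ^ k) * exp (p * of_real l)) \<partial>lborel)"
    unfolding refl
    by (subst (2) lborel_integral_real_affine[where t=0 and c="-1"]) auto
  ultimately show ?thesis by simp
qed

text \<open>Multi-indices are all functions on a finite set, so an absolutely convergent sum of
  products factors into one exponential series per coordinate. Real q gives norms of coherent
  states, complex q their inner products.\<close>

lemma
  fixes q :: "'n::finite \<Rightarrow> 'c::{real_normed_field,banach,second_countable_topology}"
  shows integrable_multi_exp: "integrable (count_space UNIV) (\<lambda>\<alpha> :: 'n \<Rightarrow> nat. \<Prod>i\<in>UNIV. q i ^ \<alpha> i / fact (\<alpha> i))"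
    and integral_multi_exp: "(\<integral>\<alpha>. (\<Prod>i\<in>UNIV. q i ^ \<alpha> i / fact (\<alpha> i)) \<partial>count_space (UNIV :: ('n \<Rightarrow> nat) set)) = (\<Prod>i\<in>UNIV. exp (q i))"
proof -
  have s: "Infinite_Set_Sum.abs_summable_on (\<lambda>k. q i ^ k / fact k) UNIV" for i
    using summable_norm_exp[of "q i"]
    by (simp add: Infinite_Set_Sum.abs_summable_on_nat_iff' divide_inverse mult.commute scaleR_conv_of_real)
  have "integrable (count_space (PiE (UNIV :: 'n set) (\<lambda>_. UNIV))) (\<lambda>\<alpha> :: 'n \<Rightarrow> nat. \<Prod>i\<in>UNIV. q i ^ \<alpha> i / fact (\<alpha> i))"
    using Infinite_Set_Sum.abs_summable_on_prod_PiE[of "UNIV :: 'n set" "\<lambda>_. UNIV :: nat set" "\<lambda>i k. q i ^ k / fact k"] s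
    by (simp add: Infinite_Set_Sum.abs_summable_on_def)
  thus "integrable (count_space UNIV) (\<lambda>\<alpha> :: 'n \<Rightarrow> nat. \<Prod>i\<in>UNIV. q i ^ \<alpha> i / fact (\<alpha> i))" by (simp add: PiE_UNIV_domain)
  have e: "infsetsum (\<lambda>k. q i ^ k / fact k) UNIV = exp (q i)" for i
    using Infinite_Set_Sum.infsetsum_nat'[OF s[of i]]
    by (simp add: exp_def divide_inverse mult.commute scaleR_conv_of_real)
  have "infsetsum (\<lambda>\<alpha> :: 'n \<Rightarrow> nat. \<Prod>i\<in>UNIV. q i ^ \<alpha> i / fact (\<alpha> i)) (PiE UNIV (\<lambda>_. UNIV)) = (\<Prod>i\<in>UNIV. exp (q i))"
    using Infinite_Set_Sum.infsetsum_prod_PiE[of "UNIV :: 'n set" "\<lambda>_. UNIV :: nat set" "\<lambda>i k. q i ^ k / fact k"] s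
    by (simp add: e)
  thus "(\<integral>\<alpha>. (\<Prod>i\<in>UNIV. q i ^ \<alpha> i / fact (\<alpha> i)) \<partial>count_space (UNIV :: ('n \<Rightarrow> nat) set)) = (\<Prod>i\<in>UNIV. exp (q i))"
    by (simp add: infsetsum_def PiE_UNIV_domain)
qed

section \<open>Coherent states and their Gram matrix\<close>

lemma pair_sigma_finite_base: "pair_sigma_finite (count_space (UNIV :: ('n::finite \<Rightarrow> nat) set)) (lborel :: real measure)"
  by (intro pair_sigma_finite.intro sigma_finite_measure_count_space_countable countableI_type sigma_finite_lborel)

text \<open>The first factor is countable and discrete, so measurability can be checked one
  multi-index at a time.\<close>

lemma measurable_base_measI:
  assumes "\<And>\<alpha>. (\<lambda>l. f (\<alpha>, l)) \<in> measurable lborel N"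
  shows "f \<in> measurable (base_meas :: (('n::finite \<Rightarrow> nat) \<times> real) measure) N"
  unfolding base_meas_def using assms by (intro measurable_pair_measure_countable1) (auto intro: countableI_type)

lemma nn_integral_base_meas:
  assumes "f \<in> borel_measurable (base_meas :: (('n::finite \<Rightarrow> nat) \<times> real) measure)"
  shows "(\<integral>\<^sup>+x. f x \<partial>base_meas) = (\<integral>\<^sup>+l. \<integral>\<^sup>+\<alpha>. f (\<alpha>, l) \<partial>count_space UNIV \<partial>lborel)"
proof -
  interpret pair_sigma_finite "count_space (UNIV :: ('n \<Rightarrow> nat) set)" "lborel :: real measure" by (rule pair_sigma_finite_base)
  show ?thesis using nn_integral_snd[of f] assms by (simp add: base_meas_def)
qed

definition mu_weight :: "('n::finite \<Rightarrow> nat) \<times> real \<Rightarrow> real" where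
  "mu_weight x = (if snd x < 0 then mfact (fst x) * (2 / \<bar>snd x\<bar>) ^ msize (fst x) * \<bar>snd x\<bar> ^ (2 * CARD('n)) else 0)"

lemma mu_weight_pos: "snd x < 0 \<Longrightarrow> mu_weight x > 0"
  by (auto simp: mu_weight_def mfact_def zero_less_power_eq intro!: mult_pos_pos prod_pos)

lemma mu_weight_nonneg [simp]: "mu_weight x \<ge> 0"
  by (cases "snd x < 0") (use mu_weight_pos[of x] in \<open>auto simp: mu_weight_def\<close>)

lemma measurable_mu_weight [measurable]: "mu_weight \<in> borel_measurable base_meas"
  by (rule measurable_base_measI) (unfold mu_weight_def fst_conv snd_conv, measurable)

lemma mu_eq: "mu = density base_meas (\<lambda>x. ennreal (mu_weight x))"
  unfolding mu_def by (intro arg_cong[where f="density base_meas"]) (auto simp: mu_weight_def fun_eq_iff)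

lemma measurable_mu_iff: "f \<in> measurable mu N \<longleftrightarrow> f \<in> measurable base_meas N"
  by (simp add: mu_eq measurable_def)

text \<open>The kernel of \<open>Strans\<close> after n derivatives in the last variable, each of
  which contributes \<open>- \<i> * l\<close>. Conjugation of the function is left out, so that
  \<open>transform\<close> is linear.\<close>

definition fourier_kernel :: "nat \<Rightarrow> (complex ^ 'n::finite) \<times> complex \<Rightarrow> ('n \<Rightarrow> nat) \<times> real \<Rightarrow> complex" where
  "fourier_kernel n z x = (if snd x < 0 then mpow (fst z) (fst x) * exp (- \<i> * of_real (snd x) * snd z)
      * (- \<i> * of_real (snd x)) ^ n * of_real (\<bar>snd x\<bar> ^ CARD('n)) else 0)"

text \<open>For nonnegative frequency both numerator and denominator are 0, and so is the quotient.\<close>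

definition coherent :: "nat \<Rightarrow> (complex ^ 'n::finite) \<times> complex \<Rightarrow> ('n \<Rightarrow> nat) \<times> real \<Rightarrow> complex" where
  "coherent n z x = cnj (fourier_kernel n z x) / of_real (mu_weight x)"

definition transform :: "nat \<Rightarrow> (('n::finite \<Rightarrow> nat) \<times> real \<Rightarrow> complex) \<Rightarrow> (complex ^ 'n) \<times> complex \<Rightarrow> complex" where
  "transform n f z = (\<integral>x. fourier_kernel n z x * f x \<partial>base_meas)"

lemma measurable_fourier_kernel [measurable]: "fourier_kernel n z \<in> borel_measurable base_meas"
  by (rule measurable_base_measI) (unfold fourier_kernel_def fst_conv snd_conv, measurable)

lemma measurable_coherent [measurable]: "coherent n z \<in> borel_measurable base_meas"
  unfolding coherent_def[abs_def] by measurable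

lemma mu_weight_coherent: "of_real (mu_weight x) * cnj (coherent n z x) = fourier_kernel n z x"
  using mu_weight_pos[of x] by (cases "snd x < 0") (auto simp: coherent_def fourier_kernel_def)

text \<open>The integrand of the Gram matrix, and the reason for the form of \<open>mu\<close>: its
  power of \<bar>l\<bar> cancels the two factors \<open>\<bar>l\<bar>^d\<close>, while
  \<open>\<alpha>! (2/\<bar>l\<bar>)^\<bar>\<alpha>\<bar>\<close> in the denominator turns the
  monomials into terms of exponential series.\<close>

lemma fourier_kernel_product:
  assumes "l < 0"
  shows "fourier_kernel n z (\<alpha>, l) * cnj (fourier_kernel n z' (\<alpha>, l)) / of_real (mu_weight (\<alpha>, l))
    = of_real ((-l) ^ (2 * n)) * exp (- \<i> * (snd z - cnj (snd z')) * of_real l)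
       * (\<Prod>i\<in>UNIV. (of_real (-l) / 2 * (fst z $ i * cnj (fst z' $ i))) ^ \<alpha> i / fact (\<alpha> i))"
proof -
  have 1: "(- \<i> * of_real l) ^ n * cnj ((- \<i> * of_real l) ^ n) = complex_of_real ((-l) ^ (2 * n))"
  proof -
    have "(- \<i> * of_real l) * cnj (- \<i> * of_real l) = complex_of_real ((-l)\<^sup>2)"
      by (simp add: complex_eq_iff power2_eq_square)
    thus ?thesis by (simp only: complex_cnj_power power_mult_distrib[symmetric] of_real_power power_mult)
  qed
  have 2: "exp (- \<i> * of_real l * snd z) * cnj (exp (- \<i> * of_real l * snd z')) = exp (- \<i> * (snd z - cnj (snd z')) * of_real l)"
  proof -
    have "- \<i> * of_real l * snd z + cnj (- \<i> * of_real l * snd z') = - \<i> * (snd z - cnj (snd z')) * of_real l"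
      by (simp add: algebra_simps)
    thus ?thesis by (simp only: exp_cnj mult_exp_exp)
  qed
  have 3: "mpow (fst z) \<alpha> * cnj (mpow (fst z') \<alpha>) = (\<Prod>i\<in>UNIV. (fst z $ i * cnj (fst z' $ i)) ^ \<alpha> i)"
    by (simp add: mpow_def prod.distrib power_mult_distrib)
  have 4: "complex_of_real (\<bar>l\<bar> ^ CARD('a)) * of_real (\<bar>l\<bar> ^ CARD('a)) = of_real (\<bar>l\<bar> ^ (2 * CARD('a)))"
    by (simp add: mult_2 power_add)
  have 5: "complex_of_real (mu_weight (\<alpha>, l)) = of_real (mfact \<alpha>) * (2 / of_real (-l)) ^ msize \<alpha> * of_real (\<bar>l\<bar> ^ (2 * CARD('a)))"
    using assms by (simp add: mu_weight_def)
  have 6: "(\<Prod>i\<in>UNIV. (of_real (-l) / 2 * (fst z $ i * cnj (fst z' $ i))) ^ \<alpha> i / fact (\<alpha> i))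
     = (\<Prod>i\<in>UNIV. (fst z $ i * cnj (fst z' $ i)) ^ \<alpha> i) * (of_real (-l) / 2) ^ msize \<alpha> / of_real (mfact \<alpha>)"
    unfolding prod_dividef power_mult_distrib prod.distrib msize_def power_sum mfact_def
    by (simp only: of_real_prod of_real_fact mult_ac)
  have l: "complex_of_real (\<bar>l\<bar> ^ (2 * CARD('a))) \<noteq> 0" using assms by simp
  have m: "complex_of_real (mfact \<alpha>) \<noteq> 0" by (auto simp: mfact_def)
  have "fourier_kernel n z (\<alpha>, l) * cnj (fourier_kernel n z' (\<alpha>, l)) =
    (mpow (fst z) \<alpha> * cnj (mpow (fst z') \<alpha>)) * (exp (- \<i> * of_real l * snd z) * cnj (exp (- \<i> * of_real l * snd z')))
     * ((- \<i> * of_real l) ^ n * cnj ((- \<i> * of_real l) ^ n)) * (complex_of_real (\<bar>l\<bar> ^ CARD('a)) * of_real (\<bar>l\<bar> ^ CARD('a)))"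
    using assms by (simp add: fourier_kernel_def mult_ac)
  also have "\<dots> = (\<Prod>i\<in>UNIV. (fst z $ i * cnj (fst z' $ i)) ^ \<alpha> i) * exp (- \<i> * (snd z - cnj (snd z')) * of_real l) * of_real ((-l) ^ (2 * n))
     * of_real (\<bar>l\<bar> ^ (2 * CARD('a)))" by (simp only: 1 2 3 4)
  finally have 7: "fourier_kernel n z (\<alpha>, l) * cnj (fourier_kernel n z' (\<alpha>, l)) =
     (\<Prod>i\<in>UNIV. (fst z $ i * cnj (fst z' $ i)) ^ \<alpha> i) * exp (- \<i> * (snd z - cnj (snd z')) * of_real l) * of_real ((-l) ^ (2 * n))
     * of_real (\<bar>l\<bar> ^ (2 * CARD('a)))" .
  define a where "a = complex_of_real (-l) / 2"
  have a: "a \<noteq> 0" "2 / of_real (-l) = inverse a" using assms by (auto simp: a_def)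
  have "A * E * T * L / (M * inverse a ^ k * L) = T * E * (A * a ^ k / M)" if "L \<noteq> 0" "M \<noteq> 0" for A E T L M :: complex and k
    using that a(1) by (simp add: field_simps)
  note * = this[OF l m]
  show ?thesis unfolding 7 5[unfolded a(2)] 6[folded a_def] a_def[symmetric] by (rule *)
qed

text \<open>The diagonal of the Gram matrix, done with nonnegative integrals because finiteness is
  part of the claim. The exponential series combine with \<open>exp (2 * Im (snd z) * l)\<close> to
  \<open>exp (2 * rho z * l)\<close>, so rho is the rate of decay in frequency.\<close>

lemma coherent_L2:
  assumes z: "z \<in> siegelU"
  shows "coherent n z \<in> L2 mu" and "normsq mu (coherent n z) = fact (2 * n) / (2 * rho z) ^ Suc (2 * n)"
proof -
  have r: "rho z > 0" using z by (simp add: siegelU_def)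
  have nn: "(\<integral>\<^sup>+x. ennreal ((cmod (coherent n z x))\<^sup>2) \<partial>mu) = ennreal (fact (2 * n) / (2 * rho z) ^ Suc (2 * n))"
  proof -
    have [measurable]: "(\<lambda>x. ennreal (mu_weight x) * ennreal ((cmod (coherent n z x))\<^sup>2)) \<in> borel_measurable base_meas"
      by measurable
    have "(\<integral>\<^sup>+x. ennreal ((cmod (coherent n z x))\<^sup>2) \<partial>mu) = (\<integral>\<^sup>+x. ennreal (mu_weight x) * ennreal ((cmod (coherent n z x))\<^sup>2) \<partial>base_meas)"
      unfolding mu_eq by (rule nn_integral_density) measurable
    also have "\<dots> = (\<integral>\<^sup>+l. \<integral>\<^sup>+\<alpha>. ennreal (mu_weight (\<alpha>, l)) * ennreal ((cmod (coherent n z (\<alpha>, l)))\<^sup>2) \<partial>count_space UNIV \<partial>lborel)"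
      by (rule nn_integral_base_meas) measurable
    also have "\<dots> = (\<integral>\<^sup>+l. indicator {..<0} l * ennreal ((-l) ^ (2 * n) * exp ((2 * rho z) * l)) \<partial>lborel)"
    proof (rule nn_integral_cong)
      fix l :: real
      show "(\<integral>\<^sup>+\<alpha>. ennreal (mu_weight (\<alpha>, l)) * ennreal ((cmod (coherent n z (\<alpha>, l)))\<^sup>2) \<partial>count_space UNIV)
         = indicator {..<0} l * ennreal ((-l) ^ (2 * n) * exp ((2 * rho z) * l))"
      proof (cases "l < 0")
        case True
        define q where "q i = (-l) / 2 * (cmod (fst z $ i))\<^sup>2" for i
        have q0: "q i \<ge> 0" for i using True by (simp add: q_def mult_nonpos_nonneg)
        define C where "C = (-l) ^ (2 * n) * exp (2 * Im (snd z) * l)"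
        have C0: "C \<ge> 0" using True by (simp add: C_def)
        have e: "mu_weight (\<alpha>, l) * (cmod (coherent n z (\<alpha>, l)))\<^sup>2 = C * (\<Prod>i\<in>UNIV. q i ^ \<alpha> i / fact (\<alpha> i))" for \<alpha>
        proof -
          have a: "cmod (complex_of_real ((-l) ^ (2 * n))) = (-l) ^ (2 * n)"
            by (simp only: norm_of_real) (use True in simp)
          have w: "mu_weight (\<alpha>, l) > 0" using True by (intro mu_weight_pos) simp
          have "mu_weight (\<alpha>, l) * (cmod (coherent n z (\<alpha>, l)))\<^sup>2
             = cmod (fourier_kernel n z (\<alpha>, l) * cnj (fourier_kernel n z (\<alpha>, l)) / of_real (mu_weight (\<alpha>, l)))"
            using w by (simp add: coherent_def norm_divide norm_mult power2_eq_square)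
          also have "\<dots> = C * (\<Prod>i\<in>UNIV. q i ^ \<alpha> i / fact (\<alpha> i))"
            unfolding fourier_kernel_product[OF True] norm_mult prod_norm[symmetric] norm_divide norm_power norm_exp_eq_Re a
            using True by (simp add: C_def q_def norm_mult power2_eq_square algebra_simps)
          finally show ?thesis .
        qed
        have "(\<integral>\<^sup>+\<alpha>. ennreal (mu_weight (\<alpha>, l)) * ennreal ((cmod (coherent n z (\<alpha>, l)))\<^sup>2) \<partial>count_space UNIV)
          = (\<integral>\<^sup>+\<alpha>. ennreal C * ennreal (\<Prod>i\<in>UNIV. q i ^ \<alpha> i / fact (\<alpha> i)) \<partial>count_space UNIV)"
          by (intro nn_integral_cong) (simp add: ennreal_mult[symmetric] e C0 prod_nonneg q0)
        also have "\<dots> = ennreal C * ennreal (\<Prod>i\<in>UNIV. exp (q i))"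
          using nn_integral_eq_integral[OF integrable_multi_exp[of q]] q0
          by (simp add: nn_integral_cmult prod_nonneg integral_multi_exp)
        also have "(\<Prod>i\<in>UNIV. exp (q i)) = exp ((-l) / 2 * (norm (fst z))\<^sup>2)"
        proof -
          have "(\<Sum>i\<in>UNIV. q i) = (-l) / 2 * (\<Sum>i\<in>UNIV. (cmod (fst z $ i))\<^sup>2)"
            by (simp only: q_def sum_distrib_left)
          also have "(\<Sum>i\<in>UNIV. (cmod (fst z $ i))\<^sup>2) = (norm (fst z))\<^sup>2"
            by (simp add: norm_vec_def L2_set_def sum_nonneg)
          finally show ?thesis by (simp only: exp_sum[OF finite, symmetric])
        qed
        also have "ennreal C * ennreal (exp ((-l) / 2 * (norm (fst z))\<^sup>2)) = ennreal ((-l) ^ (2 * n) * exp ((2 * rho z) * l))"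
        proof -
          have "2 * Im (snd z) * l + (-l) / 2 * (norm (fst z))\<^sup>2 = (2 * rho z) * l" by (simp add: rho_def field_simps)
          thus ?thesis using C0 by (simp add: C_def ennreal_mult[symmetric] mult.assoc exp_add[symmetric])
        qed
        finally show ?thesis using True by simp
      qed (simp add: mu_weight_def)
    qed
    also have "\<dots> = ennreal (fact (2 * n) / (2 * rho z) ^ Suc (2 * n))"
      using r by (intro nn_integral_power_exp) simp
    finally show ?thesis .
  qed
  show c: "coherent n z \<in> L2 mu"
    by (rule L2I_nn) (simp_all add: measurable_mu_iff nn measurable_coherent)
  show "normsq mu (coherent n z) = fact (2 * n) / (2 * rho z) ^ Suc (2 * n)"
    using nn_integral_L2[OF c] nn r by simp
qed

lemma integrable_mu_iff:
  fixes f :: "_ \<Rightarrow> complex"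
  assumes "f \<in> borel_measurable base_meas"
  shows "integrable mu f \<longleftrightarrow> integrable base_meas (\<lambda>x. mu_weight x *\<^sub>R f x)"
  unfolding mu_eq using assms by (subst integrable_density) auto

lemma transform_eq_ip:
  assumes f: "f \<in> L2 mu"
  shows "transform n f z = ip mu f (coherent n z)"
proof -
  have [measurable]: "f \<in> borel_measurable base_meas" using L2D(1)[OF f] by (simp add: measurable_mu_iff)
  have "ip mu f (coherent n z) = (\<integral>x. mu_weight x *\<^sub>R (f x * cnj (coherent n z x)) \<partial>base_meas)"
    unfolding ip_def mu_eq by (rule integral_density) (auto simp del: complex_cnj_cnj)
  also have "\<dots> = transform n f z"
    unfolding transform_def
    by (intro Bochner_Integration.integral_cong refl)
       (simp add: mu_weight_coherent[symmetric] scaleR_conv_of_real mult_ac)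
  finally show ?thesis by simp
qed

lemma transform_integrable:
  assumes f: "f \<in> L2 mu" and z: "z \<in> siegelU"
  shows "integrable base_meas (\<lambda>x. fourier_kernel n z x * f x)"
proof -
  have [measurable]: "f \<in> borel_measurable base_meas" using L2D(1)[OF f] by (simp add: measurable_mu_iff)
  have "integrable mu (\<lambda>x. f x * cnj (coherent n z x))"
    by (rule L2_integrable_mult[OF f coherent_L2(1)[OF z]])
  hence "integrable base_meas (\<lambda>x. mu_weight x *\<^sub>R (f x * cnj (coherent n z x)))"
    by (subst (asm) integrable_mu_iff) measurable
  thus ?thesis by (simp add: mu_weight_coherent[symmetric] scaleR_conv_of_real mult_ac)
qed

text \<open>Point evaluations of the transform are bounded on L2(mu). Hence norm convergence implies
  pointwise convergence of transforms, and the case n = 0 gives decay as rho tends to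
  infinity.\<close>

lemma transform_bound:
  assumes f: "f \<in> L2 mu" and z: "z \<in> siegelU"
  shows "(cmod (transform n f z))\<^sup>2 \<le> normsq mu f * (fact (2 * n) / (2 * rho z) ^ Suc (2 * n))"
  using ip_Cauchy_Schwarz[OF f coherent_L2(1)[OF z, of n]]
  by (simp only: transform_eq_ip[OF f] coherent_L2(2)[OF z])

lemma cnj_conj_kernel: "cnj (conj_kernel N z0 z) = conj_kernel N z z0"
proof -
  have "cnj (\<i> * (cnj (snd z) - snd z0) - hinner (fst z0) (fst z) / 2) = \<i> * (cnj (snd z0) - snd z) - hinner (fst z) (fst z0) / 2"
    by (simp add: cnj_hinner algebra_simps)
  thus ?thesis by (simp only: conj_kernel_def complex_cnj_divide complex_cnj_power complex_cnj_one)
qed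

text \<open>The real part equals
  \<open>rho z + rho z' + (norm (fst z - fst z'))^2 / 4\<close>.\<close>

lemma Re_kernel_pos:
  assumes z: "z \<in> siegelU" and z': "z' \<in> siegelU"
  shows "Re (\<i> * (cnj (snd z') - snd z) - hinner (fst z) (fst z') / 2) > 0"
proof -
  have "0 \<le> (norm (fst z + - fst z'))\<^sup>2" by simp
  also have "\<dots> = (norm (fst z))\<^sup>2 + (norm (fst z'))\<^sup>2 - 2 * Re (hinner (fst z') (fst z))"
    unfolding norm_add_square by (simp add: hinner_minus_left)
  finally have "2 * Re (hinner (fst z') (fst z)) \<le> (norm (fst z))\<^sup>2 + (norm (fst z'))\<^sup>2" by simp
  moreover have "Re (hinner (fst z') (fst z)) = Re (hinner (fst z) (fst z'))" by (subst cnj_hinner[symmetric]) simp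
  ultimately show ?thesis using z z' by (simp add: siegelU_def rho_def)
qed

text \<open>Summing over multi-indices adds \<open>- l / 2 * hinner (fst z) (fst z')\<close> to the
  exponent; what remains is the Laplace integral of \<open>(-l)^(2n)\<close> at the parameter p,
  whose real part is positive by \<open>Re_kernel_pos\<close>.\<close>

lemma transform_coherent:
  assumes z: "z \<in> siegelU" and z': "z' \<in> siegelU"
  shows "transform n (coherent n z') z = fact (2 * n) * conj_kernel (2 * n) z z'"
proof -
  interpret pair_sigma_finite "count_space (UNIV :: ('a \<Rightarrow> nat) set)" "lborel :: real measure" by (rule pair_sigma_finite_base)
  define p where "p = \<i> * (cnj (snd z') - snd z) - hinner (fst z) (fst z') / 2"
  have int: "integrable base_meas (\<lambda>x. fourier_kernel n z x * coherent n z' x)"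
    by (rule transform_integrable[OF coherent_L2(1)[OF z'] z])
  have "transform n (coherent n z') z = (\<integral>l. \<integral>\<alpha>. fourier_kernel n z (\<alpha>, l) * coherent n z' (\<alpha>, l) \<partial>count_space UNIV \<partial>lborel)"
    using integral_snd[of "\<lambda>\<alpha> l. fourier_kernel n z (\<alpha>, l) * coherent n z' (\<alpha>, l)"] int
    by (simp add: transform_def base_meas_def case_prod_unfold)
  also have "\<dots> = (\<integral>l. indicator {..<0} l *\<^sub>R (of_real ((-l) ^ (2 * n)) * exp (p * of_real l)) \<partial>lborel)"
  proof (rule Bochner_Integration.integral_cong[OF refl])
    fix l :: real
    show "(\<integral>\<alpha>. fourier_kernel n z (\<alpha>, l) * coherent n z' (\<alpha>, l) \<partial>count_space UNIV) = indicator {..<0} l *\<^sub>R (of_real ((-l) ^ (2 * n)) * exp (p * of_real l))"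
    proof (cases "l < 0")
      case True
      define q where "q i = of_real (-l) / 2 * (fst z $ i * cnj (fst z' $ i))" for i
      have "(\<integral>\<alpha>. fourier_kernel n z (\<alpha>, l) * coherent n z' (\<alpha>, l) \<partial>count_space UNIV)
        = (\<integral>\<alpha>. of_real ((-l) ^ (2 * n)) * exp (- \<i> * (snd z - cnj (snd z')) * of_real l) * (\<Prod>i\<in>UNIV. q i ^ \<alpha> i / fact (\<alpha> i)) \<partial>count_space UNIV)"
        unfolding coherent_def times_divide_eq_right fourier_kernel_product[OF True] q_def ..
      also have "\<dots> = of_real ((-l) ^ (2 * n)) * exp (- \<i> * (snd z - cnj (snd z')) * of_real l) * (\<Prod>i\<in>UNIV. exp (q i))"
        by (simp only: integral_mult_right_zero integral_multi_exp)
      also have "(\<Prod>i\<in>UNIV. exp (q i)) = exp (of_real (-l) / 2 * hinner (fst z) (fst z'))"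
      proof -
        have "(\<Sum>i\<in>UNIV. q i) = of_real (-l) / 2 * hinner (fst z) (fst z')"
          by (simp only: q_def hinner_def sum_distrib_left)
        thus ?thesis by (simp only: exp_sum[OF finite, symmetric])
      qed
      also have "of_real ((-l) ^ (2 * n)) * exp (- \<i> * (snd z - cnj (snd z')) * of_real l) * exp (of_real (-l) / 2 * hinner (fst z) (fst z'))
         = of_real ((-l) ^ (2 * n)) * exp (p * of_real l)"
      proof -
        have "- \<i> * (snd z - cnj (snd z')) * of_real l + of_real (-l) / 2 * hinner (fst z) (fst z') = p * of_real l"
          by (simp add: p_def algebra_simps)
        thus ?thesis by (simp only: mult.assoc mult_exp_exp)
      qed
      finally show ?thesis using True by simp
    qed (simp add: fourier_kernel_def)
  qed
  also have "\<dots> = fact (2 * n) / p ^ Suc (2 * n)"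
    by (rule integral_power_exp) (use Re_kernel_pos[OF z z'] in \<open>simp add: p_def\<close>)
  finally show ?thesis by (simp add: conj_kernel_def p_def)
qed

section \<open>Holomorphy and derivatives of the transform\<close>

lemma holomorphic_several_mult:
  assumes F: "holomorphic_several F S" "holomorphic_several G S"
  shows "holomorphic_several (\<lambda>z. F z * G z) S"
  unfolding holomorphic_several_def
proof
  fix z assume z: "z \<in> S"
  obtain D where D: "(F has_derivative D) (at z)" "\<And>c v. D (cscale c v) = c * D v"
    using holomorphic_severalD[OF F(1) z] by blast
  obtain E where E: "(G has_derivative E) (at z)" "\<And>c v. E (cscale c v) = c * E v"
    using holomorphic_severalD[OF F(2) z] by blast
  show "\<exists>D. ((\<lambda>z. F z * G z) has_derivative D) (at z) \<and> (\<forall>c v. D (cscale c v) = c * D v)"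
    using has_derivative_mult[OF D(1) E(1)] D(2) E(2)
    by (intro exI[of _ "\<lambda>v. F z * E v + D v * G z"]) (simp add: algebra_simps)
qed

lemma holomorphic_several_compose:
  assumes F: "holomorphic_several F S" and g: "\<And>w. (g has_field_derivative g' w) (at w)"
  shows "holomorphic_several (\<lambda>z. g (F z)) S"
  unfolding holomorphic_several_def
proof
  fix z assume z: "z \<in> S"
  obtain D where D: "(F has_derivative D) (at z)" "\<And>c v. D (cscale c v) = c * D v"
    using holomorphic_severalD[OF F z] by blast
  show "\<exists>D. ((\<lambda>z. g (F z)) has_derivative D) (at z) \<and> (\<forall>c v. D (cscale c v) = c * D v)"
    using has_derivative_compose[OF D(1) g[of "F z", unfolded has_field_derivative_def]] D(2)
    by (intro exI[of _ "\<lambda>v. g' (F z) * D v"]) simp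
qed

lemma holomorphic_several_bounded_linear:
  assumes "bounded_linear F" "\<And>c v. F (cscale c v) = c * F v"
  shows "holomorphic_several F S"
  unfolding holomorphic_several_def using assms bounded_linear_imp_has_derivative by blast

lemma holomorphic_several_const: "holomorphic_several (\<lambda>z. c) S"
  unfolding holomorphic_several_def by (intro ballI exI[of _ "\<lambda>_. 0"]) auto

lemma holomorphic_several_prod:
  assumes "\<And>i. i \<in> I \<Longrightarrow> holomorphic_several (F i) S"
  shows "holomorphic_several (\<lambda>z. \<Prod>i\<in>I. F i z) S"
  using assms
  by (induction I rule: infinite_finite_induct) (simp_all add: holomorphic_several_const holomorphic_several_mult)

lemma holomorphic_several_mpow: "holomorphic_several (\<lambda>z. mpow (fst z) \<alpha>) S"
  unfolding mpow_def
proof (rule holomorphic_several_prod)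
  fix i
  have "holomorphic_several (\<lambda>z. fst z $ i) S"
    by (rule holomorphic_several_bounded_linear)
       (auto simp: cscale_def intro!: bounded_linear_compose[OF bounded_linear_vec_nth bounded_linear_fst])
  thus "holomorphic_several (\<lambda>z. (fst z $ i) ^ \<alpha> i) S"
    by (rule holomorphic_several_compose[where g'="\<lambda>w. of_nat (\<alpha> i) * w ^ (\<alpha> i - 1)"])
       (auto intro!: derivative_eq_intros)
qed

lemma holomorphic_several_fourier_kernel: "holomorphic_several (\<lambda>z. fourier_kernel n z x) S"
proof (cases "snd x < 0")
  case True
  have "holomorphic_several snd S"
    by (rule holomorphic_several_bounded_linear) (auto simp: cscale_def bounded_linear_snd)
  hence "holomorphic_several (\<lambda>z. exp (- \<i> * of_real (snd x) * snd z)) S"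
    by (rule holomorphic_several_compose[where g="\<lambda>w. exp (- \<i> * of_real (snd x) * w)" and g'="\<lambda>w. exp (- \<i> * of_real (snd x) * w) * (- \<i> * of_real (snd x))"])
       (auto intro!: derivative_eq_intros)
  hence "holomorphic_several (\<lambda>z. mpow (fst z) (fst x) * exp (- \<i> * of_real (snd x) * snd z) * ((- \<i> * of_real (snd x)) ^ n * of_real (\<bar>snd x\<bar> ^ CARD('a)))) S"
    by (intro holomorphic_several_mult holomorphic_several_const holomorphic_several_mpow)
  thus ?thesis using True by (simp add: fourier_kernel_def mult.assoc)
qed (simp add: fourier_kernel_def holomorphic_several_const)

lemma fourier_kernel_deriv:
  "((\<lambda>w. fourier_kernel n (\<zeta>, w) x) has_field_derivative fourier_kernel (Suc n) (\<zeta>, w) x) (at w)"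
  by (cases "snd x < 0") (auto simp: fourier_kernel_def intro!: derivative_eq_intros)

text \<open>One point dominates a whole polydisc-like set: larger moduli in the first coordinates
  and smaller height in the last increase the kernel for every multi-index and frequency. An
  integrable majorant is thus the integrand at a single point.\<close>

lemma norm_fourier_kernel_le:
  fixes y :: "(complex ^ 'n::finite) \<times> complex"
  assumes a: "\<And>i. cmod (fst y $ i) \<le> a i" and b: "b \<le> Im (snd y)"
  shows "cmod (fourier_kernel n y x) \<le> cmod (fourier_kernel n (\<chi> i. of_real (a i), \<i> * of_real b) x)"
proof (cases "snd x < 0")
  case True
  have a0: "a i \<ge> 0" for i using a[of i] norm_ge_zero order_trans by blast
  have "cmod (mpow (fst y) (fst x)) \<le> cmod (mpow (\<chi> i. of_real (a i)) (fst x))"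
    using a a0 by (simp add: mpow_def prod_norm[symmetric] norm_power prod_mono power_mono)
  moreover have "cmod (exp (- \<i> * of_real (snd x) * snd y)) \<le> cmod (exp (- \<i> * of_real (snd x) * (\<i> * of_real b)))"
    using b True by (simp add: mult_left_mono_neg)
  ultimately show ?thesis using True
    unfolding fourier_kernel_def norm_mult by (simp only: if_True fst_conv snd_conv norm_mult) (intro mult_right_mono mult_mono; simp)
qed (simp add: fourier_kernel_def)

lemma transform_has_derivative:
  assumes f: "f \<in> L2 mu" and z: "z \<in> siegelU"
  obtains D where "(transform n f has_derivative D) (at z)" "\<And>c v. D (cscale c v) = c * D v"
    "D (0, 1) = transform (Suc n) f z"
proof -
  have [measurable]: "f \<in> borel_measurable base_meas" using L2D(1)[OF f] by (simp add: measurable_mu_iff)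
  \<comment> \<open>The dominating point for \<open>ball z (2 * r)\<close>. At r = 0 it has the same
    rho as z, so by continuity it still lies in the open domain for small r.\<close>
  define za where "za r = ((\<chi> i. complex_of_real (cmod (fst z $ i) + 2 * r)) :: complex ^ 'a, \<i> * of_real (Im (snd z) - 2 * r))" for r
  have "continuous_on UNIV za" unfolding za_def by (intro continuous_intros)
  hence "open (za -` siegelU)" by (intro open_vimage open_siegelU)
  moreover have "rho (za 0) = rho z"
    by (simp add: za_def rho_def norm_vec_def)
  hence "0 \<in> za -` siegelU" using z by (simp add: siegelU_def)
  ultimately obtain e where e: "e > 0" "ball 0 e \<subseteq> za -` siegelU" using open_contains_ball by blast
  obtain e' where e': "e' > 0" "ball z e' \<subseteq> siegelU" using open_contains_ball[of siegelU] open_siegelU z by blast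
  define r where "r = min (e / 2) (e' / 2)"
  have r: "r > 0" "r < e" "2 * r \<le> e'" using e e' by (auto simp: r_def min_def)
  have zaU: "za r \<in> siegelU" using e(2) r by (auto simp: subset_iff)
  have sub: "ball z (2 * r) \<subseteq> siegelU" using e'(2) r(3) by (auto simp: subset_iff)
  have hs: "holomorphic_several (\<lambda>z. fourier_kernel n z x * f x) S" for x S
    by (intro holomorphic_several_mult holomorphic_several_fourier_kernel holomorphic_several_const)
  have "\<exists>D. ((\<lambda>z. fourier_kernel n z x * f x) has_derivative D) (at z) \<and> (\<forall>c v. D (cscale c v) = c * D v)" for x
    using hs[of x UNIV] unfolding holomorphic_several_def by blast
  then obtain D where D: "\<And>x. ((\<lambda>z. fourier_kernel n z x * f x) has_derivative D x) (at z)"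
    "\<And>x c v. D x (cscale c v) = c * D x v" by metis
  have bound: "cmod (fourier_kernel n y x * f x) \<le> cmod (fourier_kernel n (za r) x * f x)" if y: "y \<in> ball z (2 * r)" for x y
  proof -
    have n: "norm (z - y) < 2 * r" using y by (simp add: dist_norm)
    have "cmod (fst y $ i) \<le> cmod (fst z $ i) + 2 * r" for i
    proof -
      have "cmod (fst (z - y) $ i) \<le> norm (fst (z - y))" by (rule Finite_Cartesian_Product.norm_nth_le)
      also have "\<dots> \<le> norm (z - y)" by (metis norm_fst_le prod.collapse)
      finally show ?thesis using n norm_triangle_ineq2[of "fst y $ i" "fst z $ i"] by (simp add: norm_minus_commute)
    qed
    moreover have "Im (snd z) - 2 * r \<le> Im (snd y)"
    proof -
      have "\<bar>Im (snd (z - y))\<bar> \<le> cmod (snd (z - y))" by (rule abs_Im_le_cmod)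
      also have "\<dots> \<le> norm (z - y)" by (metis norm_snd_le prod.collapse)
      finally show ?thesis using n by simp
    qed
    ultimately show ?thesis
      using norm_fourier_kernel_le[of y "\<lambda>i. cmod (fst z $ i) + 2 * r" "Im (snd z) - 2 * r" n x]
      by (simp add: za_def norm_mult mult_right_mono)
  qed
  have "((\<lambda>y. \<integral>x. fourier_kernel n y x * f x \<partial>base_meas) has_derivative (\<lambda>v. \<integral>x. D x v \<partial>base_meas)) (at z)"
  proof (rule has_derivative_integral_holomorphic[OF hs _ r(1) sub _ bound D])
    show "integrable base_meas (\<lambda>x. cmod (fourier_kernel n (za r) x * f x))"
      using transform_integrable[OF f zaU] by (rule integrable_norm)
  qed auto
  hence T: "(transform n f has_derivative (\<lambda>v. \<integral>x. D x v \<partial>base_meas)) (at z)"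
    by (simp add: transform_def[abs_def])
  have D1: "D x (0, 1) = fourier_kernel (Suc n) z x * f x" for x
  proof -
    have a: "((\<lambda>s. fourier_kernel n (z + cscale s (0, 1)) x * f x) has_field_derivative D x (0, 1)) (at 0)"
      by (rule holomorphic_several_line_deriv) (simp_all add: D)
    have "z + cscale s (0, 1) = (fst z, s + snd z)" for s
      by (simp add: cscale_def prod_eq_iff vec_eq_iff add.commute)
    hence "((\<lambda>s. fourier_kernel n (fst z, s + snd z) x * f x) has_field_derivative D x (0, 1)) (at 0)"
      using a by simp
    moreover have "((\<lambda>w. fourier_kernel n (fst z, w) x * f x) has_field_derivative fourier_kernel (Suc n) z x * f x) (at (0 + snd z))"
      using DERIV_cmult_right[OF fourier_kernel_deriv[of n "fst z" x "snd z"], of "f x"] by simp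
    hence "((\<lambda>s. fourier_kernel n (fst z, s + snd z) x * f x) has_field_derivative fourier_kernel (Suc n) z x * f x) (at 0)"
      by (simp only: DERIV_shift)
    ultimately show ?thesis by (rule DERIV_unique)
  qed
  show ?thesis
    by (rule that[OF T]) (simp_all add: D D1 transform_def)
qed

lemma holomorphic_several_transform_fun:
  assumes f: "f \<in> L2 mu" shows "holomorphic_several (transform n f) siegelU"
  unfolding holomorphic_several_def using transform_has_derivative[OF f] by metis

lemma transform_deriv_last:
  assumes f: "f \<in> L2 mu" and z: "(\<zeta>, w) \<in> siegelU"
  shows "((\<lambda>w. transform n f (\<zeta>, w)) has_field_derivative transform (Suc n) f (\<zeta>, w)) (at w)"
proof -
  obtain D where D: "(transform n f has_derivative D) (at (\<zeta>, w))" "\<And>c v. D (cscale c v) = c * D v"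
    "D (0, 1) = transform (Suc n) f (\<zeta>, w)" using transform_has_derivative[OF f z] by blast
  have "((\<lambda>s. transform n f ((\<zeta>, w) + cscale s (0, 1))) has_field_derivative D (0, 1)) (at 0)"
    by (rule holomorphic_several_line_deriv) (simp_all add: D)
  moreover have "(\<zeta>, w) + cscale s (0, 1) = (\<zeta>, s + w)" for s
    by (simp add: cscale_def vec_eq_iff add.commute)
  ultimately have "((\<lambda>s. transform n f (\<zeta>, s + w)) has_field_derivative transform (Suc n) f (\<zeta>, w)) (at 0)"
    by (simp add: D(3))
  thus ?thesis using DERIV_shift[of "\<lambda>w. transform n f (\<zeta>, w)" _ 0 w] by simp
qed

lemma open_slice: "open {w. (\<zeta>, w) \<in> siegelU}"
  unfolding fst_snd_in_siegelU by (intro open_Collect_less continuous_intros)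

lemma dlast_transform:
  assumes f: "f \<in> L2 mu" and z: "z \<in> siegelU"
  shows "dlast n (\<lambda>z. c * transform 0 f z) z = c * transform n f z"
  using z
proof (induction n arbitrary: z)
  case (Suc n)
  have "((\<lambda>w. c * transform n f (fst z, w)) has_field_derivative c * transform (Suc n) f z) (at (snd z))"
    using DERIV_cmult[OF transform_deriv_last[OF f, of "fst z" "snd z" n], of c] Suc.prems by simp
  hence "((\<lambda>w. dlast n (\<lambda>z. c * transform 0 f z) (fst z, w)) has_field_derivative c * transform (Suc n) f z) (at (snd z))"
    by (rule has_field_derivative_transform_within_open[OF _ open_slice[of "fst z"]]) (use Suc in auto)
  thus ?case by (simp add: dlast_Suc DERIV_imp_deriv)
qed simp

section \<open>Injectivity\<close>

text \<open>Positive and negative part have the same Fourier transform, in particular (at u = 0) the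
  same mass m. Divided by m they are probability densities with equal characteristic functions, and
  Levy's uniqueness theorem applies.\<close>

lemma fourier_real_L1_injective:
  fixes g :: "real \<Rightarrow> real"
  assumes g: "integrable lborel g" and z: "\<And>u. (\<integral>l. exp (\<i> * of_real (u * l)) * of_real (g l) \<partial>lborel) = 0"
  shows "AE l in lborel. g l = 0"
proof -
  define gp where "gp l = max 0 (g l)" for l
  define gm where "gm l = max 0 (- g l)" for l
  have i: "integrable lborel gp" "integrable lborel gm" using g by (auto simp: gp_def[abs_def] gm_def[abs_def])
  have nn: "gp l \<ge> 0" "gm l \<ge> 0" for l by (auto simp: gp_def gm_def)
  have gd: "g l = gp l - gm l" for l by (auto simp: gp_def gm_def max_def)
  note [measurable] = borel_measurable_integrable[OF i(1)] borel_measurable_integrable[OF i(2)]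
  have ie: "integrable lborel (\<lambda>l. exp (\<i> * of_real (u * l)) * complex_of_real (h l))" if "integrable lborel h" for h :: "real \<Rightarrow> real" and u
  proof (rule Bochner_Integration.integrable_bound[OF that])
    show "(\<lambda>l. exp (\<i> * of_real (u * l)) * complex_of_real (h l)) \<in> borel_measurable lborel"
      using borel_measurable_integrable[OF that] by measurable
  qed (simp add: norm_mult)
  have eq: "(\<integral>l. exp (\<i> * of_real (u * l)) * of_real (gp l) \<partial>lborel) = (\<integral>l. exp (\<i> * of_real (u * l)) * complex_of_real (gm l) \<partial>lborel)" for u
    using z[of u] ie[OF i(1), of u] ie[OF i(2), of u] by (simp add: gd right_diff_distrib)
  define m where "m = integral\<^sup>L lborel gp"
  have m: "m = integral\<^sup>L lborel gm"
    using eq[of 0] by (simp add: m_def integral_complex_of_real)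
  show ?thesis
  proof (cases "m = 0")
    case True
    have "AE l in lborel. gp l = 0" "AE l in lborel. gm l = 0"
      using integral_nonneg_eq_0_iff_AE[OF i(1)] integral_nonneg_eq_0_iff_AE[OF i(2)] nn m m_def True by auto
    thus ?thesis by eventually_elim (simp add: gd)
  next
    case False
    hence m0: "m > 0" using nn m_def integral_nonneg_AE[OF AE_I2, of lborel gp] by fastforce
    have rd: "real_distribution (density lborel (\<lambda>l. ennreal (h l / m)))"
      if h: "integrable lborel h" "integral\<^sup>L lborel h = m" "\<And>l. h l \<ge> 0" for h
    proof -
      have [measurable]: "h \<in> borel_measurable borel" using borel_measurable_integrable[OF h(1)] by simp
      have "(\<integral>\<^sup>+l. ennreal (h l / m) \<partial>lborel) = ennreal (\<integral>l. h l / m \<partial>lborel)"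
        using h m0 by (intro nn_integral_eq_integral) auto
      hence "(\<integral>\<^sup>+l. ennreal (h l / m) \<partial>lborel) = 1" using h m0 by simp
      hence "prob_space (density lborel (\<lambda>l. ennreal (h l / m)))"
        by (intro prob_spaceI) (simp add: emeasure_density)
      thus ?thesis by (simp add: real_distribution_def real_distribution_axioms_def)
    qed
    have ch: "char (density lborel (\<lambda>l. ennreal (h l / m))) u = (\<integral>l. exp (\<i> * of_real (u * l)) * complex_of_real (h l) \<partial>lborel) / of_real m"
      if h: "integrable lborel h" "\<And>l. h l \<ge> 0" for h u
    proof -
      have [measurable]: "h \<in> borel_measurable borel" using borel_measurable_integrable[OF h(1)] by simp
      have "char (density lborel (\<lambda>l. ennreal (h l / m))) u = (\<integral>l. (h l / m) *\<^sub>R iexp (u * l) \<partial>lborel)"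
        unfolding char_def by (rule integral_density) (use h m0 in auto)
      also have "\<dots> = (\<integral>l. exp (\<i> * of_real (u * l)) * complex_of_real (h l) / of_real m \<partial>lborel)"
        by (intro Bochner_Integration.integral_cong refl) (simp add: scaleR_conv_of_real mult_ac)
      finally show ?thesis by simp
    qed
    have "density lborel (\<lambda>l. ennreal (gp l / m)) = density lborel (\<lambda>l. ennreal (gm l / m))"
      by (rule Levy_uniqueness) (use rd i nn m m_def ch eq in \<open>auto simp: fun_eq_iff\<close>)
    hence "AE l in lborel. ennreal (gp l / m) = ennreal (gm l / m)"
      by (intro sigma_finite_measure.density_unique[OF sigma_finite_lborel]) auto
    thus ?thesis
    proof eventually_elim
      case (elim l)
      hence "gp l / m = gm l / m" using nn m0 by (subst (asm) ennreal_inj) auto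
      thus ?case using m0 by (simp add: gd)
    qed
  qed
qed

text \<open>The transform of \<open>cnj h\<close> at u is the conjugate of that of h at -u, so it
  vanishes too; this separates real and imaginary part.\<close>

lemma fourier_L1_injective:
  fixes h :: "real \<Rightarrow> complex"
  assumes h: "integrable lborel h" and z: "\<And>u. (\<integral>l. exp (\<i> * of_real (u * l)) * h l \<partial>lborel) = 0"
  shows "AE l in lborel. h l = 0"
proof -
  have [measurable]: "h \<in> borel_measurable borel" using borel_measurable_integrable[OF h] by simp
  have i1: "integrable lborel (\<lambda>l. exp (\<i> * of_real (u * l)) * h l)" for u
    by (rule Bochner_Integration.integrable_bound[OF h]) (auto simp: norm_mult)
  have i2: "integrable lborel (\<lambda>l. exp (\<i> * of_real (u * l)) * cnj (h l))" for u
    by (rule Bochner_Integration.integrable_bound[OF h]) (auto simp: norm_mult)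
  have z2: "(\<integral>l. exp (\<i> * of_real (u * l)) * cnj (h l) \<partial>lborel) = 0" for u
  proof -
    have "(\<integral>l. exp (\<i> * of_real (u * l)) * cnj (h l) \<partial>lborel) = (\<integral>l. cnj (exp (\<i> * of_real ((- u) * l)) * h l) \<partial>lborel)"
      by (intro Bochner_Integration.integral_cong refl) (simp add: exp_cnj)
    also have "\<dots> = cnj (\<integral>l. exp (\<i> * of_real ((- u) * l)) * h l \<partial>lborel)" by (rule Bochner_Integration.integral_cnj)
    finally show ?thesis by (simp only: z) simp
  qed
  have "AE l in lborel. Re (h l) = 0"
  proof (rule fourier_real_L1_injective)
    fix u
    have e: "exp (\<i> * of_real (u * l)) * of_real (Re (h l)) = (exp (\<i> * of_real (u * l)) * h l + exp (\<i> * of_real (u * l)) * cnj (h l)) / 2" for l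
      by (simp add: distrib_left[symmetric] complex_add_cnj)
    show "(\<integral>l. exp (\<i> * of_real (u * l)) * of_real (Re (h l)) \<partial>lborel) = 0"
      unfolding e using i1[of u] i2[of u] z[of u] z2[of u] by simp
  qed (use h in auto)
  moreover have "AE l in lborel. Im (h l) = 0"
  proof (rule fourier_real_L1_injective)
    fix u
    have e: "exp (\<i> * of_real (u * l)) * of_real (Im (h l)) = (exp (\<i> * of_real (u * l)) * h l - exp (\<i> * of_real (u * l)) * cnj (h l)) / (2 * \<i>)" for l
      by (simp only: right_diff_distrib[symmetric] complex_diff_cnj) (simp add: field_simps)
    show "(\<integral>l. exp (\<i> * of_real (u * l)) * of_real (Im (h l)) \<partial>lborel) = 0"
      unfolding e using i1[of u] i2[of u] z[of u] z2[of u] by simp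
  qed (use h in auto)
  ultimately show ?thesis by eventually_elim (simp add: complex_eq_iff)
qed

lemma integral_unit_circle_powers:
  "(\<integral>x. unit_circle x ^ a * cnj (unit_circle x) ^ b \<partial>unit_interval) = (if a = b then 1 else 0)"
proof -
  have uc: "unit_circle x * cnj (unit_circle x) = 1" for x
    by (simp add: complex_norm_square[symmetric])
  have *: "(\<integral>x. unit_circle x ^ k \<partial>unit_interval) = 0 ^ k" for k
    using circle_mean_value[of "\<lambda>s. s ^ k" UNIV 0 1] by (simp add: holomorphic_intros)
  show ?thesis
  proof (cases "b \<le> a")
    case True
    have "unit_circle x ^ a * cnj (unit_circle x) ^ b = unit_circle x ^ (a - b)" for x
    proof -
      have "unit_circle x ^ a = unit_circle x ^ (a - b) * unit_circle x ^ b"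
        using True by (simp add: power_add[symmetric])
      thus ?thesis by (simp only: mult.assoc power_mult_distrib[symmetric] uc) simp
    qed
    thus ?thesis using True by (simp add: *)
  next
    case False
    have "unit_circle x ^ a * cnj (unit_circle x) ^ b = cnj (unit_circle x ^ (b - a))" for x
    proof -
      have "cnj (unit_circle x) ^ b = cnj (unit_circle x) ^ (b - a) * cnj (unit_circle x) ^ a"
        using False by (simp add: power_add[symmetric])
      thus ?thesis using uc[of x] by (simp add: power_mult_distrib[symmetric] mult_ac)
    qed
    thus ?thesis using False * by (simp add: Bochner_Integration.integral_cnj del: complex_cnj_power)
  qed
qed

theorem transform_injective:
  fixes f :: "('n::finite \<Rightarrow> nat) \<times> real \<Rightarrow> complex"
  assumes f: "f \<in> L2 mu" and zero: "\<And>z. z \<in> siegelU \<Longrightarrow> transform n f z = 0"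
  shows "AE x in mu. f x = 0"
proof -
  interpret B: pair_sigma_finite "count_space (UNIV :: ('n \<Rightarrow> nat) set)" "lborel :: real measure" by (rule pair_sigma_finite_base)
  have fm [measurable]: "f \<in> borel_measurable base_meas" using L2D(1)[OF f] by (simp add: measurable_mu_iff)
  \<comment> \<open>With all moduli equal to s the squared norm is
    \<open>d * s^2 = 1/d \<le> 1\<close>, so all these points, taken at height 1, lie in the
    domain.\<close>
  define s where "s = 1 / real CARD('n)"
  define z where "z \<theta> u = ((\<chi> i. of_real s * unit_circle (\<theta> i)) :: complex ^ 'n, complex_of_real u + \<i>)" for \<theta> u
  define z0 where "z0 u = ((\<chi> i. of_real s) :: complex ^ 'n, complex_of_real u + \<i>)" for u
  have s0: "s > 0" by (simp add: s_def)
  have card_s: "real CARD('n) * s\<^sup>2 \<le> 1"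
    by (simp add: s_def power2_eq_square field_simps)
  have zU: "z \<theta> u \<in> siegelU" for \<theta> u
  proof -
    have "(norm (fst (z \<theta> u)))\<^sup>2 = real CARD('n) * s\<^sup>2"
      using s0 by (simp add: z_def norm_vec_def L2_set_def norm_mult sum_nonneg)
    thus ?thesis using card_s by (simp add: siegelU_def rho_def z_def)
  qed
  have z0U: "z0 u \<in> siegelU" for u
  proof -
    have "(norm (fst (z0 u)))\<^sup>2 = real CARD('n) * s\<^sup>2"
      using s0 by (simp add: z0_def norm_vec_def L2_set_def norm_mult sum_nonneg)
    thus ?thesis using card_s by (simp add: siegelU_def rho_def z0_def)
  qed
  have fk: "fourier_kernel n (z \<theta> u) x = fourier_kernel n (z0 u) x * (\<Prod>i\<in>UNIV. unit_circle (\<theta> i) ^ fst x i)" for \<theta> u x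
    by (simp add: fourier_kernel_def z_def z0_def mpow_def power_mult_distrib prod.distrib)
  have slice0: "(\<integral>l. fourier_kernel n (z0 u) (\<beta>, l) * f (\<beta>, l) \<partial>lborel) = 0" for u \<beta>
  proof -
    define h where "h x = fourier_kernel n (z0 u) x * f x" for x
    have hm [measurable]: "h \<in> borel_measurable base_meas" unfolding h_def[abs_def] by measurable
    have hint: "integrable base_meas h" unfolding h_def[abs_def] by (rule transform_integrable[OF f z0U])
    \<comment> \<open>The torus as a product of d copies of the unit interval. Integrating the
      transform against the conjugate character with exponents \<beta> keeps only the multi-index
      \<beta>.\<close>
    define Q where "Q = Pi\<^sub>M (UNIV :: 'n set) (\<lambda>_. unit_interval)"
    interpret U: prob_space unit_interval by standard (simp add: emeasure_unit_interval)
    interpret QP: product_prob_space "\<lambda>_::'n. unit_interval" "UNIV :: 'n set" ..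
    interpret Q: prob_space Q unfolding Q_def by (rule prob_space_PiM) unfold_locales
    interpret base: sigma_finite_measure "base_meas :: (('n \<Rightarrow> nat) \<times> real) measure"
      unfolding base_meas_def by unfold_locales
    interpret BQ: pair_sigma_finite "base_meas :: (('n \<Rightarrow> nat) \<times> real) measure" Q ..
    define P where "P \<alpha> \<theta> = (\<Prod>i\<in>UNIV. unit_circle (\<theta> i) ^ \<alpha> i * cnj (unit_circle (\<theta> i)) ^ \<beta> i)" for \<alpha> :: "'n \<Rightarrow> nat" and \<theta>
    have comp: "(\<lambda>\<theta>. unit_circle (\<theta> i)) \<in> borel_measurable Q" for i
    proof -
      have "(\<lambda>\<theta>. \<theta> i) \<in> measurable Q unit_interval" unfolding Q_def by (rule measurable_component_singleton) simp
      from measurable_compose[OF this measurable_unit_interval[OF borel_measurable_unit_circle]] show ?thesis .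
    qed
    have Pm: "P \<alpha> \<in> borel_measurable Q" for \<alpha>
      unfolding P_def using comp by measurable
    have Pnorm: "cmod (P \<alpha> \<theta>) = 1" for \<alpha> \<theta>
      by (simp add: P_def prod_norm[symmetric] norm_mult norm_power)
    have Pint: "integrable Q (P \<alpha>)" for \<alpha>
      by (rule Q.integrable_const_bound[of _ 1]) (auto simp: Pnorm Pm)
    have Pval: "(\<integral>\<theta>. P \<alpha> \<theta> \<partial>Q) = (if \<alpha> = \<beta> then 1 else 0)" for \<alpha>
    proof -
      have "(\<integral>\<theta>. P \<alpha> \<theta> \<partial>Q) = (\<Prod>i\<in>UNIV. \<integral>x. unit_circle x ^ \<alpha> i * cnj (unit_circle x) ^ \<beta> i \<partial>unit_interval)"
        unfolding P_def Q_def
        by (rule QP.product_integral_prod) (auto intro!: integrable_unit_interval continuous_intros)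
      also have "\<dots> = (if \<alpha> = \<beta> then 1 else 0)"
        by (auto simp: integral_unit_circle_powers fun_eq_iff)
      finally show ?thesis .
    qed
    have jm: "(\<lambda>(x, \<theta>). h x * P (fst x) \<theta>) \<in> borel_measurable (base_meas \<Otimes>\<^sub>M Q)"
    proof -
      have f1: "(\<lambda>p. fst (fst p)) \<in> measurable (base_meas \<Otimes>\<^sub>M Q) (count_space (UNIV :: ('n \<Rightarrow> nat) set))"
        unfolding base_meas_def by measurable
      have "(\<lambda>p. P \<alpha> (snd p)) \<in> borel_measurable (base_meas \<Otimes>\<^sub>M Q)" for \<alpha>
        using measurable_compose[OF measurable_snd Pm] .
      from measurable_compose_countable[OF this f1]
      have [measurable]: "(\<lambda>p. P (fst (fst p)) (snd p)) \<in> borel_measurable (base_meas \<Otimes>\<^sub>M Q)" .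
      have [measurable]: "(\<lambda>p. h (fst p)) \<in> borel_measurable (base_meas \<Otimes>\<^sub>M Q)"
        using measurable_compose[OF measurable_fst hm] .
      show ?thesis unfolding case_prod_unfold by measurable
    qed
    have jint: "integrable (base_meas \<Otimes>\<^sub>M Q) (\<lambda>(x, \<theta>). h x * P (fst x) \<theta>)"
      by (rule BQ.Fubini_integrable[OF jm])
         (use hint Pint in \<open>auto simp: norm_mult Pnorm Q.prob_space\<close>)
    have "0 = (\<integral>\<theta>. transform n f (z \<theta> u) * (\<Prod>i\<in>UNIV. cnj (unit_circle (\<theta> i)) ^ \<beta> i) \<partial>Q)"
      by (simp add: zero[OF zU])
    also have "\<dots> = (\<integral>\<theta>. \<integral>x. h x * P (fst x) \<theta> \<partial>base_meas \<partial>Q)"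
    proof (rule Bochner_Integration.integral_cong[OF refl])
      fix \<theta>
      have "transform n f (z \<theta> u) * (\<Prod>i\<in>UNIV. cnj (unit_circle (\<theta> i)) ^ \<beta> i)
        = (\<integral>x. (fourier_kernel n (z \<theta> u) x * f x) * (\<Prod>i\<in>UNIV. cnj (unit_circle (\<theta> i)) ^ \<beta> i) \<partial>base_meas)"
        unfolding transform_def by (rule integral_mult_left_zero[symmetric])
      thus "transform n f (z \<theta> u) * (\<Prod>i\<in>UNIV. cnj (unit_circle (\<theta> i)) ^ \<beta> i) = (\<integral>x. h x * P (fst x) \<theta> \<partial>base_meas)"
        by (simp add: fk h_def P_def prod.distrib mult_ac)
    qed
    also have "\<dots> = (\<integral>x. \<integral>\<theta>. h x * P (fst x) \<theta> \<partial>Q \<partial>base_meas)"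
      by (rule BQ.Fubini_integral[OF jint])
    also have "\<dots> = (\<integral>x. indicator {\<beta>} (fst x) *\<^sub>R h x \<partial>base_meas)"
      by (intro Bochner_Integration.integral_cong refl) (simp add: Pval indicator_def)
    also have "\<dots> = (\<integral>\<alpha>. \<integral>l. indicator {\<beta>} \<alpha> *\<^sub>R h (\<alpha>, l) \<partial>lborel \<partial>count_space UNIV)"
    proof -
      have "integrable base_meas (\<lambda>x. indicator {\<beta>} (fst x) *\<^sub>R h x)"
      proof (rule Bochner_Integration.integrable_bound[OF hint])
        have [measurable]: "(\<lambda>x. indicator {\<beta>} (fst x) :: real) \<in> borel_measurable base_meas"
          by (rule measurable_base_measI) simp
        show "(\<lambda>x. indicator {\<beta>} (fst x) *\<^sub>R h x) \<in> borel_measurable base_meas" by measurable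
      qed (auto simp: indicator_def)
      thus ?thesis using B.integral_fst[of "\<lambda>\<alpha> l. indicator {\<beta>} \<alpha> *\<^sub>R h (\<alpha>, l)"]
        by (simp add: base_meas_def case_prod_unfold)
    qed
    also have "\<dots> = (\<integral>\<alpha>. indicator {\<beta>} \<alpha> *\<^sub>R (\<integral>l. h (\<beta>, l) \<partial>lborel) \<partial>count_space UNIV)"
      by (intro Bochner_Integration.integral_cong refl) (auto simp: indicator_def)
    also have "\<dots> = (\<integral>l. h (\<beta>, l) \<partial>lborel)"
      by (subst integral_scaleR_left) (auto simp: measure_count_space)
    finally show ?thesis by (simp add: h_def)
  qed
  have slice_int: "integrable lborel (\<lambda>l. fourier_kernel n (z0 0) (\<beta>, l) * f (\<beta>, l))" for \<beta>
  proof -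
    have "integrable (count_space UNIV \<Otimes>\<^sub>M lborel) (\<lambda>(\<alpha>, l). fourier_kernel n (z0 0) (\<alpha>, l) * f (\<alpha>, l))"
      using transform_integrable[OF f z0U] by (simp add: base_meas_def case_prod_unfold)
    from B.AE_integrable_fst[OF this] show ?thesis by (simp add: AE_count_space)
  qed
  have AEslice: "AE l in lborel. l < 0 \<longrightarrow> f (\<beta>, l) = 0" for \<beta>
  proof -
    have "AE l in lborel. fourier_kernel n (z0 0) (\<beta>, l) * f (\<beta>, l) = 0"
    proof (rule fourier_L1_injective[OF slice_int])
      fix u
      \<comment> \<open>A real shift of the last coordinate by -u multiplies the kernel by
        \<open>exp (\<i> * u * l)\<close>. Vanishing at all u therefore says that the Fourier
        transform of the slice at u = 0 vanishes.\<close>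
      have e: "exp (\<i> * of_real (u * l)) * (fourier_kernel n (z0 0) (\<beta>, l) * f (\<beta>, l)) = fourier_kernel n (z0 (- u)) (\<beta>, l) * f (\<beta>, l)" for l
      proof -
        have "exp (\<i> * of_real (u * l)) * exp (- \<i> * of_real l * \<i>) = exp (- \<i> * of_real l * (of_real (- u) + \<i>))"
          by (simp add: mult_exp_exp algebra_simps)
        thus ?thesis by (simp add: fourier_kernel_def z0_def mult_ac)
      qed
      show "(\<integral>l. exp (\<i> * of_real (u * l)) * (fourier_kernel n (z0 0) (\<beta>, l) * f (\<beta>, l)) \<partial>lborel) = 0"
        unfolding e by (rule slice0)
    qed
    thus ?thesis
    proof eventually_elim
      case (elim l)
      have "mpow (\<chi> i. complex_of_real s) \<beta> \<noteq> 0" using s0 by (simp add: mpow_def)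
      thus ?case using elim by (auto simp: fourier_kernel_def z0_def)
    qed
  qed
  have "AE x in count_space UNIV \<Otimes>\<^sub>M lborel. snd x < 0 \<longrightarrow> f x = 0"
  proof (rule B.AE_pair_measure)
    have "{x \<in> space base_meas. snd x < 0 \<longrightarrow> f x = 0} \<in> sets base_meas"
    proof -
      have [measurable]: "snd \<in> borel_measurable (base_meas :: (('n \<Rightarrow> nat) \<times> real) measure)"
        by (rule measurable_base_measI) simp
      show ?thesis by measurable
    qed
    thus "{x \<in> space (count_space UNIV \<Otimes>\<^sub>M lborel). snd x < 0 \<longrightarrow> f x = 0} \<in> sets (count_space UNIV \<Otimes>\<^sub>M lborel)"
      unfolding base_meas_def .
    show "AE x in count_space UNIV. AE y in lborel. snd (x, y) < 0 \<longrightarrow> f (x, y) = 0"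
      using AEslice by (simp add: AE_count_space)
  qed
  hence "AE x in base_meas. snd x < 0 \<longrightarrow> f x = 0" unfolding base_meas_def .
  hence "AE x in base_meas. 0 < ennreal (mu_weight x) \<longrightarrow> f x = 0"
    by eventually_elim (metis mu_weight_def ennreal_0 less_irrefl)
  thus ?thesis unfolding mu_eq by (subst AE_density) simp_all
qed

section \<open>Isometry and surjectivity\<close>

text \<open>The underlying space is the domain itself, so pointwise statements over the space
  concern only points where holomorphic functions and transforms are controlled.\<close>

definition siegel_measure :: "nat \<Rightarrow> ((complex ^ 'n::finite) \<times> complex) measure" where
  "siegel_measure \<beta> = density (restrict_space lborel siegelU) (\<lambda>z. ennreal (rho z ^ \<beta>))"

lemma space_siegel_measure [simp]: "space (siegel_measure \<beta>) = siegelU"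
  by (simp add: siegel_measure_def space_restrict_space)

lemma siegelU_borel [measurable]: "siegelU \<in> sets borel"
  by (simp add: open_siegelU)

lemma measurable_siegel_measureI:
  assumes "continuous_on siegelU G" shows "G \<in> borel_measurable (siegel_measure \<beta>)"
proof -
  have "G \<in> borel_measurable (restrict_space borel siegelU)"
    using assms by (rule borel_measurable_continuous_on_restrict)
  moreover have "sets (siegel_measure \<beta> :: ((complex ^ 'a) \<times> complex) measure) = sets (restrict_space borel siegelU)"
    by (simp add: siegel_measure_def sets_restrict_space)
  ultimately show ?thesis by (simp cong: measurable_cong_sets)
qed

lemma rho_measurable_restrict: "rho \<in> borel_measurable (restrict_space lborel siegelU)"
proof -
  have "rho \<in> borel_measurable borel" by (intro borel_measurable_continuous_onI continuous_intros)
  thus ?thesis by (intro measurable_restrict_space1) simp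
qed

lemma nn_integral_siegel_measure:
  assumes f: "continuous_on siegelU f"
  shows "(\<integral>\<^sup>+z. ennreal (f z) \<partial>siegel_measure \<beta>) = (\<integral>\<^sup>+z. ennreal (siegel_weight \<beta> z * f z) \<partial>lborel)"
proof -
  note [measurable] = rho_measurable_restrict
  have "f \<in> borel_measurable (restrict_space lborel siegelU)"
    using borel_measurable_continuous_on_restrict[OF f]
    by (simp add: measurable_cong_sets[OF sets_restrict_space_cong[OF sets_lborel]])
  hence "(\<integral>\<^sup>+z. ennreal (f z) \<partial>siegel_measure \<beta>) = (\<integral>\<^sup>+z. ennreal (rho z ^ \<beta>) * ennreal (f z) \<partial>restrict_space lborel siegelU)"
    unfolding siegel_measure_def by (subst nn_integral_density) auto
  also have "\<dots> = (\<integral>\<^sup>+z. ennreal (rho z ^ \<beta>) * ennreal (f z) * indicator siegelU z \<partial>lborel)"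
    by (rule nn_integral_restrict_space) simp
  also have "\<dots> = (\<integral>\<^sup>+z. ennreal (siegel_weight \<beta> z * f z) \<partial>lborel)"
    by (intro nn_integral_cong) (auto simp: fiber_weight_eq indicator_def siegelU_def ennreal_mult')
  finally show ?thesis .
qed

lemma integral_siegel_measure:
  fixes f :: "(complex ^ 'n::finite) \<times> complex \<Rightarrow> complex"
  assumes f: "continuous_on siegelU f"
  shows "(\<integral>z. f z \<partial>siegel_measure \<beta>) = (\<integral>z. siegel_weight \<beta> z *\<^sub>R f z \<partial>lborel)"
proof -
  note [measurable] = rho_measurable_restrict
  have "f \<in> borel_measurable (restrict_space lborel siegelU)"
    using borel_measurable_continuous_on_restrict[OF f]
    by (simp add: measurable_cong_sets[OF sets_restrict_space_cong[OF sets_lborel]])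
  hence "(\<integral>z. f z \<partial>siegel_measure \<beta>) = (\<integral>z. rho z ^ \<beta> *\<^sub>R f z \<partial>restrict_space lborel siegelU)"
    unfolding siegel_measure_def
  proof (rule integral_density)
    show "(\<lambda>z. rho z ^ \<beta>) \<in> borel_measurable (restrict_space lborel siegelU)" by measurable
    show "AE z in restrict_space lborel siegelU. 0 \<le> rho z ^ \<beta>"
      by (rule AE_I2) (simp add: space_restrict_space siegelU_def)
  qed
  also have "\<dots> = (\<integral>z. siegel_weight \<beta> z *\<^sub>R f z \<partial>lborel)"
    by (subst integral_restrict_space) (simp_all add: fiber_weight_eq)
  finally show ?thesis .
qed

lemma normsq_cong: "(\<And>x. x \<in> space M \<Longrightarrow> f x = g x) \<Longrightarrow> normsq M f = normsq M g"
  unfolding normsq_def by (intro Bochner_Integration.integral_cong) auto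

lemma ip_cong:
  "(\<And>x. x \<in> space M \<Longrightarrow> f x = f' x) \<Longrightarrow> (\<And>x. x \<in> space M \<Longrightarrow> g x = g' x) \<Longrightarrow> ip M f g = ip M f' g'"
  unfolding ip_def by (intro Bochner_Integration.integral_cong) auto

lemma L2_cong: "(\<And>x. x \<in> space M \<Longrightarrow> f x = g x) \<Longrightarrow> f \<in> L2 M \<longleftrightarrow> g \<in> L2 M"
  unfolding L2_def by (simp cong: measurable_cong Bochner_Integration.integrable_cong)

lemma cnj_ip: "cnj (ip M f g) = ip M g f"
  unfolding ip_def by (subst Bochner_Integration.integral_cnj[symmetric]) (simp add: mult.commute)

lemma L2_cnj: "f \<in> L2 M \<Longrightarrow> (\<lambda>x. cnj (f x)) \<in> L2 M"
  using borel_measurable_cnj[of f M] by (simp add: L2_def)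

lemma ip_self: "ip M f f = of_real (normsq M f)"
  unfolding ip_def normsq_def
  by (subst integral_complex_of_real[symmetric]) (simp only: complex_norm_square)

lemma ip_add_left:
  assumes "f \<in> L2 M" "g \<in> L2 M" "h \<in> L2 M"
  shows "ip M (\<lambda>x. f x + g x) h = ip M f h + ip M g h"
  unfolding ip_def using L2_integrable_mult[OF assms(1,3)] L2_integrable_mult[OF assms(2,3)]
  by (simp add: distrib_right)

lemma ip_cmult_left: "ip M (\<lambda>x. c * f x) h = c * ip M f h"
  unfolding ip_def by (simp add: mult.assoc)

lemma normsq_add_le:
  assumes "f \<in> L2 M" "g \<in> L2 M"
  shows "normsq M (\<lambda>x. f x + g x) \<le> 2 * normsq M f + 2 * normsq M g"
  using normsq_parallelogram[OF assms] normsq_nonneg[of M "\<lambda>x. f x - g x"] by linarith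

lemma normsq_limit:
  assumes "\<And>n. F n \<in> L2 M" "f \<in> L2 M" "(\<lambda>n. normsq M (\<lambda>x. F n x - f x)) \<longlonglongrightarrow> 0"
  shows "(\<lambda>n. normsq M (F n)) \<longlonglongrightarrow> normsq M f"
  using normsq_tendsto[OF assms(1,2) _ assms(3), of "\<lambda>x. 0"]
  by (simp add: L2_def) (simp add: normsq_def)

lemma transform_add:
  assumes "f \<in> L2 mu" "g \<in> L2 mu" "z \<in> siegelU"
  shows "transform n (\<lambda>x. f x + g x) z = transform n f z + transform n g z"
  using transform_integrable[OF assms(1,3), of n] transform_integrable[OF assms(2,3), of n]
  by (simp add: transform_def distrib_left)

lemma transform_cmult: "transform n (\<lambda>x. c * f x) z = c * transform n f z"
  unfolding transform_def by (simp add: mult.left_commute)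

lemma transform_diff:
  assumes "f \<in> L2 mu" "g \<in> L2 mu" "z \<in> siegelU"
  shows "transform n (\<lambda>x. f x - g x) z = transform n f z - transform n g z"
  using transform_integrable[OF assms(1,3), of n] transform_integrable[OF assms(2,3), of n]
  by (simp add: transform_def right_diff_distrib)

lemma measurable_transform: "f \<in> L2 mu \<Longrightarrow> transform n f \<in> borel_measurable (siegel_measure \<beta>)"
  by (intro measurable_siegel_measureI holomorphic_several_continuous_on holomorphic_several_transform_fun)

lemma transform_L2_tendsto:
  assumes F: "\<And>k. F k \<in> L2 mu" and f: "f \<in> L2 mu" and lim: "(\<lambda>k. normsq mu (\<lambda>x. F k x - f x)) \<longlonglongrightarrow> 0"
    and z: "z \<in> siegelU"
  shows "(\<lambda>k. transform n (F k) z) \<longlonglongrightarrow> transform n f z"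
proof -
  define C where "C = fact (2 * n) / (2 * rho z) ^ Suc (2 * n)"
  have b: "norm (transform n (F k) z - transform n f z) \<le> sqrt (normsq mu (\<lambda>x. F k x - f x) * C)" for k
    using transform_bound[OF L2_diff[OF F f] z, of n k] unfolding C_def transform_diff[OF F f z]
    by (rule real_le_rsqrt)
  have l: "(\<lambda>k. sqrt (normsq mu (\<lambda>x. F k x - f x) * C)) \<longlonglongrightarrow> 0"
    using tendsto_real_sqrt[OF tendsto_mult_left_zero[OF lim, of C]] by simp
  have "(\<lambda>k. transform n (F k) z - transform n f z) \<longlonglongrightarrow> 0"
    by (rule Lim_null_comparison[OF always_eventually[OF allI[OF b]] l])
  thus ?thesis by (simp add: LIM_zero_iff)
qed

section \<open>Isometry onto the weighted Bergman space\<close>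

context
  fixes n \<beta> :: nat and T :: "(('n::finite \<Rightarrow> nat) \<times> real \<Rightarrow> complex) \<Rightarrow> (complex ^ 'n) \<times> complex \<Rightarrow> complex"
    and \<nu> :: "((complex ^ 'n) \<times> complex) measure" and c :: real
  assumes n\<beta>: "2 * n = \<beta> + CARD('n) + 1"
  defines "T \<equiv> transform n" and "\<nu> \<equiv> siegel_measure \<beta>"
    and "c \<equiv> fact (2 * n) * siegel_const \<beta> TYPE('n)"
begin

lemma transform_const_pos: "c > 0"
  using siegel_const_pos[of \<beta>, where 'n='n] by (simp add: c_def)

text \<open>By the Gram formula and the Hermitian symmetry of the kernel, the transform of the
  coherent state at z is the conjugate of \<open>fact (2 * n) * conj_kernel (2 * n) z\<close>.
  Pairing with it is therefore evaluation at z, times c.\<close>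

lemma reproducing_coherent:
  assumes z: "z \<in> siegelU"
  shows "T (coherent n z) \<in> L2 \<nu>"
    and "holomorphic_several G siegelU \<Longrightarrow> G \<in> L2 \<nu> \<Longrightarrow> ip \<nu> G (T (coherent n z)) = of_real c * G z"
proof -
  have Tc: "T (coherent n z) y = cnj (fact (2 * n) * conj_kernel (2 * n) z y)" if "y \<in> siegelU" for y
    using transform_coherent[OF that z, of n] by (simp add: T_def cnj_conj_kernel)
  have contT: "continuous_on siegelU (T (coherent n z))"
    unfolding T_def using coherent_L2(1)[OF z]
    by (intro holomorphic_several_continuous_on holomorphic_several_transform_fun)
  have contk: "continuous_on siegelU (conj_kernel (2 * n) z)"
  proof -
    have "continuous_on siegelU (\<lambda>y. cnj (T (coherent n z) y) / fact (2 * n))"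
      using contT by (intro continuous_intros) auto
    thus ?thesis by (rule continuous_on_cong[THEN iffD1, rotated -1]) (auto simp: Tc)
  qed
  have "(\<integral>\<^sup>+y. ennreal (siegel_weight \<beta> y * (cmod (conj_kernel (2 * n) z y))\<^sup>2) \<partial>lborel) < \<infinity>"
    \<comment> \<open>The finiteness statement does not involve G, so G = 0 is inserted.\<close>
    using siegel_reproducing(1)[OF holomorphic_several_const[of 0] _ z n\<beta>] by simp
  hence fin: "(\<integral>\<^sup>+y. ennreal ((cmod (conj_kernel (2 * n) z y))\<^sup>2) \<partial>\<nu>) < \<infinity>"
    unfolding \<nu>_def using contk by (subst nn_integral_siegel_measure) (auto intro!: continuous_intros)
  have kL2: "conj_kernel (2 * n) z \<in> L2 \<nu>"
    by (rule L2I_nn[OF _ fin]) (simp add: \<nu>_def measurable_siegel_measureI contk)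
  have "(\<lambda>y. cnj (fact (2 * n) * conj_kernel (2 * n) z y)) \<in> L2 \<nu>"
    by (intro L2_cnj L2_cmult kL2)
  thus "T (coherent n z) \<in> L2 \<nu>"
    by (rule L2_cong[THEN iffD2, rotated]) (simp add: Tc \<nu>_def)
  assume G: "holomorphic_several G siegelU" and GL: "G \<in> L2 \<nu>"
  have cG: "continuous_on siegelU G" by (rule holomorphic_several_continuous_on[OF G])
  have "(\<integral>\<^sup>+y. ennreal ((cmod (G y))\<^sup>2) \<partial>\<nu>) < \<infinity>" by (simp add: nn_integral_L2[OF GL])
  hence finG: "(\<integral>\<^sup>+y. ennreal (siegel_weight \<beta> y * (cmod (G y))\<^sup>2) \<partial>lborel) < \<infinity>"
    unfolding \<nu>_def using cG by (subst (asm) nn_integral_siegel_measure) (auto intro!: continuous_intros)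
  have "ip \<nu> G (T (coherent n z)) = (\<integral>y. fact (2 * n) * (G y * conj_kernel (2 * n) z y) \<partial>\<nu>)"
    unfolding ip_def by (intro Bochner_Integration.integral_cong) (auto simp: Tc \<nu>_def)
  also have "\<dots> = fact (2 * n) * (\<integral>y. G y * conj_kernel (2 * n) z y \<partial>\<nu>)" by (rule integral_mult_right_zero)
  also have "(\<integral>y. G y * conj_kernel (2 * n) z y \<partial>\<nu>) = of_real (siegel_const \<beta> TYPE('n)) * G z"
    unfolding \<nu>_def using siegel_reproducing(2)[OF G finG z n\<beta>] cG contk
    by (subst integral_siegel_measure) (auto intro!: continuous_intros)
  finally show "ip \<nu> G (T (coherent n z)) = of_real c * G z" by (simp add: c_def)
qed

text \<open>The reproducing formula gives the polarised isometry identity on a subspace containing all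
  coherent states; its orthogonal complement is killed by the transform, hence trivial.\<close>

lemma transform_isometry:
  assumes \<phi>: "\<phi> \<in> L2 mu"
  shows "T \<phi> \<in> L2 \<nu>" and "normsq \<nu> (T \<phi>) = c * normsq mu \<phi>"
proof -
  note sp = space_siegel_measure[of \<beta>, where 'a='n, folded \<nu>_def]
  \<comment> \<open>The identity is tested against every g with square-integrable transform, which
    is not yet known to mean every g. For fixed g both sides are linear in f, so V is a subspace;
    for f a coherent state at z both sides are c times the conjugate of
    \<open>T g z\<close>.\<close>
  define V where "V = {f \<in> L2 mu. T f \<in> L2 \<nu> \<and> (\<forall>g\<in>L2 mu. T g \<in> L2 \<nu> \<longrightarrow> ip \<nu> (T f) (T g) = of_real c * ip mu f g)}"
  have Tadd: "ip \<nu> (T (\<lambda>x. f x + g x)) h = ip \<nu> (\<lambda>z. T f z + T g z) h"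
     "T (\<lambda>x. f x + g x) \<in> L2 \<nu> \<longleftrightarrow> (\<lambda>z. T f z + T g z) \<in> L2 \<nu>" if "f \<in> L2 mu" "g \<in> L2 mu" for f g h
    using that by (auto intro!: ip_cong L2_cong simp: sp T_def transform_add)
  have V: "V \<subseteq> L2 mu" by (auto simp: V_def)
  have coh: "coherent n z \<in> V" if z: "z \<in> siegelU" for z
  proof -
    have "ip \<nu> (T (coherent n z)) (T g) = of_real c * ip mu (coherent n z) g" if g: "g \<in> L2 mu" "T g \<in> L2 \<nu>" for g
    proof -
      have "ip \<nu> (T g) (T (coherent n z)) = of_real c * T g z"
        using g by (intro reproducing_coherent(2)[OF z]) (auto simp: T_def holomorphic_several_transform_fun)
      also have "T g z = ip mu g (coherent n z)" using g by (simp add: T_def transform_eq_ip)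
      finally have "cnj (ip \<nu> (T g) (T (coherent n z))) = cnj (of_real c * ip mu g (coherent n z))" by simp
      thus ?thesis by (simp add: cnj_ip)
    qed
    thus ?thesis using coherent_L2(1)[OF z] reproducing_coherent(1)[OF z] by (simp add: V_def)
  qed
  have Vne: "V \<noteq> {}"
    using coh[of "(0, \<i>)"] by (auto simp: siegelU_def rho_def)
  have Vadd: "(\<lambda>x. f x + g x) \<in> V" if "f \<in> V" "g \<in> V" for f g
    using that by (auto simp: V_def Tadd L2_add ip_add_left distrib_left)
  have Vmult: "(\<lambda>x. a * f x) \<in> V" if "f \<in> V" for a f
  proof -
    have "T (\<lambda>x. a * f x) = (\<lambda>z. a * T f z)" by (simp add: T_def fun_eq_iff transform_cmult)
    thus ?thesis using that by (auto simp: V_def L2_cmult ip_cmult_left)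
  qed
  obtain P F where P: "P \<in> L2 mu" and F: "\<And>k::nat. F k \<in> V" and lim: "(\<lambda>k. normsq mu (\<lambda>x. F k x - P x)) \<longlonglongrightarrow> 0"
    and orth: "\<And>v. v \<in> V \<Longrightarrow> ip mu (\<lambda>x. \<phi> x - P x) v = 0"
    using L2_projection[OF V Vne Vadd Vmult \<phi>] by blast
  have "AE x in mu. \<phi> x - P x = 0"
  proof (rule transform_injective)
    show d: "(\<lambda>x. \<phi> x - P x) \<in> L2 mu" by (intro L2_diff \<phi> P)
    show "transform n (\<lambda>x. \<phi> x - P x) z = 0" if "z \<in> siegelU" for z
      using orth[OF coh[OF that]] by (simp add: transform_eq_ip[OF d])
  qed
  hence ae: "AE x in mu. P x = \<phi> x" by eventually_elim simp
  have FL: "F k \<in> L2 mu" for k using F V by auto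
  have lim': "(\<lambda>k. normsq mu (\<lambda>x. F k x - \<phi> x)) \<longlonglongrightarrow> 0"
  proof -
    have "normsq mu (\<lambda>x. F k x - P x) = normsq mu (\<lambda>x. F k x - \<phi> x)" for k
      unfolding normsq_def
      by (rule integral_cong_AE) (use ae L2D(1)[OF FL] L2D(1)[OF P] L2D(1)[OF \<phi>] in auto)
    thus ?thesis using lim by simp
  qed
  have iso: "normsq \<nu> (T f) = c * normsq mu f" if "f \<in> V" for f
  proof -
    have "complex_of_real (normsq \<nu> (T f)) = of_real (c * normsq mu f)"
      using that by (auto simp: V_def ip_self[symmetric])
    thus ?thesis by (simp only: of_real_eq_iff)
  qed
  have TL: "T (F k) \<in> L2 \<nu>" for k using F[of k] by (simp add: V_def)
  \<comment> \<open>Fatou's lemma as k tends to infinity in the isometry for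
    \<open>F k - F m\<close>. The margin e is there because the squared norms converge to the bound
    but need not lie below it.\<close>
  have key: "(\<lambda>z. T \<phi> z - T (F m) z) \<in> L2 \<nu> \<and> normsq \<nu> (\<lambda>z. T \<phi> z - T (F m) z) \<le> c * normsq mu (\<lambda>x. F m x - \<phi> x) + e"
    if e: "e > 0" for m e
  proof -
    have 1: "(\<lambda>z. T (F k) z - T (F m) z) \<in> L2 \<nu>" for k by (intro L2_diff TL)
    have 2: "(\<lambda>z. T \<phi> z - T (F m) z) \<in> borel_measurable \<nu>"
      unfolding T_def \<nu>_def by (intro borel_measurable_diff measurable_transform \<phi> FL)
    have 3: "AE z in \<nu>. (\<lambda>k. T (F k) z - T (F m) z) \<longlonglongrightarrow> T \<phi> z - T (F m) z"
      unfolding T_def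
      by (rule AE_I2) (intro tendsto_diff tendsto_const transform_L2_tendsto[OF FL \<phi> lim'], simp add: sp)
    have e1: "normsq \<nu> (\<lambda>z. T (F k) z - T (F m) z) = c * normsq mu (\<lambda>x. F m x - F k x)" for k
    proof -
      have d: "(\<lambda>x. F k x + (-1) * F m x) \<in> V" by (intro Vadd Vmult F)
      have "normsq \<nu> (\<lambda>z. T (F k) z - T (F m) z) = normsq \<nu> (T (\<lambda>x. F k x + (-1) * F m x))"
        by (rule normsq_cong) (simp add: sp T_def transform_diff FL)
      also have "\<dots> = c * normsq mu (\<lambda>x. F k x + (-1) * F m x)" by (rule iso[OF d])
      finally show ?thesis using normsq_diff_commute[of mu "F k" "F m"] by simp
    qed
    have "(\<lambda>k. c * normsq mu (\<lambda>x. F m x - F k x)) \<longlonglongrightarrow> c * normsq mu (\<lambda>x. F m x - \<phi> x)"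
      by (rule tendsto_mult[OF tendsto_const normsq_tendsto[OF FL \<phi> FL lim']])
    hence "\<forall>\<^sub>F k in sequentially. c * normsq mu (\<lambda>x. F m x - F k x) < c * normsq mu (\<lambda>x. F m x - \<phi> x) + e"
      by (rule order_tendstoD(2)) (use e in simp)
    hence 4: "\<forall>\<^sub>F k in sequentially. normsq \<nu> (\<lambda>z. T (F k) z - T (F m) z) \<le> c * normsq mu (\<lambda>x. F m x - \<phi> x) + e"
      by (auto simp: e1 elim: eventually_mono)
    show ?thesis using L2_Fatou[OF 1 2 3 4] by simp
  qed
  have "(\<lambda>z. (T \<phi> z - T (F 0) z) + T (F 0) z) \<in> L2 \<nu>" using key[of 1 0] TL by (intro L2_add) auto
  thus T\<phi>: "T \<phi> \<in> L2 \<nu>" by simp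
  have "normsq \<nu> (\<lambda>z. T \<phi> z - T (F m) z) \<le> c * normsq mu (\<lambda>x. F m x - \<phi> x)" for m
  proof (rule field_le_epsilon)
    fix e :: real assume "0 < e"
    from key[OF this, of m] show "normsq \<nu> (\<lambda>z. T \<phi> z - T (F m) z) \<le> c * normsq mu (\<lambda>x. F m x - \<phi> x) + e" by blast
  qed
  hence le: "normsq \<nu> (\<lambda>z. T (F m) z - T \<phi> z) \<le> c * normsq mu (\<lambda>x. F m x - \<phi> x)" for m
    by (subst normsq_diff_commute)
  have le': "norm (normsq \<nu> (\<lambda>z. T (F m) z - T \<phi> z)) \<le> c * normsq mu (\<lambda>x. F m x - \<phi> x)" for m
    using le[of m] by simp
  have "(\<lambda>m. normsq \<nu> (\<lambda>z. T (F m) z - T \<phi> z)) \<longlonglongrightarrow> 0"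
    by (rule Lim_null_comparison[OF always_eventually[OF allI[OF le']] tendsto_mult_right_zero[OF lim']])
  from normsq_limit[OF TL T\<phi> this]
  have "(\<lambda>m. normsq \<nu> (T (F m))) \<longlonglongrightarrow> normsq \<nu> (T \<phi>)" .
  moreover have "(\<lambda>m. normsq \<nu> (T (F m))) \<longlonglongrightarrow> c * normsq mu \<phi>"
    unfolding iso[OF F] by (rule tendsto_mult[OF tendsto_const normsq_limit[OF FL \<phi> lim']])
  ultimately show "normsq \<nu> (T \<phi>) = c * normsq mu \<phi>" by (rule LIMSEQ_unique)
qed

text \<open>By the isometry, preimages of a sequence approximating the projection P of G form a
  Cauchy sequence, with limit f. P is only determined almost everywhere and need not be holomorphic,
  so the reproducing formula is applied to G - T f; there G - P is orthogonal to the kernels and P -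
  T f has norm 0.\<close>

lemma transform_surjective:
  assumes G: "holomorphic_several G siegelU" and GL: "G \<in> L2 \<nu>"
  obtains f where "f \<in> L2 mu" "\<And>z. z \<in> siegelU \<Longrightarrow> T f z = G z"
proof -
  note sp = space_siegel_measure[of \<beta>, where 'a='n, folded \<nu>_def]
  define V where "V = {H \<in> L2 \<nu>. \<exists>f\<in>L2 mu. \<forall>z\<in>siegelU. H z = T f z}"
  have V: "V \<subseteq> L2 \<nu>" by (auto simp: V_def)
  have TV: "T f \<in> V" if "f \<in> L2 mu" for f using that transform_isometry(1) by (auto simp: V_def)
  have Vne: "V \<noteq> {}"
    using TV[of "\<lambda>_. 0"] by (auto simp: L2_def)
  have Vadd: "(\<lambda>x. H x + K x) \<in> V" if HK: "H \<in> V" "K \<in> V" for H K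
  proof -
    obtain f g where fg: "f \<in> L2 mu" "g \<in> L2 mu" "\<forall>z\<in>siegelU. H z = T f z" "\<forall>z\<in>siegelU. K z = T g z"
      using HK by (auto simp: V_def)
    hence "\<forall>z\<in>siegelU. H z + K z = T (\<lambda>x. f x + g x) z" by (simp add: T_def transform_add)
    moreover have "(\<lambda>x. H x + K x) \<in> L2 \<nu>" using HK by (intro L2_add) (auto simp: V_def)
    moreover have "(\<lambda>x. f x + g x) \<in> L2 mu" by (intro L2_add fg)
    ultimately show ?thesis unfolding V_def by blast
  qed
  have Vmult: "(\<lambda>x. a * H x) \<in> V" if H: "H \<in> V" for a H
  proof -
    obtain f where f: "f \<in> L2 mu" "\<forall>z\<in>siegelU. H z = T f z" using H by (auto simp: V_def)
    hence "\<forall>z\<in>siegelU. a * H z = T (\<lambda>x. a * f x) z" by (simp add: T_def transform_cmult)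
    moreover have "(\<lambda>x. a * H x) \<in> L2 \<nu>" using H by (intro L2_cmult) (auto simp: V_def)
    moreover have "(\<lambda>x. a * f x) \<in> L2 mu" by (intro L2_cmult f)
    ultimately show ?thesis unfolding V_def by blast
  qed
  obtain P H where P: "P \<in> L2 \<nu>" and H: "\<And>k::nat. H k \<in> V" and lim: "(\<lambda>k. normsq \<nu> (\<lambda>x. H k x - P x)) \<longlonglongrightarrow> 0"
    and orth: "\<And>v. v \<in> V \<Longrightarrow> ip \<nu> (\<lambda>x. G x - P x) v = 0"
    using L2_projection[OF V Vne Vadd Vmult GL] by blast
  have HL: "H k \<in> L2 \<nu>" for k using H V by auto
  have "\<exists>f\<in>L2 mu. \<forall>z\<in>siegelU. H k z = T f z" for k using H[of k] by (simp add: V_def)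
  then obtain F where FL: "\<And>k. F k \<in> L2 mu" and HF: "\<And>k z. z \<in> siegelU \<Longrightarrow> H k z = T (F k) z" by metis
  have dist: "normsq \<nu> (\<lambda>z. H k z - T f z) = c * normsq mu (\<lambda>x. F k x - f x)" if f: "f \<in> L2 mu" for k f
  proof -
    have "normsq \<nu> (\<lambda>z. H k z - T f z) = normsq \<nu> (T (\<lambda>x. F k x - f x))"
      by (rule normsq_cong) (simp add: sp HF T_def transform_diff FL f)
    also have "\<dots> = c * normsq mu (\<lambda>x. F k x - f x)" by (rule transform_isometry(2)[OF L2_diff[OF FL f]])
    finally show ?thesis .
  qed
  have c0: "c > 0" by (rule transform_const_pos)
  have Cauchy: "\<exists>N. \<forall>m\<ge>N. \<forall>k\<ge>N. normsq mu (\<lambda>x. F m x - F k x) < e" if e: "e > 0" for e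
  proof -
    have "\<forall>\<^sub>F k in sequentially. normsq \<nu> (\<lambda>x. H k x - P x) < c * e / 4"
      by (rule order_tendstoD(2)[OF lim]) (use e c0 in simp)
    then obtain N where N: "\<And>k. k \<ge> N \<Longrightarrow> normsq \<nu> (\<lambda>x. H k x - P x) < c * e / 4"
      by (auto simp: eventually_sequentially)
    have "normsq mu (\<lambda>x. F m x - F k x) < e" if mk: "m \<ge> N" "k \<ge> N" for m k
    proof -
      have "c * normsq mu (\<lambda>x. F m x - F k x) = normsq \<nu> (\<lambda>z. H m z - T (F k) z)" by (simp add: dist FL)
      also have "\<dots> = normsq \<nu> (\<lambda>z. (H m z - P z) + (P z - H k z))"
        by (rule normsq_cong) (simp add: sp HF)
      also have "\<dots> \<le> 2 * normsq \<nu> (\<lambda>z. H m z - P z) + 2 * normsq \<nu> (\<lambda>z. P z - H k z)"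
        by (intro normsq_add_le L2_diff HL P)
      also have "normsq \<nu> (\<lambda>z. P z - H k z) = normsq \<nu> (\<lambda>z. H k z - P z)" by (rule normsq_diff_commute)
      finally have "c * normsq mu (\<lambda>x. F m x - F k x) < c * e" using N[OF mk(1)] N[OF mk(2)] by simp
      thus ?thesis using c0 by simp
    qed
    thus ?thesis by blast
  qed
  obtain f where f: "f \<in> L2 mu" and flim: "(\<lambda>k. normsq mu (\<lambda>x. F k x - f x)) \<longlonglongrightarrow> 0"
    using L2_complete[OF FL Cauchy] by blast
  have Tf: "T f \<in> L2 \<nu>" by (rule transform_isometry(1)[OF f])
  have up: "normsq \<nu> (\<lambda>z. P z - T f z) \<le> 2 * normsq \<nu> (\<lambda>z. H k z - P z) + 2 * (c * normsq mu (\<lambda>x. F k x - f x))" for k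
  proof -
    have "normsq \<nu> (\<lambda>z. (P z - H k z) + (H k z - T f z)) \<le> 2 * normsq \<nu> (\<lambda>z. P z - H k z) + 2 * normsq \<nu> (\<lambda>z. H k z - T f z)"
      by (intro normsq_add_le L2_diff HL P Tf)
    thus ?thesis using dist[OF f, of k] normsq_diff_commute[of \<nu> P "H k"] by simp
  qed
  have "(\<lambda>k. 2 * normsq \<nu> (\<lambda>z. H k z - P z) + 2 * (c * normsq mu (\<lambda>x. F k x - f x))) \<longlonglongrightarrow> 2 * 0 + 2 * (c * 0)"
    by (rule tendsto_add[OF tendsto_mult[OF tendsto_const lim] tendsto_mult[OF tendsto_const tendsto_mult[OF tendsto_const flim]]])
  hence "normsq \<nu> (\<lambda>z. P z - T f z) \<le> 2 * 0 + 2 * (c * 0)"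
    by (rule LIMSEQ_le_const) (intro exI allI impI up)
  hence n0: "normsq \<nu> (\<lambda>z. P z - T f z) = 0" using normsq_nonneg[of \<nu> "\<lambda>z. P z - T f z"] by simp
  have ipz: "ip \<nu> (\<lambda>z. P z - T f z) h = 0" if "h \<in> L2 \<nu>" for h
    using ip_Cauchy_Schwarz[OF L2_diff[OF P Tf] that] n0 by simp
  have GT: "holomorphic_several (\<lambda>z. G z - T f z) siegelU"
    unfolding T_def by (intro holomorphic_several_diff G holomorphic_several_transform_fun f)
  have "T f z = G z" if z: "z \<in> siegelU" for z
  proof -
    have k: "T (coherent n z) \<in> L2 \<nu>" by (rule reproducing_coherent(1)[OF z])
    have "of_real c * (G z - T f z) = ip \<nu> (\<lambda>y. G y - T f y) (T (coherent n z))"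
      by (rule reproducing_coherent(2)[OF z GT, symmetric]) (intro L2_diff GL Tf)
    also have "\<dots> = ip \<nu> (\<lambda>y. (G y - P y) + (P y - T f y)) (T (coherent n z))" by simp
    also have "\<dots> = ip \<nu> (\<lambda>y. G y - P y) (T (coherent n z)) + ip \<nu> (\<lambda>y. P y - T f y) (T (coherent n z))"
      by (intro ip_add_left L2_diff GL P Tf k)
    also have "\<dots> = 0"
      using orth[OF TV[OF coherent_L2(1)[OF z]]] ipz[OF k] by simp
    finally show ?thesis using c0 by simp
  qed
  thus ?thesis by (rule that[OF f])
qed

end

section \<open>From the transform to the Drury-Arveson space\<close>

lemma L2mu_eq: "L2mu = L2 mu"
  by (simp add: L2mu_def L2_def)

definition strans_const :: "'n::finite itself \<Rightarrow> real" where
  "strans_const _ = 1 / (2 * pi) ^ (CARD('n) + 1)"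

lemma strans_const_pos: "strans_const T > 0"
  by (simp add: strans_const_def)

text \<open>All conjugation is absorbed into the argument of a linear transform.\<close>

lemma Strans_eq_transform:
  "Strans (\<phi> :: ('n::finite \<Rightarrow> nat) \<times> real \<Rightarrow> complex) z
    = of_real (strans_const TYPE('n)) * transform 0 (\<lambda>x. cnj (\<phi> x)) z"
proof -
  have "(\<integral>x. (if snd x < 0 then mpow (fst z) (fst x) * exp (- \<i> * complex_of_real (snd x) * snd z)
              * cnj (\<phi> x) * complex_of_real (\<bar>snd x\<bar> ^ CARD('n)) else 0) \<partial>base_meas)
     = transform 0 (\<lambda>x. cnj (\<phi> x)) z"
    unfolding transform_def by (rule Bochner_Integration.integral_cong[OF refl]) (simp add: fourier_kernel_def)
  thus ?thesis by (simp add: Strans_def strans_const_def)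
qed

lemma DA_normsq_eq:
  fixes F :: "(complex ^ 'n::finite) \<times> complex \<Rightarrow> complex"
  assumes F: "holomorphic_several F siegelU" and n: "2 * n = \<beta> + CARD('n) + 1"
  shows "DA_normsq n F = (\<integral>\<^sup>+z. ennreal ((cmod (dlast n F z))\<^sup>2) \<partial>siegel_measure \<beta>)"
proof -
  have "continuous_on siegelU (dlast n F)"
    by (intro holomorphic_several_continuous_on holomorphic_several_dlast F open_siegelU)
  hence "(\<integral>\<^sup>+z. ennreal ((cmod (dlast n F z))\<^sup>2) \<partial>siegel_measure \<beta>) = (\<integral>\<^sup>+z. ennreal (siegel_weight \<beta> z * (cmod (dlast n F z))\<^sup>2) \<partial>lborel)"
    by (intro nn_integral_siegel_measure continuous_intros)
  also have "\<dots> = DA_normsq n F"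
    unfolding DA_normsq_def
  proof (rule nn_integral_cong)
    fix z :: "(complex ^ 'n) \<times> complex"
    show "ennreal (siegel_weight \<beta> z * (cmod (dlast n F z))\<^sup>2) = indicator siegelU z *
      ennreal ((cmod ((rho z) ^ n * dlast n F z))\<^sup>2 * (rho z) powr (- real CARD('n) - 1))"
    proof (cases "z \<in> siegelU")
      case True
      hence r: "rho z > 0" by (simp add: siegelU_def)
      have "rho z powr (- real CARD('n) - 1) = inverse (rho z ^ (CARD('n) + 1))"
      proof -
        have "- real CARD('n) - 1 = - real (CARD('n) + 1)" by simp
        thus ?thesis using r by (simp only: powr_minus powr_realpow)
      qed
      moreover have "(cmod ((rho z) ^ n * dlast n F z))\<^sup>2 = rho z ^ (2 * n) * (cmod (dlast n F z))\<^sup>2"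
        using r by (simp add: norm_mult norm_power power_mult_distrib power_mult mult.commute)
      moreover have "rho z ^ (2 * n) = rho z ^ \<beta> * rho z ^ (CARD('n) + 1)"
        unfolding n by (simp add: power_add)
      ultimately have "(cmod ((rho z) ^ n * dlast n F z))\<^sup>2 * (rho z) powr (- real CARD('n) - 1) = rho z ^ \<beta> * (cmod (dlast n F z))\<^sup>2"
        using r by (simp add: field_simps)
      thus ?thesis using True by (simp add: fiber_weight_eq)
    qed (simp add: fiber_weight_eq)
  qed
  finally show ?thesis by simp
qed

text \<open>Downward induction on the order of the derivative. If the next derivative vanishes, the
  k-th one is a constant on the convex half-plane, and Cauchy's estimate on unit discs high up
  bounds this constant by \<open>fact k\<close> times values of h that are arbitrarily small. This
  replaces the polynomial ambiguity of an n-fold antiderivative by 0.\<close>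

lemma half_plane_eq_0:
  fixes h :: "complex \<Rightarrow> complex"
  assumes h: "h holomorphic_on {w. Im w > a}"
    and lim: "\<And>\<epsilon>. \<epsilon> > 0 \<Longrightarrow> \<exists>T. \<forall>w. Im w > a \<longrightarrow> Im w > T \<longrightarrow> cmod (h w) < \<epsilon>"
    and zero: "\<And>w. Im w > a \<Longrightarrow> (deriv ^^ n) h w = 0" and w: "Im w > a"
  shows "h w = 0"
proof -
  have op: "open {w. Im w > a}" by (rule open_halfspace_Im_gt)
  have "\<forall>w. Im w > a \<longrightarrow> (deriv ^^ k) h w = 0" if "k \<le> n" for k
    using that
  proof (induction "n - k" arbitrary: k)
    case 0 thus ?case using zero by simp
  next
    case (Suc m)
    have d0: "\<forall>w. Im w > a \<longrightarrow> (deriv ^^ Suc k) h w = 0" using Suc(1)[of "Suc k"] Suc(2,3) by simp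
    have "\<exists>c. \<forall>w\<in>{w. Im w > a}. (deriv ^^ k) h w = c"
    proof (rule has_field_derivative_zero_constant)
      show "convex {w. Im w > a}" by (rule convex_halfspace_Im_gt)
      fix w assume "w \<in> {w. Im w > a}"
      thus "((deriv ^^ k) h has_field_derivative 0) (at w within {w. Im w > a})"
        using holomorphic_derivI[OF holomorphic_higher_deriv[OF h op] op, of w k] d0
        by (simp add: has_field_derivative_at_within)
    qed
    then obtain c where c: "\<And>w. Im w > a \<Longrightarrow> (deriv ^^ k) h w = c" by auto
    have "cmod c \<le> 0 + e" if e: "e > 0" for e
    proof -
      obtain T where T: "\<And>w. Im w > a \<Longrightarrow> Im w > T \<Longrightarrow> cmod (h w) < e / fact k" using lim[of "e / fact k"] e by auto
      \<comment> \<open>The + 2 keeps the closed unit disc about p strictly above both a and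
        T.\<close>
      define p where "p = \<i> * of_real (max a T + 2)"
      have im: "Im x > a" "Im x > T" if "x \<in> cball p 1" for x
        using that abs_Im_le_cmod[of "p - x"] by (auto simp: p_def dist_norm)
      have "cmod ((deriv ^^ k) h p) \<le> fact k * (e / fact k) / 1 ^ k"
      proof (rule Cauchy_inequality)
        show "h holomorphic_on ball p 1" using im by (intro holomorphic_on_subset[OF h]) auto
        show "continuous_on (cball p 1) h" using im
          by (intro holomorphic_on_imp_continuous_on holomorphic_on_subset[OF h]) auto
        show "cmod (h x) \<le> e / fact k" if "cmod (p - x) = 1" for x
          using T[of x] im[of x] that by (simp add: dist_norm)
      qed simp
      moreover have "(deriv ^^ k) h p = c" using im[of p] by (intro c) auto
      ultimately show ?thesis by simp
    qed
    hence "cmod c \<le> 0" by (rule field_le_epsilon)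
    thus ?case using c by simp
  qed
  from this[of 0] show ?thesis using w by simp
qed

definition vanishing_at_infinity :: "((complex ^ 'n::finite) \<times> complex \<Rightarrow> complex) \<Rightarrow> bool" where
  "vanishing_at_infinity F \<longleftrightarrow> (\<forall>R \<epsilon>. R > 0 \<longrightarrow> \<epsilon> > 0 \<longrightarrow> (\<exists>T. \<forall>\<zeta> w. (\<zeta>, w) \<in> siegelU \<longrightarrow> norm \<zeta> \<le> R \<longrightarrow> Im w > T
            \<longrightarrow> cmod (F (\<zeta>, w)) < \<epsilon>))"

lemma DA_n_eq: "DA_n n = {F. holomorphic_several F siegelU \<and> vanishing_at_infinity F \<and> DA_normsq n F < \<infinity>}"
  by (simp add: DA_n_def vanishing_at_infinity_def)

text \<open>For fixed first coordinate the difference is a function of one variable on a half-plane,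
  and \<open>half_plane_eq_0\<close> applies.\<close>

lemma dlast_determines:
  fixes F G :: "(complex ^ 'n::finite) \<times> complex \<Rightarrow> complex"
  assumes F: "holomorphic_several F siegelU" "vanishing_at_infinity F"
    and G: "holomorphic_several G siegelU" "vanishing_at_infinity G"
    and eq: "\<And>z. z \<in> siegelU \<Longrightarrow> dlast n F z = dlast n G z" and z: "z \<in> siegelU"
  shows "F z = G z"
proof -
  define \<zeta> where "\<zeta> = fst z"
  let ?H = "{w. Im w > (norm \<zeta>)\<^sup>2 / 4}"
  have slice: "(\<lambda>w. F (\<zeta>, w)) holomorphic_on ?H" "(\<lambda>w. G (\<zeta>, w)) holomorphic_on ?H"
    by (rule holomorphic_several_last[OF F(1) _ open_halfspace_Im_gt], simp add: fst_snd_in_siegelU)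
       (rule holomorphic_several_last[OF G(1) _ open_halfspace_Im_gt], simp add: fst_snd_in_siegelU)
  have "F (\<zeta>, snd z) - G (\<zeta>, snd z) = 0"
  proof (rule half_plane_eq_0[where h="\<lambda>w. F (\<zeta>, w) - G (\<zeta>, w)" and n=n])
    show "(\<lambda>w. F (\<zeta>, w) - G (\<zeta>, w)) holomorphic_on ?H" by (intro holomorphic_intros slice)
    show "(deriv ^^ n) (\<lambda>w. F (\<zeta>, w) - G (\<zeta>, w)) w = 0" if "(norm \<zeta>)\<^sup>2 / 4 < Im w" for w
      using higher_deriv_diff[OF slice open_halfspace_Im_gt, of w n] eq[of "(\<zeta>, w)"] that
      by (simp add: dlast_def fst_snd_in_siegelU)
    show "(norm \<zeta>)\<^sup>2 / 4 < Im (snd z)" using z by (simp add: \<zeta>_def siegelU_def rho_def)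
    fix \<epsilon> :: real assume e: "\<epsilon> > 0"
    define R where "R = norm \<zeta> + 1"
    have R: "R > 0" "norm \<zeta> \<le> R" by (auto simp: R_def add_nonneg_pos)
    obtain T1 where T1: "\<And>w. (\<zeta>, w) \<in> siegelU \<Longrightarrow> Im w > T1 \<Longrightarrow> cmod (F (\<zeta>, w)) < \<epsilon> / 2"
      using F(2) R e unfolding vanishing_at_infinity_def by (meson half_gt_zero)
    obtain T2 where T2: "\<And>w. (\<zeta>, w) \<in> siegelU \<Longrightarrow> Im w > T2 \<Longrightarrow> cmod (G (\<zeta>, w)) < \<epsilon> / 2"
      using G(2) R e unfolding vanishing_at_infinity_def by (meson half_gt_zero)
    show "\<exists>T. \<forall>w. (norm \<zeta>)\<^sup>2 / 4 < Im w \<longrightarrow> T < Im w \<longrightarrow> cmod (F (\<zeta>, w) - G (\<zeta>, w)) < \<epsilon>"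
    proof (intro exI[of _ "max T1 T2"] allI impI)
      fix w assume w: "(norm \<zeta>)\<^sup>2 / 4 < Im w" "max T1 T2 < Im w"
      have "cmod (F (\<zeta>, w)) < \<epsilon> / 2" "cmod (G (\<zeta>, w)) < \<epsilon> / 2"
        using w T1[of w] T2[of w] by (simp_all add: fst_snd_in_siegelU)
      thus "cmod (F (\<zeta>, w) - G (\<zeta>, w)) < \<epsilon>" using norm_triangle_ineq4[of "F (\<zeta>, w)" "G (\<zeta>, w)"] by linarith
    qed
  qed
  thus ?thesis by (simp add: \<zeta>_def)
qed

text \<open>\<open>transform_bound\<close> at n = 0 bounds the squared modulus by a constant over
  \<open>2 * rho\<close>, and rho is at least \<open>Im w - R^2 / 4\<close> for first coordinates of
  norm at most R.\<close>

lemma vanishing_at_infinity_transform: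
  assumes f: "f \<in> L2 mu" shows "vanishing_at_infinity (\<lambda>z. of_real k * transform 0 f z)"
  unfolding vanishing_at_infinity_def
proof (intro allI impI)
  fix R \<epsilon> :: real assume e: "\<epsilon> > 0"
  \<comment> \<open>A lower bound for rho that makes the estimate less than
    \<open>\<epsilon>^2\<close>; the + 1 makes A positive and the estimate strict.\<close>
  define A where "A = k\<^sup>2 * normsq mu f / \<epsilon>\<^sup>2 + 1"
  have A: "A > 0" unfolding A_def by (intro add_nonneg_pos) auto
  show "\<exists>T. \<forall>\<zeta> w. (\<zeta>, w) \<in> siegelU \<longrightarrow> norm \<zeta> \<le> R \<longrightarrow> Im w > T \<longrightarrow> cmod (of_real k * transform 0 f (\<zeta>, w)) < \<epsilon>"
  proof (intro exI[of _ "R\<^sup>2 / 4 + A"] allI impI)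
    fix \<zeta> :: "complex ^ 'a" and w assume z: "(\<zeta>, w) \<in> siegelU" "norm \<zeta> \<le> R" "Im w > R\<^sup>2 / 4 + A"
    have "(norm \<zeta>)\<^sup>2 \<le> R\<^sup>2" using z(2) by (intro power_mono) auto
    hence r: "rho (\<zeta>, w) > A" using z(3) by (simp add: rho_def)
    have "(cmod (of_real k * transform 0 f (\<zeta>, w)))\<^sup>2 = k\<^sup>2 * (cmod (transform 0 f (\<zeta>, w)))\<^sup>2"
      by (simp add: norm_mult power_mult_distrib)
    also have "\<dots> \<le> k\<^sup>2 * (normsq mu f * (fact (2 * 0) / (2 * rho (\<zeta>, w)) ^ Suc (2 * 0)))"
      by (intro mult_left_mono transform_bound f z) auto
    also have "\<dots> = k\<^sup>2 * normsq mu f / (2 * rho (\<zeta>, w))" by simp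
    also have "\<dots> < \<epsilon>\<^sup>2"
    proof -
      have "k\<^sup>2 * normsq mu f = \<epsilon>\<^sup>2 * (A - 1)" using e by (simp add: A_def)
      also have "\<dots> < \<epsilon>\<^sup>2 * (2 * rho (\<zeta>, w))" using e r A by (intro mult_strict_left_mono) auto
      finally show ?thesis using r A by (simp add: field_simps)
    qed
    finally show "cmod (of_real k * transform 0 f (\<zeta>, w)) < \<epsilon>"
      by (rule power2_less_imp_less) (use e in simp)
  qed
qed

lemma transform_in_DA_n:
  fixes f :: "('n::finite \<Rightarrow> nat) \<times> real \<Rightarrow> complex"
  assumes f: "f \<in> L2 mu" and n: "2 * n > CARD('n)"
  defines "\<beta> \<equiv> 2 * n - CARD('n) - 1"
  shows "DA_normsq n (\<lambda>z. of_real k * transform 0 f z) =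
      ennreal (k\<^sup>2 * (fact (2 * n) * siegel_const \<beta> TYPE('n) * normsq mu f))"
    and "(\<lambda>z. of_real k * transform 0 f z) \<in> DA_n n"
proof -
  have n\<beta>: "2 * n = \<beta> + CARD('n) + 1" using n by (simp add: \<beta>_def)
  have hs: "holomorphic_several (\<lambda>z. of_real k * transform 0 f z) siegelU"
    by (intro holomorphic_several_cmult holomorphic_several_transform_fun f)
  have "DA_normsq n (\<lambda>z. of_real k * transform 0 f z)
    = (\<integral>\<^sup>+z. ennreal ((cmod (of_real k * transform n f z))\<^sup>2) \<partial>siegel_measure \<beta>)"
    unfolding DA_normsq_eq[OF hs n\<beta>]
    by (rule nn_integral_cong) (simp add: dlast_transform[OF f])
  also have "\<dots> = ennreal (normsq (siegel_measure \<beta>) (\<lambda>z. of_real k * transform n f z))"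
    by (rule nn_integral_L2[OF L2_cmult[OF transform_isometry(1)[OF n\<beta> f]]])
  also have "\<dots> = ennreal (k\<^sup>2 * (fact (2 * n) * siegel_const \<beta> TYPE('n) * normsq mu f))"
    by (simp add: normsq_cmult transform_isometry(2)[OF n\<beta> f])
  finally show *: "DA_normsq n (\<lambda>z. of_real k * transform 0 f z) =
      ennreal (k\<^sup>2 * (fact (2 * n) * siegel_const \<beta> TYPE('n) * normsq mu f))" .
  show "(\<lambda>z. of_real k * transform 0 f z) \<in> DA_n n"
    using hs vanishing_at_infinity_transform[OF f, of k] by (simp add: DA_n_eq *)
qed

text \<open>The n-th derivative of F is a Bergman function, hence \<open>transform n f\<close> for
  some f. Then F and \<open>transform 0 f\<close> share their n-th derivative and their vanishing at
  infinity. The representation by \<open>transform 0\<close> no longer mentions n, so it fits every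
  member of the union \<open>DA\<close>.\<close>

lemma DA_n_eq_transform:
  fixes F :: "(complex ^ 'n::finite) \<times> complex \<Rightarrow> complex"
  assumes F: "F \<in> DA_n n" and n: "2 * n > CARD('n)"
  obtains f where "f \<in> L2 mu" "\<And>z. z \<in> siegelU \<Longrightarrow> transform 0 f z = F z"
proof -
  define \<beta> where "\<beta> = 2 * n - CARD('n) - 1"
  have n\<beta>: "2 * n = \<beta> + CARD('n) + 1" using n by (simp add: \<beta>_def)
  have hs: "holomorphic_several F siegelU" "vanishing_at_infinity F" and fin: "DA_normsq n F < \<infinity>"
    using F by (auto simp: DA_n_eq)
  have G: "holomorphic_several (dlast n F) siegelU" by (intro holomorphic_several_dlast hs open_siegelU)
  have "dlast n F \<in> L2 (siegel_measure \<beta>)"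
    using fin unfolding DA_normsq_eq[OF hs(1) n\<beta>]
    by (intro L2I_nn measurable_siegel_measureI holomorphic_several_continuous_on G)
  from transform_surjective[OF n\<beta> G this]
  obtain f where f: "f \<in> L2 mu" "\<And>z. z \<in> siegelU \<Longrightarrow> transform n f z = dlast n F z" by blast
  have "transform 0 f z = F z" if z: "z \<in> siegelU" for z
  proof (rule dlast_determines[OF _ _ hs _ z, of _ n])
    show "holomorphic_several (transform 0 f) siegelU" by (rule holomorphic_several_transform_fun[OF f(1)])
    show "vanishing_at_infinity (transform 0 f)"
      using vanishing_at_infinity_transform[OF f(1), of 1] by simp
    show "dlast n (transform 0 f) z = dlast n F z" if "z \<in> siegelU" for z
      using dlast_transform[OF f(1) that, of n 1] f(2)[OF that] by simp
  qed
  thus ?thesis using that f(1) by blast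
qed

text \<open>Elements of \<open>DA\<close> are total functions constrained only on the domain, so
  bijectivity is expressed with equality on \<open>siegelU\<close> on one side and equality almost
  everywhere for \<open>mu\<close> on the other.\<close>

theorem theorem1p4:
  fixes dummy :: "'n::finite itself"
  shows
   "(\<forall>\<phi> \<in> (L2mu :: (('n \<Rightarrow> nat) \<times> real \<Rightarrow> complex) set). Strans \<phi> \<in> DA) \<and>
    (\<forall>\<phi> \<in> (L2mu :: (('n \<Rightarrow> nat) \<times> real \<Rightarrow> complex) set). \<forall>\<psi> \<in> L2mu. \<forall>a b.
        \<forall>z \<in> siegelU. Strans (\<lambda>x. a * \<phi> x + b * \<psi> x) z = cnj a * Strans \<phi> z + cnj b * Strans \<psi> z) \<and>
    (\<forall>\<phi> \<in> (L2mu :: (('n \<Rightarrow> nat) \<times> real \<Rightarrow> complex) set). \<forall>\<psi> \<in> L2mu.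
        (\<forall>z \<in> siegelU. Strans \<phi> z = Strans \<psi> z) \<longrightarrow> (AE x in mu. \<phi> x = \<psi> x)) \<and>
    (\<forall>F \<in> (DA :: ((complex ^ 'n) \<times> complex \<Rightarrow> complex) set).
        \<exists>\<phi> \<in> L2mu. \<forall>z \<in> siegelU. Strans \<phi> z = F z) \<and>
    (\<forall>n::nat. 2 * n > CARD('n) \<longrightarrow>
        (\<exists>c > 0. \<forall>\<phi> \<in> (L2mu :: (('n \<Rightarrow> nat) \<times> real \<Rightarrow> complex) set).
            DA_norm n (Strans \<phi>) = c * L2norm \<phi>))"
proof (intro conjI ballI allI impI)
  let ?k = "strans_const TYPE('n)"
  have k: "?k > 0" by (rule strans_const_pos)
  have S: "Strans \<phi> = (\<lambda>z. of_real ?k * transform 0 (\<lambda>x. cnj (\<phi> x)) z)" for \<phi> :: "('n \<Rightarrow> nat) \<times> real \<Rightarrow> complex"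
    by (rule ext) (rule Strans_eq_transform)
  {
    fix \<phi> :: "('n \<Rightarrow> nat) \<times> real \<Rightarrow> complex" assume "\<phi> \<in> L2mu"
    hence "(\<lambda>x. cnj (\<phi> x)) \<in> L2 mu" by (intro L2_cnj) (simp add: L2mu_eq)
    \<comment> \<open>Any n > d/2 would do as a witness for the union; n = d qualifies because d is
      positive.\<close>
    hence "Strans \<phi> \<in> DA_n CARD('n)" unfolding S by (rule transform_in_DA_n(2)) simp
    thus "Strans \<phi> \<in> DA" unfolding DA_def by (intro UN_I[of "CARD('n)"]) auto
  next
    fix \<phi> \<psi> :: "('n \<Rightarrow> nat) \<times> real \<Rightarrow> complex" and a b :: complex and z :: "(complex ^ 'n) \<times> complex"
    assume "\<phi> \<in> L2mu" "\<psi> \<in> L2mu" and z: "z \<in> siegelU"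
    hence "(\<lambda>x. cnj a * cnj (\<phi> x)) \<in> L2 mu" "(\<lambda>x. cnj b * cnj (\<psi> x)) \<in> L2 mu"
      by (auto intro!: L2_cmult L2_cnj simp: L2mu_eq)
    from transform_add[OF this z, of 0]
    show "Strans (\<lambda>x. a * \<phi> x + b * \<psi> x) z = cnj a * Strans \<phi> z + cnj b * Strans \<psi> z"
      by (simp add: S transform_cmult algebra_simps)
  next
    fix \<phi> \<psi> :: "('n \<Rightarrow> nat) \<times> real \<Rightarrow> complex"
    assume "\<phi> \<in> L2mu" "\<psi> \<in> L2mu" and eq: "\<forall>z\<in>siegelU. Strans \<phi> z = Strans \<psi> z"
    hence L: "(\<lambda>x. cnj (\<phi> x)) \<in> L2 mu" "(\<lambda>x. cnj (\<psi> x)) \<in> L2 mu"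
      by (auto intro!: L2_cnj simp: L2mu_eq)
    have "AE x in mu. cnj (\<phi> x) - cnj (\<psi> x) = 0"
    proof (rule transform_injective[OF L2_diff[OF L]])
      show "transform 0 (\<lambda>x. cnj (\<phi> x) - cnj (\<psi> x)) z = 0" if "z \<in> siegelU" for z
        using eq that k by (simp add: transform_diff[OF L that] S)
    qed
    thus "AE x in mu. \<phi> x = \<psi> x" by eventually_elim simp
  next
    fix F :: "(complex ^ 'n) \<times> complex \<Rightarrow> complex" assume "F \<in> DA"
    then obtain n where "2 * n > CARD('n)" "F \<in> DA_n n" by (auto simp: DA_def)
    then obtain f where f: "f \<in> L2 mu" "\<And>z. z \<in> siegelU \<Longrightarrow> transform 0 f z = F z"
      using DA_n_eq_transform by blast
    \<comment> \<open>Conjugation and the factor \<open>1 / ?k\<close> undo what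
      \<open>Strans\<close> adds to \<open>transform 0\<close>.\<close>
    have "(\<lambda>x. of_real (1 / ?k) * cnj (f x)) \<in> L2mu"
      unfolding L2mu_eq by (intro L2_cmult L2_cnj f)
    moreover have "Strans (\<lambda>x. of_real (1 / ?k) * cnj (f x)) z = F z" if "z \<in> siegelU" for z
    proof -
      have "Strans (\<lambda>x. of_real (1 / ?k) * cnj (f x)) z = of_real ?k * (of_real (1 / ?k) * transform 0 f z)"
        by (simp add: S transform_cmult[symmetric])
      thus ?thesis using f(2)[OF that] k by simp
    qed
    ultimately show "\<exists>\<phi>\<in>L2mu. \<forall>z\<in>siegelU. Strans \<phi> z = F z" by blast
  next
    fix n :: nat assume n: "CARD('n) < 2 * n"
    \<comment> \<open>The constant of the isometry for squared norms of \<open>transform n\<close>;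
      hence the square root, and \<open>?k\<close> from the prefactor of
      \<open>Strans\<close>.\<close>
    define c where "c = fact (2 * n) * siegel_const (2 * n - CARD('n) - 1) TYPE('n)"
    have c: "c > 0" unfolding c_def using siegel_const_pos[where 'n='n] by simp
    have "DA_norm n (Strans \<phi>) = (?k * sqrt c) * L2norm \<phi>" if "\<phi> \<in> L2mu" for \<phi> :: "('n \<Rightarrow> nat) \<times> real \<Rightarrow> complex"
    proof -
      have f: "(\<lambda>x. cnj (\<phi> x)) \<in> L2 mu" using that by (intro L2_cnj) (simp add: L2mu_eq)
      have e: "normsq mu (\<lambda>x. cnj (\<phi> x)) = normsq mu \<phi>" by (simp add: normsq_def)
      have "DA_normsq n (Strans \<phi>) = ennreal (?k\<^sup>2 * (c * normsq mu \<phi>))"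
        unfolding S transform_in_DA_n(1)[OF f n] e c_def ..
      hence "DA_norm n (Strans \<phi>) = sqrt (?k\<^sup>2 * (c * normsq mu \<phi>))"
        using c by (simp add: DA_norm_def)
      also have "\<dots> = (?k * sqrt c) * L2norm \<phi>"
        using k by (simp add: real_sqrt_mult L2norm_def normsq_def)
      finally show ?thesis .
    qed
    thus "\<exists>c>0. \<forall>\<phi>\<in>(L2mu :: (('n \<Rightarrow> nat) \<times> real \<Rightarrow> complex) set). DA_norm n (Strans \<phi>) = c * L2norm \<phi>"
      using k c by (intro exI[of _ "?k * sqrt c"]) auto
  }
qed

end
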